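(* Let $G$ be a fixed even Coxeter group with generating set $\Sigma$. There is a deterministic logspace transducer which, on input a word $w\in\Sigma^*$, computes the Parikh-image of the shortlex normal form of (the element of $G$ represented by) $w$.
   Context: A Coxeter group $G$ is given by a generating set $\Sigma=\{a_1,\ldots,a_n\}$ and a symmetric $n\times n$ matrix $M=(m_{i,j})$ over $\mathbb{N}=\{0,1,2,\ldots\}$ with $m_{i,j}=1\iff i=j$; the defining relations are $(a_ia_j)^{m_{i,j}}=1$ for $1\le i,j\le n$. (An entry $m_{i,j}=0$ means no relation; it plays the role of $\infty$.) The Coxeter group is even if all $m_{i,j}$ with $i\ne j$ are even numbers ($0$ is allowed). A geodesic for $g\in G$ is a word in $\Sigma^*$ of minimal length among all words representing $g$. With a fixed linear order on $\Sigma$, the shortlex normal form of $g$ is the lexicographically first word among all geodesics for $g$. The Parikh-image of a word $v\in\Sigma^*$ is the vector $[\,|v|_a\,]_{a\in\Sigma}\in\mathbb{N}^\Sigma$, where $|v|_a$ is the number of occurrences of $a$ in $v$. A deterministic logspace transducer is a deterministic Turing machine with a read-only input tape, a read/write work tape of length $\mathcal{O}(\log n)$ (where here $n$ is the input length), and a write-only output tape written sequentially from left to right. The group (its generators and matrix) is fixed and is not part of the input. *)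

theory Defs
  imports "HOL-Algebra.Group" "HOL-Library.Landau_Symbols"
begin

section \<open>Groups given by generators and relators\<close>

text \<open>
  A group word over the generating set \<open>S\<close> is a list of pairs \<open>(a, s)\<close>, where \<open>(a, True)\<close> stands
  for the generator \<open>a\<close> and \<open>(a, False)\<close> for its formal inverse.
\<close>

definition group_words :: "'a set \<Rightarrow> ('a \<times> bool) list set" where
  "group_words S = lists (S \<times> UNIV)"

inductive pres_eq :: "'a set \<Rightarrow> ('a \<times> bool) list set \<Rightarrow> ('a \<times> bool) list \<Rightarrow> ('a \<times> bool) list \<Rightarrow> bool"
  for S R where
  refl: "u \<in> group_words S \<Longrightarrow> pres_eq S R u u"
| sym: "pres_eq S R u v \<Longrightarrow> pres_eq S R v u"
| trans: "pres_eq S R u v \<Longrightarrow> pres_eq S R v w \<Longrightarrow> pres_eq S R u w"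
| cong: "pres_eq S R u v \<Longrightarrow> pres_eq S R u' v' \<Longrightarrow> pres_eq S R (u @ u') (v @ v')"
| cancel: "a \<in> S \<Longrightarrow> pres_eq S R [(a, s), (a, \<not> s)] []"
| relator: "r \<in> R \<Longrightarrow> r \<in> group_words S \<Longrightarrow> pres_eq S R r []"

definition pres_rel :: "'a set \<Rightarrow> ('a \<times> bool) list set \<Rightarrow> (('a \<times> bool) list \<times> ('a \<times> bool) list) set" where
  "pres_rel S R = {(u, v). pres_eq S R u v}"

definition presented_group :: "'a set \<Rightarrow> ('a \<times> bool) list set \<Rightarrow> ('a \<times> bool) list set monoid" where
  "presented_group S R =
     \<lparr>carrier = group_words S // pres_rel S R,
      mult = (\<lambda>A B. \<Union>u\<in>A. \<Union>v\<in>B. pres_rel S R `` {u @ v}),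
      one = pres_rel S R `` {[]}\<rparr>"

lemma pres_eq_words: "pres_eq S R u v \<Longrightarrow> u \<in> group_words S \<and> v \<in> group_words S"
  by (induction rule: pres_eq.induct) (auto simp: group_words_def)

lemma equiv_pres_rel: "equiv (group_words S) (pres_rel S R)"
proof (rule equivI)
  show "pres_rel S R \<subseteq> group_words S \<times> group_words S"
    by (auto simp: pres_rel_def dest: pres_eq_words)
  show "refl_on (group_words S) (pres_rel S R)"
    by (auto simp: refl_on_def pres_rel_def intro: pres_eq.refl)
  show "sym (pres_rel S R)"
    by (auto simp: sym_def pres_rel_def intro: pres_eq.sym)
  show "trans (pres_rel S R)"
    by (auto simp: trans_def pres_rel_def intro: pres_eq.trans)
qed

lemma presented_group_mult:
  assumes "u \<in> group_words S" "v \<in> group_words S"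
  shows "(pres_rel S R `` {u}) \<otimes>\<^bsub>presented_group S R\<^esub> (pres_rel S R `` {v}) = pres_rel S R `` {u @ v}"
proof -
  have "congruent2 (pres_rel S R) (pres_rel S R) (\<lambda>u v. pres_rel S R `` {u @ v})"
    unfolding congruent2_def
    by (auto intro!: equiv_class_eq[OF equiv_pres_rel]) (auto simp: pres_rel_def intro: pres_eq.cong)
  from UN_equiv_class2[OF equiv_pres_rel equiv_pres_rel this assms]
  show ?thesis by (simp add: presented_group_def)
qed

lemma group_words_append: "u \<in> group_words S \<Longrightarrow> v \<in> group_words S \<Longrightarrow> u @ v \<in> group_words S"
  by (simp add: group_words_def)

lemma pres_eq_inverse:
  "u \<in> group_words S \<Longrightarrow> pres_eq S R (rev (map (\<lambda>(a, s). (a, \<not> s)) u) @ u) []"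
proof (induction u)
  case Nil
  then show ?case by (auto intro: pres_eq.refl)
next
  case (Cons x u)
  obtain a s where x: "x = (a, s)" by (cases x)
  have a: "a \<in> S" and u: "u \<in> group_words S" using Cons.prems by (auto simp: group_words_def x)
  let ?v = "rev (map (\<lambda>(a, s). (a, \<not> s)) u)"
  have v: "?v \<in> group_words S" using u by (fastforce simp: group_words_def in_lists_conv_set)
  have 1: "pres_eq S R [(a, \<not> s), (a, s)] []"
    using pres_eq.cancel[OF a, of R "\<not> s"] by simp
  have "pres_eq S R (?v @ [(a, \<not> s), (a, s)] @ u) (?v @ [] @ u)"
    by (intro pres_eq.cong[OF pres_eq.refl[OF v]] pres_eq.cong[OF 1] pres_eq.refl u)
  with Cons.IH[OF u] show ?case by (auto simp: x intro: pres_eq.trans)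
qed

lemma group_presented_group: "group (presented_group S R)"
proof (rule groupI)
  let ?G = "presented_group S R" and ?c = "\<lambda>u. pres_rel S R `` {u}"
  have nil: "[] \<in> group_words S" by (simp add: group_words_def)
  have car: "x \<in> carrier ?G \<longleftrightarrow> (\<exists>u \<in> group_words S. x = ?c u)" for x
    by (auto simp: presented_group_def quotient_def)
  have one: "\<one>\<^bsub>?G\<^esub> = ?c []" by (simp add: presented_group_def)
  note mult = presented_group_mult group_words_append
  show "\<one>\<^bsub>?G\<^esub> \<in> carrier ?G" unfolding car one using nil by blast
  show "x \<otimes>\<^bsub>?G\<^esub> y \<in> carrier ?G" if "x \<in> carrier ?G" "y \<in> carrier ?G" for x y
  proof -
    from that obtain u v where "u \<in> group_words S" "v \<in> group_words S" "x = ?c u" "y = ?c v"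
      unfolding car by blast
    then show ?thesis unfolding car using mult by metis
  qed
  show "x \<otimes>\<^bsub>?G\<^esub> y \<otimes>\<^bsub>?G\<^esub> z = x \<otimes>\<^bsub>?G\<^esub> (y \<otimes>\<^bsub>?G\<^esub> z)"
    if "x \<in> carrier ?G" "y \<in> carrier ?G" "z \<in> carrier ?G" for x y z
    using that unfolding car by (elim bexE) (simp add: mult)
  show "\<one>\<^bsub>?G\<^esub> \<otimes>\<^bsub>?G\<^esub> x = x" if "x \<in> carrier ?G" for x
    using that unfolding car one by (elim bexE) (simp add: mult nil)
  show "\<exists>y\<in>carrier ?G. y \<otimes>\<^bsub>?G\<^esub> x = \<one>\<^bsub>?G\<^esub>" if x: "x \<in> carrier ?G" for x
  proof -
    from x obtain u where u: "u \<in> group_words S" "x = ?c u" unfolding car by blast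
    let ?v = "rev (map (\<lambda>(a, s). (a, \<not> s)) u)"
    have v: "?v \<in> group_words S" using u(1) by (fastforce simp: group_words_def in_lists_conv_set)
    have "?c (?v @ u) = ?c []"
      by (rule equiv_class_eq[OF equiv_pres_rel]) (use pres_eq_inverse[OF u(1)] in \<open>simp add: pres_rel_def\<close>)
    then have "?c ?v \<otimes>\<^bsub>?G\<^esub> x = \<one>\<^bsub>?G\<^esub>" using u v by (simp add: mult one)
    moreover have "?c ?v \<in> carrier ?G" unfolding car using v by blast
    ultimately show ?thesis by blast
  qed
qed

section \<open>Coxeter groups\<close>

definition coxeter_matrix :: "'a set \<Rightarrow> ('a \<Rightarrow> 'a \<Rightarrow> nat) \<Rightarrow> bool" where
  "coxeter_matrix S m \<longleftrightarrow> finite S \<and>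
     (\<forall>a\<in>S. \<forall>b\<in>S. m a b = m b a) \<and> (\<forall>a\<in>S. \<forall>b\<in>S. m a b = 1 \<longleftrightarrow> a = b)"

definition even_coxeter_matrix :: "'a set \<Rightarrow> ('a \<Rightarrow> 'a \<Rightarrow> nat) \<Rightarrow> bool" where
  "even_coxeter_matrix S m \<longleftrightarrow>
     coxeter_matrix S m \<and> (\<forall>a\<in>S. \<forall>b\<in>S. a \<noteq> b \<longrightarrow> even (m a b))"

definition positive_word :: "'a list \<Rightarrow> ('a \<times> bool) list" where
  "positive_word w = map (\<lambda>a. (a, True)) w"

text \<open>For \<open>m a b = 0\<close> the relator is the empty word, i.e. it imposes no relation.\<close>

definition coxeter_relators :: "'a set \<Rightarrow> ('a \<Rightarrow> 'a \<Rightarrow> nat) \<Rightarrow> ('a \<times> bool) list set" where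
  "coxeter_relators S m =
     {positive_word (concat (replicate (m a b) [a, b])) | a b. a \<in> S \<and> b \<in> S}"

definition coxeter_group :: "'a set \<Rightarrow> ('a \<Rightarrow> 'a \<Rightarrow> nat) \<Rightarrow> ('a \<times> bool) list set monoid" where
  "coxeter_group S m = presented_group S (coxeter_relators S m)"

definition element_of :: "'a set \<Rightarrow> ('a \<Rightarrow> 'a \<Rightarrow> nat) \<Rightarrow> 'a list \<Rightarrow> ('a \<times> bool) list set" where
  "element_of S m w = pres_rel S (coxeter_relators S m) `` {positive_word w}"

lemma group_coxeter_group: "group (coxeter_group S m)"
  by (simp add: coxeter_group_def group_presented_group)

lemma positive_word_words: "w \<in> lists S \<Longrightarrow> positive_word w \<in> group_words S"
  by (auto simp: positive_word_def group_words_def in_lists_conv_set)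

lemma element_of_closed: "w \<in> lists S \<Longrightarrow> element_of S m w \<in> carrier (coxeter_group S m)"
  by (simp add: element_of_def coxeter_group_def presented_group_def quotientI positive_word_words)

lemma element_of_Nil: "element_of S m [] = \<one>\<^bsub>coxeter_group S m\<^esub>"
  by (simp add: element_of_def coxeter_group_def presented_group_def positive_word_def)

lemma element_of_append:
  assumes "v \<in> lists S" "w \<in> lists S"
  shows "element_of S m (v @ w) = element_of S m v \<otimes>\<^bsub>coxeter_group S m\<^esub> element_of S m w"
  using presented_group_mult[OF positive_word_words positive_word_words, OF assms]
  by (simp add: element_of_def coxeter_group_def positive_word_def)

section \<open>Geodesics, shortlex normal forms and Parikh-images\<close>

definition geodesic :: "'a set \<Rightarrow> ('a \<Rightarrow> 'a \<Rightarrow> nat) \<Rightarrow> ('a \<times> bool) list set \<Rightarrow> 'a list \<Rightarrow> bool" where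
  "geodesic S m g v \<longleftrightarrow> v \<in> lists S \<and> element_of S m v = g \<and>
     (\<forall>u\<in>lists S. element_of S m u = g \<longrightarrow> length v \<le> length u)"

definition is_shortlex_nf ::
    "'a::linorder set \<Rightarrow> ('a \<Rightarrow> 'a \<Rightarrow> nat) \<Rightarrow> ('a \<times> bool) list set \<Rightarrow> 'a list \<Rightarrow> bool" where
  "is_shortlex_nf S m g v \<longleftrightarrow> geodesic S m g v \<and>
     (\<forall>u. geodesic S m g u \<longrightarrow> u = v \<or> (v, u) \<in> lexord {(a, b). a < b})"

definition shortlex_nf ::
    "'a::linorder set \<Rightarrow> ('a \<Rightarrow> 'a \<Rightarrow> nat) \<Rightarrow> ('a \<times> bool) list set \<Rightarrow> 'a list" where
  "shortlex_nf S m g = (THE v. is_shortlex_nf S m g v)"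

definition parikh_image :: "'a set \<Rightarrow> 'a list \<Rightarrow> 'a \<Rightarrow> nat" where
  "parikh_image S v = (\<lambda>a\<in>S. count_list v a)"

lemma lexord_less_finite_least:
  fixes A :: "'a::linorder list set"
  assumes "finite A" "A \<noteq> {}"
  shows "\<exists>v\<in>A. \<forall>u\<in>A. u = v \<or> (v, u) \<in> lexord {(a, b). a < b}"
  using assms
proof (induction rule: finite_ne_induct)
  case (singleton x)
  then show ?case by simp
next
  case (insert x F)
  let ?r = "lexord {(a::'a, b). a < b}"
  from insert.IH obtain v where v: "v \<in> F" "\<forall>u\<in>F. u = v \<or> (v, u) \<in> ?r" by blast
  have "(x, v) \<in> ?r \<or> x = v \<or> (v, x) \<in> ?r" by (rule lexord_linear) auto
  moreover have "trans ?r" by (rule lexord_transI) (auto simp: trans_def)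
  ultimately show ?case using v by (metis insert_iff transD)
qed

lemma ex1_shortlex_nf:
  fixes S :: "'a::linorder set"
  assumes "finite S" "w \<in> lists S"
  shows "\<exists>!v. is_shortlex_nf S m (element_of S m w) v"
proof -
  let ?g = "element_of S m w" and ?r = "lexord {(a::'a, b). a < b}"
  let ?A = "{v. geodesic S m ?g v}"
  obtain v where "v \<in> lists S \<and> element_of S m v = ?g"
    "\<And>u. u \<in> lists S \<and> element_of S m u = ?g \<Longrightarrow> length v \<le> length u"
    using ex_has_least_nat[of "\<lambda>v. v \<in> lists S \<and> element_of S m v = ?g" w length] assms(2) by auto
  then have v: "geodesic S m ?g v" by (simp add: geodesic_def)
  have "?A \<subseteq> {u. set u \<subseteq> S \<and> length u \<le> length v}"
    using v by (auto simp: geodesic_def)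
  then have "finite ?A" using finite_lists_length_le[OF assms(1)] by (rule finite_subset)
  from lexord_less_finite_least[OF this] v
  obtain z where z: "is_shortlex_nf S m ?g z" by (auto simp: is_shortlex_nf_def)
  have "asym ?r" by (rule lexord_asym) (auto intro!: asymI)
  then have "x = y" if "is_shortlex_nf S m ?g x" "is_shortlex_nf S m ?g y" for x y
    using that by (metis is_shortlex_nf_def asymD)
  with z show ?thesis by blast
qed

section \<open>Logspace transducers\<close>

text \<open>
  On input \<open>w\<close> the read-only tape has the cells \<open>0, \<dots>, length w + 1\<close>, the first and the last of which
  carry the end markers.  The work tape is infinite to the right only; a move to the left in cell 0
  has no effect.  In each step at most one symbol is appended to the output, which is never read.
  States and work symbols are coded by natural numbers.
\<close>

datatype 'a input_symbol = LeftEnd | Letter 'a | RightEnd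

datatype move = MoveLeft | Stay | MoveRight

record ('a, 'o) transducer =
  states :: "nat set"
  work_symbols :: "nat set"
  initial_state :: nat
  halting_states :: "nat set"
  blank_symbol :: nat
  transition ::
    "nat \<Rightarrow> 'a input_symbol \<Rightarrow> nat \<Rightarrow> nat \<times> nat \<times> move \<times> move \<times> 'o option"

record 'o config =
  cur_state :: nat
  input_head :: nat
  work_tape :: "nat \<Rightarrow> nat"
  work_head :: nat
  output_tape :: "'o list"

definition transducer :: "'a set \<Rightarrow> ('a, 'o) transducer \<Rightarrow> bool" where
  "transducer S T \<longleftrightarrow>
     finite (states T) \<and> finite (work_symbols T) \<and>
     initial_state T \<in> states T \<and> halting_states T \<subseteq> states T \<and> blank_symbol T \<in> work_symbols T \<and>
     (\<forall>q\<in>states T. \<forall>x \<in> insert LeftEnd (insert RightEnd (Letter ` S)). \<forall>c\<in>work_symbols T.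
        case transition T q x c of (q', c', _) \<Rightarrow> q' \<in> states T \<and> c' \<in> work_symbols T)"

definition input_cell :: "'a list \<Rightarrow> nat \<Rightarrow> 'a input_symbol" where
  "input_cell w i =
     (if i = 0 then LeftEnd else if i \<le> length w then Letter (w ! (i - 1)) else RightEnd)"

fun move_head :: "move \<Rightarrow> nat \<Rightarrow> nat" where
  "move_head MoveLeft i = i - 1"
| "move_head Stay i = i"
| "move_head MoveRight i = i + 1"

definition initial_config :: "('a, 'o) transducer \<Rightarrow> 'o config" where
  "initial_config T =
     \<lparr>cur_state = initial_state T, input_head = 0, work_tape = (\<lambda>_. blank_symbol T),
      work_head = 0, output_tape = []\<rparr>"

definition step :: "('a, 'o) transducer \<Rightarrow> 'a list \<Rightarrow> 'o config \<Rightarrow> 'o config" where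
  "step T w c =
     (if cur_state c \<in> halting_states T then c
      else case transition T (cur_state c) (input_cell w (input_head c)) (work_tape c (work_head c))
        of (q, b, d, e, out) \<Rightarrow>
          \<lparr>cur_state = q,
           input_head = min (length w + 1) (move_head d (input_head c)),
           work_tape = (work_tape c)(work_head c := b),
           work_head = move_head e (work_head c),
           output_tape = output_tape c @ (case out of None \<Rightarrow> [] | Some x \<Rightarrow> [x])\<rparr>)"

definition run :: "('a, 'o) transducer \<Rightarrow> 'a list \<Rightarrow> nat \<Rightarrow> 'o config" where
  "run T w t = (step T w ^^ t) (initial_config T)"

definition logspace_transducer :: "'a set \<Rightarrow> ('a, 'o) transducer \<Rightarrow> bool" where
  "logspace_transducer S T \<longleftrightarrow> transducer S T \<and>
     (\<exists>s :: nat \<Rightarrow> nat. (\<lambda>n. real (s n)) \<in> O(\<lambda>n. ln (real n)) \<and>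
        (\<forall>w\<in>lists S. \<forall>t. work_head (run T w t) < s (length w)))"

definition computes :: "('a, 'o) transducer \<Rightarrow> 'a list \<Rightarrow> 'o list \<Rightarrow> bool" where
  "computes T w v \<longleftrightarrow>
     (\<exists>t. cur_state (run T w t) \<in> halting_states T \<and> output_tape (run T w t) = v)"

section \<open>Vectors of natural numbers as output words\<close>

text \<open>
  The entries are written in the order of the index set, each in binary (most significant bit
  first, zero being the single digit 0) and followed by a separator.
\<close>

datatype output_symbol = Bit bool | Separator

fun binary :: "nat \<Rightarrow> bool list" where
  "binary n = (if n < 2 then [n = 1] else binary (n div 2) @ [odd n])"

declare binary.simps [simp del]

definition encode_vector :: "'a::linorder set \<Rightarrow> ('a \<Rightarrow> nat) \<Rightarrow> output_symbol list" where
  "encode_vector S f =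
     concat (map (\<lambda>a. map Bit (binary (f a)) @ [Separator]) (sorted_list_of_set S))"

end

theory Submission
  imports Defs "HOL-Real_Asymp.Real_Asymp"
begin

text \<open>
  For a word \<open>w = a\<^sub>1 \<dots> a\<^sub>n\<close> let \<open>t\<^sub>i = a\<^sub>1 \<dots> a\<^sub>i \<dots> a\<^sub>1\<close>. The set of reflections \<open>t\<close> for which the
  number of \<open>i\<close> with \<open>t\<^sub>i = t\<close> is odd depends only on the element represented by \<open>w\<close>, and for a
  geodesic the \<open>t\<^sub>i\<close> are pairwise distinct. In an even Coxeter group \<open>t\<^sub>i = t\<^sub>j\<close> implies \<open>a\<^sub>i = a\<^sub>j\<close>, so the
  number of occurrences of \<open>a\<close> in any geodesic is the number of odd reflections of type \<open>a\<close>. Reading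
  \<open>w\<close> from left to right, this number goes up or down by one at each letter \<open>a\<close>, according to the
  parity of the number of earlier positions with the same reflection.

  It remains to decide \<open>t\<^sub>i = t\<^sub>j\<close> in logarithmic space. The geometric representation is faithful,
  and its matrix entries lie in the integer span of the numbers \<open>cos (i \<pi> / Q)\<close>. Hence it lifts to
  integer matrices, and equality in the group amounts to finitely many equations between integers
  of absolute value at most exponential in \<open>n\<close>. Such an equation is checked modulo all \<open>k\<close> up to a
  linear bound, because the least common multiple of \<open>1, \<dots>, k\<close> is at least \<open>2\<^sup>k\<^sup>-\<^sup>1\<close>. All this needs only
  a fixed number of counters with values linear in \<open>n\<close>.
\<close>

section \<open>Coxeter groups and reflections\<close>

text \<open>Evenness enters in \<open>even_count_cong\<close>. For odd \<open>m a b\<close> with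
  \<open>a \<noteq> b\<close> the generators \<open>a\<close> and \<open>b\<close> are conjugate: a
  reflection has no letter type, and geodesics of one element may differ in their letter counts, as
  \<open>a b a = b a b\<close> shows.

  The set of odd reflections is too large to store. The machine therefore recomputes the reflections
  of all earlier positions for each position and keeps one parity bit. As \<open>t\<^sub>i\<close>
  is a palindrome, it is applied to a vector by walking from the left end to position
  \<open>i\<close> and back.

  The main obstacle is equality of real matrices. The numbers \<open>cos (i \<pi> / Q)\<close> are
  linearly dependent over the integers, so equal real vectors may have different lifts, and the
  matrices chosen for the letters need not even satisfy the relations of the group. What helps is
  that the kernel of the evaluation map is cut out by finitely many integer linear forms
  (\<open>integer_relations\<close>). The group being fixed, their mere existence suffices: they are
  constants of the program. Using all moduli instead of primes avoids any primality test.\<close>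

locale coxeter =
  fixes S :: "'a set" and m :: "'a \<Rightarrow> 'a \<Rightarrow> nat"
  assumes cox: "coxeter_matrix S m"
begin

abbreviation (input) "G \<equiv> coxeter_group S m"
abbreviation (input) group_mult (infixl "\<cdot>" 70) where "x \<cdot> y \<equiv> x \<otimes>\<^bsub>coxeter_group S m\<^esub> y"
abbreviation (input) "el \<equiv> element_of S m"
abbreviation (input) "carr \<equiv> carrier (coxeter_group S m)"

sublocale G: group G by (rule group_coxeter_group)

section \<open>Equality of elements in terms of positive words\<close>

lemma element_eq_iff:
  assumes "u \<in> lists S" "v \<in> lists S"
  shows "el u = el v \<longleftrightarrow> pres_eq S (coxeter_relators S m) (positive_word u) (positive_word v)"
  unfolding element_of_def
  using eq_equiv_class_iff[OF equiv_pres_rel positive_word_words positive_word_words, OF assms]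
  by (simp add: pres_rel_def)

lemma map_fst_positive_word [simp]: "map fst (positive_word u) = u"
  by (simp add: positive_word_def o_def)

lemma map_fst_group_words: "u \<in> group_words S \<Longrightarrow> map fst u \<in> lists S"
  unfolding group_words_def by (induction u) auto

lemma rev_lists [simp]: "rev u \<in> lists S \<longleftrightarrow> u \<in> lists S"
  by (simp add: in_lists_conv_set)

text \<open>Generators are involutions, so erasing the signs by \<open>map fst\<close> turns a
  derivation in the presentation into one between positive words; the rule \<open>cancel\<close>
  becomes \<open>square\<close>. The invariants of group elements below are all proved by this
  induction.\<close>

lemma element_eq_induct [consumes 3, case_names refl sym trans append square relator]:
  assumes "u \<in> lists S" "v \<in> lists S" "el u = el v"
    and refl: "\<And>u. u \<in> lists S \<Longrightarrow> E u u"
    and sym: "\<And>u v. u \<in> lists S \<Longrightarrow> v \<in> lists S \<Longrightarrow> E u v \<Longrightarrow> E v u"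
    and trans: "\<And>u v w. u \<in> lists S \<Longrightarrow> v \<in> lists S \<Longrightarrow> w \<in> lists S \<Longrightarrow> E u v \<Longrightarrow> E v w \<Longrightarrow> E u w"
    and append: "\<And>u v u' v'. u \<in> lists S \<Longrightarrow> v \<in> lists S \<Longrightarrow> u' \<in> lists S \<Longrightarrow> v' \<in> lists S \<Longrightarrow>
      E u v \<Longrightarrow> E u' v' \<Longrightarrow> E (u @ u') (v @ v')"
    and square: "\<And>a. a \<in> S \<Longrightarrow> E [a, a] []"
    and relator: "\<And>a b. a \<in> S \<Longrightarrow> b \<in> S \<Longrightarrow> E (concat (replicate (m a b) [a, b])) []"
  shows "E u v"
proof -
  have "pres_eq S (coxeter_relators S m) (positive_word u) (positive_word v)"
    using assms(1-3) element_eq_iff by blast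
  moreover have "E (map fst x) (map fst y)" if "pres_eq S (coxeter_relators S m) x y" for x y
    using that
  proof (induction rule: pres_eq.induct)
    case (refl x)
    then show ?case using assms(4) map_fst_group_words by blast
  next
    case (sym x y)
    then show ?case using assms(5) map_fst_group_words pres_eq_words by blast
  next
    case (trans x y z)
    then show ?case using assms(6) map_fst_group_words pres_eq_words by meson
  next
    case (cong x y x' y')
    then show ?case using assms(7) map_fst_group_words pres_eq_words by (metis map_append)
  next
    case (cancel a s)
    then show ?case using assms(8) by simp
  next
    case (relator r)
    then obtain a b where "a \<in> S" "b \<in> S" "map fst r = concat (replicate (m a b) [a, b])"
      unfolding coxeter_relators_def by auto
    then show ?case using assms(9) by simp
  qed
  ultimately show ?thesis by fastforce
qed

lemma el_closed [simp, intro]: "u \<in> lists S \<Longrightarrow> el u \<in> carr"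
  by (rule element_of_closed)

lemma el_Nil [simp]: "el [] = \<one>\<^bsub>G\<^esub>"
  by (rule element_of_Nil)

lemma el_append: "u \<in> lists S \<Longrightarrow> v \<in> lists S \<Longrightarrow> el (u @ v) = el u \<cdot> el v"
  by (rule element_of_append)

lemma el_Cons: "a \<in> S \<Longrightarrow> v \<in> lists S \<Longrightarrow> el (a # v) = el [a] \<cdot> el v"
  using el_append[of "[a]" v] by simp

lemma relator_words: "a \<in> S \<Longrightarrow> b \<in> S \<Longrightarrow> concat (replicate n [a, b]) \<in> lists S"
  by (induction n) auto

lemma el_relator:
  assumes "a \<in> S" "b \<in> S"
  shows "el (concat (replicate (m a b) [a, b])) = \<one>\<^bsub>G\<^esub>"
proof -
  have "pres_eq S (coxeter_relators S m) (positive_word (concat (replicate (m a b) [a, b]))) []"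
    by (rule pres_eq.relator)
      (use assms positive_word_words[OF relator_words[OF assms]] in \<open>auto simp: coxeter_relators_def\<close>)
  then show ?thesis
    using element_eq_iff[of "concat (replicate (m a b) [a, b])" "[]"] relator_words[OF assms]
    by (simp add: positive_word_def)
qed

lemma el_square:
  assumes "a \<in> S"
  shows "el [a, a] = \<one>\<^bsub>G\<^esub>"
proof -
  have "m a a = 1" using cox assms unfolding coxeter_matrix_def by blast
  then show ?thesis using el_relator[OF assms assms] by simp
qed

lemma generator_square: "a \<in> S \<Longrightarrow> el [a] \<cdot> el [a] = \<one>\<^bsub>G\<^esub>"
  using el_square el_append[of "[a]" "[a]"] by simp

lemma inv_generator: "a \<in> S \<Longrightarrow> inv\<^bsub>G\<^esub> el [a] = el [a]"
  by (rule G.inv_equality) (auto simp: generator_square)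

lemma el_rev: "u \<in> lists S \<Longrightarrow> el (rev u) = inv\<^bsub>G\<^esub> el u"
proof (induction u)
  case (Cons a u)
  then have "el (rev (a # u)) = inv\<^bsub>G\<^esub> el u \<cdot> el [a]"
    using el_append[of "rev u" "[a]"] by simp
  also have "\<dots> = inv\<^bsub>G\<^esub> (el [a] \<cdot> el u)"
    using Cons.prems by (subst G.inv_mult_group) (auto simp: inv_generator)
  finally show ?case using Cons.prems el_Cons[of a u] by simp
qed simp

section \<open>The reflection cocycle\<close>

text \<open>The parity of the number of prefixes \<open>u b\<close> of a word with \<open>u b u\<inverse> = t\<close>.\<close>

primrec par :: "'a list \<Rightarrow> ('a \<times> bool) list set \<Rightarrow> bool" where
  "par [] t = False"
| "par (a # v) t = ((t = el [a]) \<noteq> par v (el [a] \<cdot> t \<cdot> el [a]))"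

text \<open>Prefixes of \<open>u @ v\<close> that reach beyond \<open>u\<close> carry the factor
  \<open>u\<close>, which conjugates their reflections. With N(u) for the set of all
  \<open>t\<close> with \<open>par u t\<close>, this is the cocycle rule: N(u v) is the symmetric
  difference of N(u) and the conjugate of N(v) by u.\<close>

lemma par_append:
  "u \<in> lists S \<Longrightarrow> t \<in> carr \<Longrightarrow>
    par (u @ v) t = (par u t \<noteq> par v (inv\<^bsub>G\<^esub> el u \<cdot> t \<cdot> el u))"
proof (induction u arbitrary: t)
  case (Cons a u)
  have a: "a \<in> S" "u \<in> lists S" using Cons.prems by auto
  let ?t = "el [a] \<cdot> t \<cdot> el [a]"
  have "?t \<in> carr" using a Cons.prems by auto
  moreover have "inv\<^bsub>G\<^esub> el (a # u) \<cdot> t \<cdot> el (a # u) = inv\<^bsub>G\<^esub> el u \<cdot> ?t \<cdot> el u"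
    using a Cons.prems el_Cons[OF a]
    by (simp add: G.inv_mult_group inv_generator G.m_assoc)
  ultimately show ?case using Cons.IH[OF a(2), of ?t] by auto
qed simp

lemma sum_lessThan_add: "(\<Sum>i<n + k. f i) = (\<Sum>i<n. f i) + (\<Sum>i<k. f (n + i))"
  for n k :: nat and f :: "nat \<Rightarrow> nat"
  by (induction k) (auto simp: add.assoc)

text \<open>The letters of \<open>a b a b ...\<close> have the reflections \<open>a\<close>,
  \<open>a b a\<close>, \<open>a b a b a\<close> and so on, which are \<open>x\<^sup>i a\<close> for
  \<open>i = 0, 1, 2, ...\<close>.\<close>

lemma par_dihedral:
  assumes "a \<in> S" "b \<in> S"
  defines "x \<equiv> el [a] \<cdot> el [b]"
  shows "t \<in> carr \<Longrightarrow> par (concat (replicate q [a, b])) t \<longleftrightarrow>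
    odd (\<Sum>i<2 * q. of_bool (t = x [^]\<^bsub>G\<^esub> i \<cdot> el [a]) :: nat)"
proof (induction q arbitrary: t)
  case (Suc q)
  let ?A = "el [a]" and ?B = "el [b]"
  have AB: "?A \<in> carr" "?B \<in> carr" "x \<in> carr" "?A \<cdot> ?A = \<one>\<^bsub>G\<^esub>" "?B \<cdot> ?B = \<one>\<^bsub>G\<^esub>"
    using assms generator_square by (auto simp: x_def)
  have cancel: "?A \<cdot> (?A \<cdot> y) = y" "?B \<cdot> (?B \<cdot> y) = y" if "y \<in> carr" for y
    using AB that by (simp_all flip: G.m_assoc)
  let ?t = "?B \<cdot> (?A \<cdot> t \<cdot> ?A) \<cdot> ?B"
  have t: "?t \<in> carr" using AB Suc.prems by auto
  have sw: "?A \<cdot> t \<cdot> ?A = ?B \<longleftrightarrow> t = x \<cdot> ?A"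
  proof
    assume "?A \<cdot> t \<cdot> ?A = ?B"
    then have "x \<cdot> ?A = ?A \<cdot> (?A \<cdot> t \<cdot> ?A) \<cdot> ?A" by (simp add: x_def)
    also have "\<dots> = t" using AB Suc.prems cancel by (simp add: G.m_assoc)
    finally show "t = x \<cdot> ?A" by simp
  next
    assume "t = x \<cdot> ?A"
    then show "?A \<cdot> t \<cdot> ?A = ?B" using AB cancel by (simp add: x_def G.m_assoc)
  qed
  \<comment> \<open>Dropping the first two letters shifts the exponent by two: multiply by
    \<open>x\<close> on the left and by its inverse \<open>?B \<cdot> ?A\<close> on the
    right.\<close>
  have "?t = x [^]\<^bsub>G\<^esub> i \<cdot> ?A \<longleftrightarrow> t = x [^]\<^bsub>G\<^esub> Suc (Suc i) \<cdot> ?A" for i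
  proof -
    have conj: "x \<cdot> ?t \<cdot> (?B \<cdot> ?A) = t"
      using AB Suc.prems cancel by (simp add: x_def G.m_assoc)
    have pw: "x \<cdot> (x [^]\<^bsub>G\<^esub> i \<cdot> ?A) \<cdot> (?B \<cdot> ?A) = x [^]\<^bsub>G\<^esub> Suc (Suc i) \<cdot> ?A"
    proof -
      have "x [^]\<^bsub>G\<^esub> Suc (Suc i) = x [^]\<^bsub>G\<^esub> Suc i \<cdot> x" by simp
      also have "x [^]\<^bsub>G\<^esub> Suc i = x \<cdot> x [^]\<^bsub>G\<^esub> i" using AB by (intro G.nat_pow_Suc2)
      finally show ?thesis using AB by (simp add: x_def G.m_assoc)
    qed
    have "?t = y \<longleftrightarrow> x \<cdot> ?t \<cdot> (?B \<cdot> ?A) = x \<cdot> y \<cdot> (?B \<cdot> ?A)" if "y \<in> carr" for y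
      using AB t that by simp
    from this[of "x [^]\<^bsub>G\<^esub> i \<cdot> ?A"] show ?thesis unfolding conj pw using AB by simp
  qed
  moreover have "par (concat (replicate (Suc q) [a, b])) t \<longleftrightarrow>
      ((t = ?A) \<noteq> ((t = x \<cdot> ?A) \<noteq> par (concat (replicate q [a, b])) ?t))"
    using sw by simp
  ultimately show ?case
    using Suc.IH[OF t] AB
    by (simp add: sum.lessThan_Suc_shift del: sum.lessThan_Suc G.nat_pow_Suc)
qed simp

text \<open>With \<open>x = a b\<close> and \<open>x\<^sup>m = 1\<close>, the list of all
  \<open>x\<^sup>i a\<close> with \<open>i < 2 m\<close> runs through the same \<open>m\<close>
  entries twice, so every element is met an even number of times.\<close>

lemma par_relator:
  assumes "a \<in> S" "b \<in> S" "t \<in> carr"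
  shows "\<not> par (concat (replicate (m a b) [a, b])) t"
proof -
  let ?x = "el [a] \<cdot> el [b]"
  have x: "?x \<in> carr" using assms by auto
  have "el (concat (replicate q [a, b])) = ?x [^]\<^bsub>G\<^esub> q" for q
  proof (induction q)
    case (Suc q)
    have "el (concat (replicate (Suc q) [a, b])) = ?x \<cdot> ?x [^]\<^bsub>G\<^esub> q"
      using assms relator_words[OF assms(1,2), of q] Suc el_Cons[of a "b # concat (replicate q [a, b])"]
        el_Cons[of b "concat (replicate q [a, b])"] by (simp add: G.m_assoc)
    then show ?case using G.nat_pow_Suc2[OF x] by metis
  qed simp
  with el_relator[OF assms(1,2)] have xm: "?x [^]\<^bsub>G\<^esub> m a b = \<one>\<^bsub>G\<^esub>" by metis
  have "?x [^]\<^bsub>G\<^esub> (m a b + i) = ?x [^]\<^bsub>G\<^esub> i" for i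
    using x xm by (simp flip: G.nat_pow_mult)
  then show ?thesis
    unfolding par_dihedral[OF assms] mult_2 sum_lessThan_add by simp
qed

lemma par_cong:
  assumes "u \<in> lists S" "v \<in> lists S" "el u = el v"
  shows "\<forall>t\<in>carr. par u t = par v t"
proof -
  \<comment> \<open>Equality of the elements is carried through the induction, because
    \<open>par_append\<close> conjugates by the element of the first word.\<close>
  have "(\<forall>t\<in>carr. par u t = par v t) \<and> el u = el v"
    using assms
  proof (induction u v rule: element_eq_induct)
    case (append u v u' v')
    have "par (u @ u') t = par (v @ v') t" if "t \<in> carr" for t
      using append that by (auto simp: par_append)
    then show ?case using append by (simp add: el_append)
  next
    case (square a)
    have sq: "par [a, a] t = par [] t" if "t \<in> carr" for t
    proof -
      have A: "el [a] \<in> carr" using square by simp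
      have "el [a] \<cdot> t \<cdot> el [a] = el [a] \<longleftrightarrow> t = el [a]"
      proof
        assume "el [a] \<cdot> t \<cdot> el [a] = el [a]"
        then have "el [a] = el [a] \<cdot> (el [a] \<cdot> t \<cdot> el [a]) \<cdot> el [a]"
          using A generator_square[OF square] by simp
        also have "\<dots> = (el [a] \<cdot> el [a]) \<cdot> t \<cdot> (el [a] \<cdot> el [a])"
          using A that by (simp add: G.m_assoc)
        also have "\<dots> = t" using that generator_square[OF square] by simp
        finally show "t = el [a]" ..
      qed (use A generator_square[OF square] in simp)
      then show ?thesis by simp
    qed
    show ?case by (intro conjI ballI sq) (simp_all add: el_square square)
  next
    case (relator a b)
    then show ?case using par_relator by (simp add: el_relator)
  qed auto
  then show ?thesis by blast
qed

section \<open>Reflections along a word and geodesics\<close>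

definition reflection :: "'a list \<Rightarrow> 'a \<Rightarrow> ('a \<times> bool) list set" where
  "reflection u b = el (u @ [b] @ rev u)"

lemma reflection_eq:
  assumes "u \<in> lists S" "b \<in> S"
  shows "reflection u b = el u \<cdot> el [b] \<cdot> inv\<^bsub>G\<^esub> el u"
  unfolding reflection_def using assms by (simp add: el_append el_rev G.m_assoc el_Cons[of b "rev u"])

lemma reflection_closed: "u \<in> lists S \<Longrightarrow> b \<in> S \<Longrightarrow> reflection u b \<in> carr"
  unfolding reflection_def by (intro el_closed) auto

lemma par_snoc:
  assumes "u \<in> lists S" "b \<in> S" "t \<in> carr"
  shows "par (u @ [b]) t = (par u t \<noteq> (t = reflection u b))"
proof -
  have "inv\<^bsub>G\<^esub> el u \<cdot> t \<cdot> el u = el [b] \<longleftrightarrow> t = reflection u b"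
  proof
    assume "inv\<^bsub>G\<^esub> el u \<cdot> t \<cdot> el u = el [b]"
    then have "reflection u b = el u \<cdot> (inv\<^bsub>G\<^esub> el u \<cdot> t \<cdot> el u) \<cdot> inv\<^bsub>G\<^esub> el u"
      using assms by (simp add: reflection_eq)
    also have "\<dots> = t" using assms by (simp add: G.m_assoc) (simp flip: G.m_assoc)
    finally show "t = reflection u b" by simp
  next
    assume "t = reflection u b"
    then show "inv\<^bsub>G\<^esub> el u \<cdot> t \<cdot> el u = el [b]"
      using assms by (simp add: reflection_eq G.m_assoc) (simp flip: G.m_assoc)
  qed
  then show ?thesis using assms by (simp add: par_append)
qed

lemma par_imp_reflection:
  "u \<in> lists S \<Longrightarrow> t \<in> carr \<Longrightarrow> par u t \<Longrightarrow> \<exists>x b y. u = x @ [b] @ y \<and> t = reflection x b"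
proof (induction u rule: rev_induct)
  case (snoc b u)
  then consider "par u t" | "t = reflection u b" using par_snoc[of u b t] by auto
  then show ?case
  proof cases
    case 1
    with snoc obtain x c y where "u = x @ [c] @ y" "t = reflection x c" by auto
    then show ?thesis by (intro exI[of _ x] exI[of _ c] exI[of _ "y @ [b]"]) simp
  next
    case 2
    then show ?thesis by (intro exI[of _ u] exI[of _ b] exI[of _ "[]"]) simp
  qed
qed simp

lemma finite_par: "u \<in> lists S \<Longrightarrow> finite {t \<in> carr. par u t}"
proof (induction u rule: rev_induct)
  case (snoc b u)
  have "{t \<in> carr. par (u @ [b]) t} \<subseteq> insert (reflection u b) {t \<in> carr. par u t}"
    using snoc.prems par_snoc[of u b] by auto
  then show ?case by (rule finite_subset) (use snoc in simp)
qed simp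

lemma geodesic_butlast:
  assumes "geodesic S m g (u @ [b])"
  shows "geodesic S m (el u) u"
proof -
  have ub: "u \<in> lists S" "b \<in> S" "el (u @ [b]) = g" using assms by (auto simp: geodesic_def)
  have "length u \<le> length v" if "v \<in> lists S" "el v = el u" for v
  proof -
    have "v @ [b] \<in> lists S" "el (v @ [b]) = g" using that ub by (simp_all add: el_append)
    then have "length (u @ [b]) \<le> length (v @ [b])"
      using assms unfolding geodesic_def by blast
    then show ?thesis by simp
  qed
  then show ?thesis using ub by (auto simp: geodesic_def)
qed

text \<open>This is the deletion property. With \<open>t = reflection u b\<close> one has
  \<open>u b = t u\<close>. If \<open>t\<close> is also the reflection of an earlier letter
  \<open>c\<close> of \<open>u\<close>, then multiplying \<open>u\<close> by \<open>t\<close> from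
  the left erases \<open>c\<close>, which gives a word for \<open>g\<close> that is shorter by
  two.\<close>

lemma geodesic_not_par:
  assumes "geodesic S m g (u @ [b])"
  shows "\<not> par u (reflection u b)"
proof
  assume "par u (reflection u b)"
  have ub: "u \<in> lists S" "b \<in> S" "el (u @ [b]) = g" using assms by (auto simp: geodesic_def)
  with \<open>par u _\<close> obtain x c y where u: "u = x @ [c] @ y" and r: "reflection u b = reflection x c"
    using par_imp_reflection reflection_closed by blast
  have xy: "x \<in> lists S" "c \<in> S" "y \<in> lists S" using ub(1) u by auto
  have c1: "inv\<^bsub>G\<^esub> el x \<cdot> (el x \<cdot> z) = z" and c2: "el [c] \<cdot> (el [c] \<cdot> z) = z"
    if "z \<in> carr" for z
    using xy that generator_square[OF xy(2)] by (simp_all flip: G.m_assoc)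
  have "reflection u b \<cdot> el u = el u \<cdot> el [b]"
    using ub(1,2) by (simp add: reflection_eq G.m_assoc)
  then have "g = reflection u b \<cdot> el u"
    using ub by (simp add: el_append)
  also have "\<dots> = reflection x c \<cdot> (el x \<cdot> (el [c] \<cdot> el y))"
    unfolding r using u xy by (simp add: el_append el_Cons[of c y])
  also have "\<dots> = el x \<cdot> el y"
    using xy by (simp add: reflection_eq G.m_assoc c1 c2)
  also have "\<dots> = el (x @ y)" using xy by (simp add: el_append)
  finally have "x @ y \<in> lists S" "el (x @ y) = g" using xy by simp_all
  then have "length (u @ [b]) \<le> length (x @ y)" using assms unfolding geodesic_def by blast
  then show False using u by simp
qed

text \<open>The homomorphism to Z/2 that counts the letter \<open>a\<close>, as a predicate on
  elements. It singles out the reflections of type \<open>a\<close>; independence of the chosen word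
  is \<open>odd_in_el\<close>.\<close>

definition odd_in :: "'a \<Rightarrow> ('a \<times> bool) list set \<Rightarrow> bool" where
  "odd_in a t \<longleftrightarrow> (\<exists>z\<in>lists S. t = el z \<and> odd (count_list z a))"

definition inversions :: "'a list \<Rightarrow> 'a \<Rightarrow> ('a \<times> bool) list set set" where
  "inversions u a = {t \<in> carr. par u t \<and> odd_in a t}"

lemma inversions_cong:
  "u \<in> lists S \<Longrightarrow> v \<in> lists S \<Longrightarrow> el u = el v \<Longrightarrow> inversions u a = inversions v a"
  using par_cong[of u v] by (auto simp: inversions_def)

lemma finite_inversions: "u \<in> lists S \<Longrightarrow> finite (inversions u a)"
  using finite_par[of u] by (rule rev_finite_subset) (auto simp: inversions_def)

text \<open>Links the recursion of \<open>par\<close> with the count of positions that the program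
  makes. Positions start at 1, like the letter cells of the input tape.\<close>

lemma par_take:
  assumes "w \<in> lists S" "i \<le> length w" "t \<in> carr"
  shows "par (take i w) t \<longleftrightarrow> odd (card {j \<in> {1..i}. reflection (take (j - 1) w) (w ! (j - 1)) = t})"
  using assms(2)
proof (induction i)
  case (Suc i)
  let ?C = "\<lambda>i. {j \<in> {1..i}. reflection (take (j - 1) w) (w ! (j - 1)) = t}"
  let ?r = "reflection (take i w) (w ! i)"
  have w: "take i w \<in> lists S" "w ! i \<in> S"
    using assms(1) Suc.prems by (auto dest: in_set_takeD)
  have "?C (Suc i) = ?C i \<union> (if ?r = t then {Suc i} else {})"
    by (auto simp: le_Suc_eq)
  then have "card (?C (Suc i)) = card (?C i) + of_bool (?r = t)" by simp
  then show ?case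
    using Suc par_snoc[OF w assms(3)] by (auto simp: take_Suc_conv_app_nth)
qed simp

end

section \<open>Letter parities and inversion counts in even Coxeter groups\<close>

locale even_coxeter = coxeter +
  assumes ev: "\<And>a b. a \<in> S \<Longrightarrow> b \<in> S \<Longrightarrow> a \<noteq> b \<Longrightarrow> even (m a b)"
begin

text \<open>The relator of distinct letters contains each of them \<open>m b c\<close> times, an
  even number; for equal letters it is \<open>[b, b]\<close>.\<close>

lemma even_count_cong:
  assumes "u \<in> lists S" "v \<in> lists S" "el u = el v"
  shows "even (count_list u a) = even (count_list v a)"
  using assms
proof (induction u v rule: element_eq_induct)
  case (relator b c)
  have "count_list (concat (replicate n [b, c])) a = n * count_list [b, c] a" for n
    by (induction n) auto
  then show ?case using ev[OF relator] by (cases "b = c") auto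
qed auto

lemma odd_in_el: "z \<in> lists S \<Longrightarrow> odd_in a (el z) \<longleftrightarrow> odd (count_list z a)"
  unfolding odd_in_def using even_count_cong by blast

text \<open>The word and its reversal contribute the same count, so the middle letter decides the
  parity. Hence positions with the same reflection carry the same letter.\<close>

lemma odd_in_reflection:
  assumes "u \<in> lists S" "b \<in> S"
  shows "odd_in a (reflection u b) \<longleftrightarrow> a = b"
proof -
  have "count_list (rev u) a = count_list u a" by (induction u) auto
  then show ?thesis
    unfolding reflection_def using assms by (subst odd_in_el) auto
qed

lemma inversions_snoc:
  assumes "u \<in> lists S" "b \<in> S"
  shows "inversions (u @ [b]) a =
    (if a \<noteq> b then inversions u a
     else if par u (reflection u b) then inversions u a - {reflection u b}
     else insert (reflection u b) (inversions u a))"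
  using par_snoc[OF assms] odd_in_reflection[OF assms, of a] reflection_closed[OF assms]
  by (auto simp: inversions_def)

lemma card_inversions_snoc:
  assumes "u \<in> lists S" "b \<in> S"
  shows "a \<noteq> b \<Longrightarrow> card (inversions (u @ [b]) a) = card (inversions u a)"
    and "\<not> par u (reflection u b) \<Longrightarrow> card (inversions (u @ [b]) b) = card (inversions u b) + 1"
    and "par u (reflection u b) \<Longrightarrow> card (inversions u b) = card (inversions (u @ [b]) b) + 1"
proof -
  show "a \<noteq> b \<Longrightarrow> card (inversions (u @ [b]) a) = card (inversions u a)"
    using assms by (simp add: inversions_snoc)
  have "par u (reflection u b) \<longleftrightarrow> reflection u b \<in> inversions u b"
    using odd_in_reflection[OF assms, of b] reflection_closed[OF assms] by (auto simp: inversions_def)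
  then show "\<not> par u (reflection u b) \<Longrightarrow> card (inversions (u @ [b]) b) = card (inversions u b) + 1"
    "par u (reflection u b) \<Longrightarrow> card (inversions u b) = card (inversions (u @ [b]) b) + 1"
    using inversions_snoc[OF assms, of b] finite_inversions[OF assms(1), of b]
    by (simp, metis Suc_eq_plus1 card_Suc_Diff1)
qed

lemma card_inversions_geodesic: "geodesic S m g v \<Longrightarrow> card (inversions v a) = count_list v a"
proof (induction v arbitrary: g rule: rev_induct)
  case Nil
  then show ?case by (simp add: inversions_def)
next
  case (snoc b u)
  then have "u \<in> lists S" "b \<in> S" by (auto simp: geodesic_def)
  from card_inversions_snoc[OF this] snoc.IH[OF geodesic_butlast[OF snoc.prems]]
    geodesic_not_par[OF snoc.prems] show ?case by (cases "a = b") auto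
qed

text \<open>Applied to prefixes of the input, this keeps the counter of the program linear in the
  input length.\<close>

lemma card_inversions_le: "u \<in> lists S \<Longrightarrow> card (inversions u a) \<le> length u"
proof (induction u rule: rev_induct)
  case Nil
  then show ?case by (simp add: inversions_def)
next
  case (snoc b u)
  then have ub: "u \<in> lists S" "b \<in> S" by auto
  note c = card_inversions_snoc[OF ub]
  consider "a \<noteq> b" | "a = b" "par u (reflection u b)" | "a = b" "\<not> par u (reflection u b)" by blast
  then show ?case
  proof cases
    case 1
    then show ?thesis using c(1)[OF 1] snoc.IH[OF ub(1)] by simp
  next
    case 2
    then show ?thesis using c(3)[OF 2(2)] snoc.IH[OF ub(1)] by simp
  next
    case 3
    then show ?thesis using c(2)[OF 3(2)] snoc.IH[OF ub(1)] by simp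
  qed
qed

end

lemma shortlex_nf_count:
  fixes S :: "'a::linorder set"
  assumes "even_coxeter_matrix S m" "w \<in> lists S"
  shows "count_list (shortlex_nf S m (element_of S m w)) a = card (coxeter.inversions S m w a)"
proof -
  interpret even_coxeter S m
    using assms(1) by unfold_locales (auto simp: even_coxeter_matrix_def)
  have "finite S" using cox by (simp add: coxeter_matrix_def)
  let ?v = "shortlex_nf S m (element_of S m w)"
  have "is_shortlex_nf S m (element_of S m w) ?v"
    unfolding shortlex_nf_def using ex1_shortlex_nf[OF \<open>finite S\<close> assms(2)] by (rule theI')
  then have g: "geodesic S m (element_of S m w) ?v" by (simp add: is_shortlex_nf_def)
  then have "?v \<in> lists S" "element_of S m ?v = element_of S m w" by (auto simp: geodesic_def)
  with card_inversions_geodesic[OF g] inversions_cong[OF _ assms(2)] show ?thesis by simp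
qed

section \<open>The geometric representation\<close>

text \<open>The Chebyshev polynomial of the second kind \<open>U\<^sub>n\<^sub>-\<^sub>1\<close> at
  \<open>c / 2\<close>, that is, \<open>sin (n \<theta>) / sin \<theta>\<close> for
  \<open>c = 2 cos \<theta>\<close>. The iterated pair holds two consecutive values.\<close>

definition cheb :: "real \<Rightarrow> nat \<Rightarrow> real" where
  "cheb c n = fst (((\<lambda>(x, y). (y, c * y - x)) ^^ n) (0, 1))"

lemma cheb_aux: "((\<lambda>(x, y). (y, c * y - x)) ^^ n) (0, 1) = (cheb c n, cheb c (Suc n))"
  by (cases "((\<lambda>(x, y). (y, c * y - x)) ^^ n) (0, 1)") (simp add: cheb_def)

lemma cheb_0 [simp]: "cheb c 0 = 0" and cheb_1 [simp]: "cheb c (Suc 0) = 1"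
  by (simp_all add: cheb_def)

lemma cheb_Suc_Suc: "cheb c (Suc (Suc n)) = c * cheb c (Suc n) - cheb c n"
  using cheb_aux[of "Suc n" c] cheb_aux[of n c] by simp

lemma cheb_2: "cheb 2 n = real n"
proof -
  have "cheb 2 n = real n \<and> cheb 2 (Suc n) = real (Suc n)"
    by (induction n) (auto simp: cheb_Suc_Suc)
  then show ?thesis by simp
qed

lemma sin_step: "2 * cos \<theta> * sin \<alpha> - sin (\<alpha> - \<theta>) = sin (\<alpha> + \<theta>)" for \<theta> :: real
  by (simp add: sin_add sin_diff algebra_simps)

lemma cheb_sin: "cheb (2 * cos \<theta>) n * sin \<theta> = sin (real n * \<theta>)"
proof -
  have "cheb (2 * cos \<theta>) n * sin \<theta> = sin (real n * \<theta>) \<and>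
      cheb (2 * cos \<theta>) (Suc n) * sin \<theta> = sin (real (Suc n) * \<theta>)"
  proof (induction n)
    case (Suc n)
    have "cheb (2 * cos \<theta>) (Suc (Suc n)) * sin \<theta> =
        2 * cos \<theta> * (cheb (2 * cos \<theta>) (Suc n) * sin \<theta>) - cheb (2 * cos \<theta>) n * sin \<theta>"
      by (simp add: cheb_Suc_Suc algebra_simps)
    also have "\<dots> = 2 * cos \<theta> * sin (real (Suc n) * \<theta>) - sin (real (Suc n) * \<theta> - \<theta>)"
      using Suc by (simp add: algebra_simps)
    also have "\<dots> = sin (real (Suc n) * \<theta> + \<theta>)" by (rule sin_step)
    finally show ?case using Suc by (simp add: algebra_simps)
  qed simp
  then show ?thesis by simp
qed

lemma cheb_nonneg:
  assumes "M \<ge> 2" "n \<le> M"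
  shows "cheb (2 * cos (pi / real M)) n \<ge> 0"
proof -
  let ?\<theta> = "pi / real M"
  have "?\<theta> < pi" using assms(1) by (simp add: divide_less_eq)
  then have pos: "sin ?\<theta> > 0" using assms by (intro sin_gt_zero) auto
  have "real n * ?\<theta> \<le> pi" using assms by (simp add: field_simps)
  then have "sin (real n * ?\<theta>) \<ge> 0" by (intro sin_ge_zero) auto
  then have "cheb (2 * cos ?\<theta>) n * sin ?\<theta> \<ge> 0" by (simp only: cheb_sin)
  then show ?thesis using pos by (simp add: zero_le_mult_iff)
qed

text \<open>The effect of two generators, applied one after the other, on their own two coordinates;
  \<open>k\<close> and \<open>l\<close> are the contributions of the other coordinates, which stay
  constant.\<close>

definition dihedral_step :: "real \<Rightarrow> real \<Rightarrow> real \<Rightarrow> real \<times> real \<Rightarrow> real \<times> real" where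
  "dihedral_step c k l = (\<lambda>(x, y). (c * (c * x - y + l) - x + k, c * x - y + l))"

text \<open>
  The affine map has a fixed point since \<open>c\<^sup>2 \<noteq> 4\<close>; relative to it the orbit solves the recurrence
  \<open>z\<^sub>n\<^sub>+\<^sub>2 = c z\<^sub>n\<^sub>+\<^sub>1 - z\<^sub>n\<close>, hence is a combination of sines with period \<open>2M\<close>.
\<close>

lemma dihedral_step_period:
  assumes "M \<ge> 2"
  shows "(dihedral_step (2 * cos (pi / real M)) k l ^^ M) (x, y) = (x, y)"
proof -
  define \<theta> where "\<theta> = pi / real M"
  define c where "c = 2 * cos \<theta>"
  have "\<theta> < pi" using assms by (simp add: \<theta>_def divide_less_eq)
  then have s: "sin \<theta> > 0" using assms by (intro sin_gt_zero) (auto simp: \<theta>_def)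
  have D: "4 - c\<^sup>2 \<noteq> 0" using s by (simp add: c_def cos_squared_eq algebra_simps)
  define X where "X = (2 * k + c * l) / (4 - c\<^sup>2)"
  define Y where "Y = (2 * l + c * k) / (4 - c\<^sup>2)"
  have X: "2 * X = c * Y + k" and Y: "2 * Y = c * X + l"
    using D by (simp_all add: X_def Y_def field_simps power2_eq_square)
  define p where "p = x - X"
  define q where "q = y - Y"
  have "\<exists>x' y'. (dihedral_step c k l ^^ n) (x, y) = (x', y') \<and>
      (x' - X) * sin \<theta> = p * sin (2 * real n * \<theta> + \<theta>) - q * sin (2 * real n * \<theta>) \<and>
      (y' - Y) * sin \<theta> = p * sin (2 * real n * \<theta>) - q * sin (2 * real n * \<theta> - \<theta>)" for n
  proof (induction n)
    case 0
    then show ?case by (simp add: p_def q_def algebra_simps)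
  next
    case (Suc n)
    then obtain x' y' where IH: "(dihedral_step c k l ^^ n) (x, y) = (x', y')"
      "(x' - X) * sin \<theta> = p * sin (2 * real n * \<theta> + \<theta>) - q * sin (2 * real n * \<theta>)"
      "(y' - Y) * sin \<theta> = p * sin (2 * real n * \<theta>) - q * sin (2 * real n * \<theta> - \<theta>)" by blast
    let ?a = "2 * real n * \<theta>"
    define y'' where "y'' = c * x' - y' + l"
    define x'' where "x'' = c * y'' - x' + k"
    have y'': "(y'' - Y) = c * (x' - X) - (y' - Y)" using Y by (simp add: y''_def algebra_simps)
    have x'': "(x'' - X) = c * (y'' - Y) - (x' - X)" using X by (simp add: x''_def algebra_simps)
    have "(y'' - Y) * sin \<theta> = c * ((x' - X) * sin \<theta>) - (y' - Y) * sin \<theta>"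
      unfolding y'' by (simp add: algebra_simps)
    also have "\<dots> = p * (2 * cos \<theta> * sin (?a + \<theta>) - sin ((?a + \<theta>) - \<theta>)) -
        q * (2 * cos \<theta> * sin ?a - sin (?a - \<theta>))"
      unfolding IH c_def by (simp add: algebra_simps)
    also have "\<dots> = p * sin (?a + \<theta> + \<theta>) - q * sin (?a + \<theta>)" unfolding sin_step ..
    finally have 1: "(y'' - Y) * sin \<theta> = p * sin (?a + \<theta> + \<theta>) - q * sin (?a + \<theta>)" .
    have "(x'' - X) * sin \<theta> = c * ((y'' - Y) * sin \<theta>) - (x' - X) * sin \<theta>"
      unfolding x'' by (simp add: algebra_simps)
    also have "\<dots> = p * (2 * cos \<theta> * sin (?a + \<theta> + \<theta>) - sin ((?a + \<theta> + \<theta>) - \<theta>)) -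
        q * (2 * cos \<theta> * sin (?a + \<theta>) - sin ((?a + \<theta>) - \<theta>))"
      unfolding IH 1 c_def by (simp add: algebra_simps)
    also have "\<dots> = p * sin (?a + \<theta> + \<theta> + \<theta>) - q * sin (?a + \<theta> + \<theta>)" unfolding sin_step ..
    finally have 2: "(x'' - X) * sin \<theta> = p * sin (?a + \<theta> + \<theta> + \<theta>) - q * sin (?a + \<theta> + \<theta>)" .
    have a: "2 * real (Suc n) * \<theta> = ?a + \<theta> + \<theta>" by (simp add: algebra_simps)
    have "(dihedral_step c k l ^^ Suc n) (x, y) = (x'', y'')"
      using IH(1) by (simp add: dihedral_step_def x''_def y''_def)
    then show ?case
      unfolding a using 1 2 by (intro exI[of _ x''] exI[of _ y''] conjI) (simp_all add: algebra_simps)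
  qed
  from this[of M] obtain x' y' where *: "(dihedral_step c k l ^^ M) (x, y) = (x', y')"
    "(x' - X) * sin \<theta> = p * sin (2 * real M * \<theta> + \<theta>) - q * sin (2 * real M * \<theta>)"
    "(y' - Y) * sin \<theta> = p * sin (2 * real M * \<theta>) - q * sin (2 * real M * \<theta> - \<theta>)" by blast
  have a: "2 * real M * \<theta> = 2 * pi" using assms by (simp add: \<theta>_def)
  have "(x' - X) * sin \<theta> = p * sin \<theta>" "(y' - Y) * sin \<theta> = q * sin \<theta>"
    using *(2,3) unfolding a by (simp_all add: sin_diff sin_add)
  then have "x' = x" "y' = y" using s by (simp_all add: p_def q_def)
  then show ?thesis using *(1) by (simp add: c_def \<theta>_def)
qed

section \<open>The reflection representation in the basis of simple roots\<close>

context coxeter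
begin

lemma finS: "finite S"
  using cox by (simp add: coxeter_matrix_def)

lemma m_sym: "a \<in> S \<Longrightarrow> b \<in> S \<Longrightarrow> m a b = m b a"
  using cox unfolding coxeter_matrix_def by blast

lemma m_cases: "a \<in> S \<Longrightarrow> b \<in> S \<Longrightarrow> a \<noteq> b \<Longrightarrow> m a b = 0 \<or> m a b \<ge> 2"
proof -
  assume "a \<in> S" "b \<in> S" "a \<noteq> b"
  then have "m a b \<noteq> 1" using cox unfolding coxeter_matrix_def by blast
  then show ?thesis by linarith
qed

lemma m_diag: "a \<in> S \<Longrightarrow> m a a = 1"
  using cox unfolding coxeter_matrix_def by blast

text \<open>For distinct generators this is \<open>-2 B(a, b)\<close> with the Tits form
  \<open>B\<close>. The entry 0 stands for infinity and receives the limit value 2.\<close>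

definition cartan :: "'a \<Rightarrow> 'a \<Rightarrow> real" where
  "cartan a b = (if m a b = 0 then 2 else 2 * cos (pi / real (m a b)))"

text \<open>In coordinates with respect to the simple roots this is
  \<open>f - 2 B(\<alpha>\<^sub>s, f) \<alpha>\<^sub>s\<close>, which changes only the coordinate at
  \<open>s\<close>.\<close>

definition reflect :: "'a \<Rightarrow> ('a \<Rightarrow> real) \<Rightarrow> 'a \<Rightarrow> real" where
  "reflect s f = f(s := - f s + (\<Sum>t\<in>S - {s}. cartan s t * f t))"

definition act :: "'a list \<Rightarrow> ('a \<Rightarrow> real) \<Rightarrow> 'a \<Rightarrow> real" where
  "act u f = foldr reflect u f"

definition simple_root :: "'a \<Rightarrow> 'a \<Rightarrow> real" where
  "simple_root s x = of_bool (x = s)"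

lemma act_Nil [simp]: "act [] f = f"
  and act_Cons [simp]: "act (s # u) f = reflect s (act u f)"
  and act_append: "act (u @ v) f = act u (act v f)"
  by (simp_all add: act_def)

lemma reflect_linear:
  "reflect s (\<lambda>x. p * f x + q * g x) = (\<lambda>x. p * reflect s f x + q * reflect s g x)"
  by (auto simp: reflect_def fun_eq_iff sum.distrib sum_distrib_left algebra_simps)

lemma act_linear: "act u (\<lambda>x. p * f x + q * g x) = (\<lambda>x. p * act u f x + q * act u g x)"
  by (induction u) (simp_all add: reflect_linear)

lemma reflect_reflect: "reflect s (reflect s f) = f"
  by (auto simp: reflect_def fun_eq_iff)

lemma reflect_simple_root: "reflect s (simple_root s) = (\<lambda>x. - simple_root s x)"
  by (auto simp: reflect_def simple_root_def fun_eq_iff)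

lemma reflect_simple_root_other:
  assumes "s \<in> S" "t \<in> S" "s \<noteq> t"
  shows "reflect t (simple_root s) = (\<lambda>x. 1 * simple_root s x + cartan t s * simple_root t x)"
proof -
  have "(\<Sum>r\<in>S - {t}. cartan t r * simple_root s r) = (\<Sum>r\<in>S - {t}. if r = s then cartan t r else 0)"
    by (intro sum.cong) (auto simp: simple_root_def)
  also have "\<dots> = cartan t s" using assms finS by simp
  finally show ?thesis using assms by (auto simp: reflect_def simple_root_def fun_eq_iff)
qed

text \<open>The word \<open>a b\<close> leaves all other coordinates fixed and acts on the
  coordinates at \<open>a\<close> and \<open>b\<close> as a \<open>dihedral_step\<close>, whose
  period divides \<open>m a b\<close>.\<close>

lemma act_relator:
  assumes "a \<in> S" "b \<in> S"
  shows "act (concat (replicate (m a b) [a, b])) f = f"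
proof (cases "a = b \<or> m a b = 0")
  case True
  then show ?thesis using assms m_diag reflect_reflect by auto
next
  case False
  then have ab: "a \<noteq> b" by simp
  then have M: "m a b \<ge> 2" using m_cases[OF assms] False by simp
  define c where "c = cartan a b"
  have cba: "cartan b a = c" using m_sym assms by (simp add: c_def cartan_def)
  define k where "k = (\<Sum>t\<in>S - {a, b}. cartan a t * f t)"
  define l where "l = (\<Sum>t\<in>S - {a, b}. cartan b t * f t)"
  have "(\<Sum>t\<in>S - {a}. cartan a t * g t) = c * g b + (\<Sum>t\<in>S - {a, b}. cartan a t * g t)"
    "(\<Sum>t\<in>S - {b}. cartan b t * g t) = c * g a + (\<Sum>t\<in>S - {a, b}. cartan b t * g t)" for g
  proof -
    have 1: "S - {a} = insert b (S - {a, b})" and 2: "S - {b} = insert a (S - {a, b})"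
      using ab assms by auto
    have 3: "finite (S - {a, b})" "a \<notin> S - {a, b}" "b \<notin> S - {a, b}" using finS by auto
    show "(\<Sum>t\<in>S - {a}. cartan a t * g t) = c * g b + (\<Sum>t\<in>S - {a, b}. cartan a t * g t)"
      unfolding 1 sum.insert[OF 3(1,3)] c_def ..
    show "(\<Sum>t\<in>S - {b}. cartan b t * g t) = c * g a + (\<Sum>t\<in>S - {a, b}. cartan b t * g t)"
      unfolding 2 sum.insert[OF 3(1,2)] cba ..
  qed
  then have sums: "(\<Sum>t\<in>S - {a}. cartan a t * (f(a := x, b := y)) t) = c * y + k"
    "(\<Sum>t\<in>S - {b}. cartan b t * (f(a := x, b := y)) t) = c * x + l" for x y
    using ab by (auto simp: k_def l_def intro!: sum.cong)
  have step: "act [a, b] (f(a := x, b := y)) =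
      f(a := fst (dihedral_step c k l (x, y)), b := snd (dihedral_step c k l (x, y)))" for x y
  proof -
    have "reflect b (f(a := x, b := y)) = f(a := x, b := c * x - y + l)"
      using sums(2)[of x y] by (auto simp: reflect_def fun_eq_iff)
    moreover have "reflect a (f(a := x, b := z)) = f(a := c * z - x + k, b := z)" for z
      using sums(1)[of x z] ab by (auto simp: reflect_def fun_eq_iff)
    ultimately show ?thesis by (simp add: dihedral_step_def)
  qed
  have "act (concat (replicate n [a, b])) f =
      f(a := fst ((dihedral_step c k l ^^ n) (f a, f b)), b := snd ((dihedral_step c k l ^^ n) (f a, f b)))" for n
  proof (induction n)
    case (Suc n)
    obtain p q where pq: "(dihedral_step c k l ^^ n) (f a, f b) = (p, q)" by (rule prod.exhaust)
    have "act (concat (replicate (Suc n) [a, b])) f = act [a, b] (act (concat (replicate n [a, b])) f)"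
      by simp
    also have "act (concat (replicate n [a, b])) f = f(a := p, b := q)"
      unfolding Suc pq fst_conv snd_conv ..
    also have "act [a, b] \<dots> = f(a := fst (dihedral_step c k l (p, q)), b := snd (dihedral_step c k l (p, q)))"
      by (rule step)
    finally show ?case unfolding funpow.simps o_apply pq .
  qed simp
  from this[of "m a b"] show ?thesis
    using dihedral_step_period[OF M, of k l "f a" "f b"] M by (simp add: c_def cartan_def)
qed

lemma act_cong:
  assumes "u \<in> lists S" "v \<in> lists S" "el u = el v"
  shows "act u = act v"
  using assms
proof (induction u v rule: element_eq_induct[consumes 3])
  case (append u v u' v')
  then show ?case by (intro ext) (simp add: act_append)
next
  case (square a)
  then show ?case by (simp add: fun_eq_iff reflect_reflect)
next
  case (relator a b)
  then show ?case using act_relator by auto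
qed auto

lemma even_length_cong:
  assumes "u \<in> lists S" "v \<in> lists S" "el u = el v"
  shows "even (length u) = even (length v)"
  using assms
proof (induction u v rule: element_eq_induct[consumes 3])
  case (relator a b)
  have "length (concat (replicate n [a, b])) = 2 * n" for n by (induction n) auto
  then show ?case by simp
qed auto

section \<open>Reduced words\<close>

definition reduced :: "'a list \<Rightarrow> bool" where
  "reduced u \<longleftrightarrow> u \<in> lists S \<and> (\<forall>v\<in>lists S. el v = el u \<longrightarrow> length u \<le> length v)"

lemma reducedD: "reduced u \<Longrightarrow> v \<in> lists S \<Longrightarrow> el v = el u \<Longrightarrow> length u \<le> length v"
  by (simp add: reduced_def)

lemma reduced_cong:
  "reduced u \<Longrightarrow> v \<in> lists S \<Longrightarrow> el v = el u \<Longrightarrow> length v = length u \<Longrightarrow> reduced v"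
  by (simp add: reduced_def)

lemma ex_reduced: "u \<in> lists S \<Longrightarrow> \<exists>v. reduced v \<and> el v = el u"
  using ex_has_least_nat[of "\<lambda>v. v \<in> lists S \<and> el v = el u" u length]
  unfolding reduced_def by metis

lemma reduced_append:
  assumes "reduced (u @ v)"
  shows "reduced u" "reduced v"
proof -
  have uv: "u \<in> lists S" "v \<in> lists S" using assms by (auto simp: reduced_def)
  have "length u \<le> length u'" if "u' \<in> lists S" "el u' = el u" for u'
    using reducedD[OF assms, of "u' @ v"] that uv by (simp add: el_append)
  then show "reduced u" using uv by (simp add: reduced_def)
  have "length v \<le> length v'" if "v' \<in> lists S" "el v' = el v" for v'
    using reducedD[OF assms, of "u @ v'"] that uv by (simp add: el_append)
  then show "reduced v" using uv by (simp add: reduced_def)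
qed

lemma reduced_double: "\<not> reduced [s, s]"
proof
  assume red: "reduced [s, s]"
  then have "s \<in> S" by (simp add: reduced_def)
  then have "length [s, s] \<le> length []"
    using reducedD[OF red, of "[]"] el_square[of s] by simp
  then show False by simp
qed

text \<open>Relators have even length, so the parity of the length is an invariant of the element. A
  word for \<open>u s\<close> that is shorter than \<open>u @ [s]\<close> thus cannot have the
  length of \<open>u\<close>; it is shorter than \<open>u\<close> itself.\<close>

lemma not_reduced_snoc:
  assumes "reduced u" "s \<in> S" "\<not> reduced (u @ [s])"
  obtains v where "v \<in> lists S" "el v = el (u @ [s])" "length v < length u"
proof -
  have u: "u \<in> lists S" using assms(1) by (simp add: reduced_def)
  with assms(2,3) obtain v where v: "v \<in> lists S" "el v = el (u @ [s])" "length v < length (u @ [s])"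
    unfolding reduced_def by force
  have "even (length v) = even (length (u @ [s]))"
    using even_length_cong[OF v(1) _ v(2)] u assms(2) by simp
  then have "length v \<noteq> length u" by auto
  with v show ?thesis using that by simp
qed

subsection \<open>Alternating words\<close>

text \<open>Built from the right: the last letter is \<open>s\<close>, and removing it exchanges the
  two letters. This fits words \<open>y @ [s]\<close> and the action on
  \<open>simple_root s\<close>, where the last letter acts first.\<close>

fun alternating :: "nat \<Rightarrow> 'a \<Rightarrow> 'a \<Rightarrow> 'a list" where
  "alternating 0 s t = []"
| "alternating (Suc k) s t = alternating k t s @ [s]"

lemma length_alternating [simp]: "length (alternating k s t) = k"
  by (induction k arbitrary: s t) auto

lemma alternating_lists: "s \<in> A \<Longrightarrow> t \<in> A \<Longrightarrow> alternating k s t \<in> lists A"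
  by (induction k arbitrary: s t) auto

lemma alternating_add: "\<exists>z\<in>lists {s, t}. length z = p \<and> alternating (p + q) s t = z @ alternating q s t"
proof (induction q arbitrary: s t)
  case 0
  show ?case by (rule bexI[of _ "alternating p s t"]) (simp_all add: alternating_lists)
next
  case (Suc q)
  from Suc.IH[of t s] show ?case by (auto simp: insert_commute)
qed

lemma alternating_double: "alternating (2 * q) s t = concat (replicate q [t, s])"
proof (induction q)
  case (Suc q)
  have "concat (replicate (Suc q) [t, s]) = concat (replicate q [t, s]) @ [t, s]"
    by (induction q) auto
  then show ?case using Suc by simp
qed simp

text \<open>In the relator of length 2m the suffix of length m + 1 is the inverse of a prefix of
  length m - 1, so the reversed prefix is a shorter word for it. A reduced alternating word longer
  than m would end in such a suffix.\<close>

lemma reduced_alternating_le: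
  assumes st: "s \<in> S" "t \<in> S" and M: "0 < m t s" and red: "reduced (alternating k s t)"
  shows "k \<le> m t s"
proof (rule ccontr)
  let ?M = "m t s"
  assume "\<not> k \<le> ?M"
  then have "k = (k - Suc ?M) + Suc ?M" by simp
  then obtain z where "alternating k s t = z @ alternating (Suc ?M) s t"
    using alternating_add by metis
  then have red': "reduced (alternating (Suc ?M) s t)" using red reduced_append(2) by metis
  have "2 * ?M = (?M - 1) + Suc ?M" using M by simp
  then obtain z where z: "z \<in> lists {s, t}" "length z = ?M - 1"
    "alternating (2 * ?M) s t = z @ alternating (Suc ?M) s t"
    using alternating_add by metis
  have zS: "z \<in> lists S" using z(1) st by auto
  have aS: "alternating (Suc ?M) s t \<in> lists S" using st by (rule alternating_lists)
  have "el (z @ alternating (Suc ?M) s t) = \<one>\<^bsub>G\<^esub>"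
    using el_relator[OF st(2,1)] z(3) by (simp only: alternating_double)
  then have "el z \<cdot> el (alternating (Suc ?M) s t) = \<one>\<^bsub>G\<^esub>"
    using zS aS by (simp only: el_append)
  then have "el (alternating (Suc ?M) s t) = inv\<^bsub>G\<^esub> el z"
    using zS aS el_closed by (metis G.inv_equality G.inv_inv G.inv_closed G.inv_comm)
  then have "el (rev z) = el (alternating (Suc ?M) s t)" using el_rev[OF zS] by simp
  then have "length (alternating (Suc ?M) s t) \<le> length (rev z)"
    using reducedD[OF red', of "rev z"] zS by (auto simp: in_lists_conv_set)
  then show False using z(2) by simp
qed

lemma reduced_imp_alternating:
  "y \<in> lists {s, t} \<Longrightarrow> reduced (y @ [s]) \<Longrightarrow> y @ [s] = alternating (Suc (length y)) s t"
proof (induction y arbitrary: s t rule: rev_induct)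
  case (snoc b y)
  have "b \<noteq> s"
  proof
    assume "b = s"
    with snoc.prems(2) have "reduced (y @ [s, s])" by simp
    then show False using reduced_append(2) reduced_double by blast
  qed
  then have b: "b = t" using snoc.prems(1) by auto
  have "y \<in> lists {t, s}" using snoc.prems(1) by (auto simp: in_lists_conv_set)
  moreover have "reduced (y @ [t])" using reduced_append(1)[OF snoc.prems(2)] b by simp
  ultimately have "y @ [t] = alternating (Suc (length y)) t s" by (rule snoc.IH)
  then show ?case using b by simp
qed simp

section \<open>Roots of dihedral subgroups, positivity of roots and faithfulness\<close>

lemma act_alternating:
  assumes "s \<in> S" "t \<in> S" "s \<noteq> t"
  shows "act (alternating k t s) (simple_root s) =
    (if even k then (\<lambda>x. cheb (cartan s t) (Suc k) * simple_root s x + cheb (cartan s t) k * simple_root t x)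
     else (\<lambda>x. cheb (cartan s t) k * simple_root s x + cheb (cartan s t) (Suc k) * simple_root t x))"
  using assms
proof (induction k arbitrary: s t rule: less_induct)
  case (less k)
  let ?c = "cartan s t"
  have c: "cartan t s = ?c" using less.prems m_sym by (simp add: cartan_def)
  have r: "reflect t (simple_root s) = (\<lambda>x. 1 * simple_root s x + ?c * simple_root t x)"
    using reflect_simple_root_other[OF less.prems] c by simp
  consider "k = 0" | "k = Suc 0" | j where "k = Suc (Suc j)" by (metis not0_implies_Suc)
  then show ?case
  proof cases
    case 1
    then show ?thesis by simp
  next
    case 2
    then show ?thesis by (simp add: r cheb_Suc_Suc)
  next
    case 3
    \<comment> \<open>The last letter \<open>t\<close> sends \<open>simple_root s\<close> to
      \<open>simple_root s\<close> plus \<open>?c\<close> times \<open>simple_root t\<close>. The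
      next letter \<open>s\<close> negates the first summand, leaving \<open>j\<close> letters; the
      second one is the claim for \<open>Suc j\<close> with the letters exchanged. Together they
      give the recurrence of \<open>cheb\<close>.\<close>
    have "act (alternating k t s) (simple_root s) =
        (\<lambda>x. 1 * act (alternating (Suc j) s t) (simple_root s) x +
          ?c * act (alternating (Suc j) s t) (simple_root t) x)"
      unfolding 3 alternating.simps(2)[of "Suc j"] act_append act_Cons act_Nil r by (rule act_linear)
    moreover have "act (alternating (Suc j) s t) (simple_root s) =
        (\<lambda>x. - 1 * act (alternating j t s) (simple_root s) x)"
      using act_linear[of "alternating j t s" "- 1" "simple_root s" 0 "simple_root s"]
      by (simp add: act_append reflect_simple_root)
    ultimately show ?thesis
      using less.IH[of j s t] less.IH[of "Suc j" t s] less.prems c 3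
      by (auto simp: fun_eq_iff cheb_Suc_Suc algebra_simps)
  qed
qed

text \<open>Write \<open>u = v y\<close> with \<open>y\<close> a word in \<open>s\<close> and the
  last letter \<open>t\<close> of \<open>u\<close>, the lengths adding up, and \<open>v\<close> as
  short as possible. Then \<open>v\<close> sends both simple roots to nonnegative vectors by
  induction, and \<open>y\<close> sends \<open>simple_root s\<close> to a combination of the two
  whose coefficients are quotients of sines (or integers, for infinite order) and
  nonnegative.\<close>

lemma reduced_imp_positive:
  "reduced (u @ [s]) \<Longrightarrow> act u (simple_root s) x \<ge> 0"
proof (induction "length u" arbitrary: u s x rule: less_induct)
  case less
  have red: "reduced u" and us: "u \<in> lists S" "s \<in> S"
    using reduced_append(1)[OF less.prems] less.prems by (auto simp: reduced_def)
  show ?case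
  proof (cases u rule: rev_cases)
    case Nil
    then show ?thesis by (simp add: simple_root_def)
  next
    case (snoc u' t)
    have ts: "t \<noteq> s"
    proof
      assume "t = s"
      with less.prems snoc have "reduced (u' @ [s, s])" by simp
      then show False using reduced_append(2) reduced_double by blast
    qed
    have t: "t \<in> S" "u' \<in> lists S" using us snoc by auto
    define P where "P k \<longleftrightarrow> (\<exists>v x. v \<in> lists S \<and> x \<in> lists {s, t} \<and> el (v @ x) = el u \<and>
      length v + length x = length u \<and> length v = k)" for k
    \<comment> \<open>Splitting off just \<open>t\<close> is one admissible factorization. It makes
      the minimal \<open>v\<close> shorter than \<open>u\<close>, as the induction hypothesis
      requires.\<close>
    have P': "P (length u')"
      unfolding P_def by (rule exI[of _ u'], rule exI[of _ "[t]"]) (use snoc t in auto)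
    define k where "k = (LEAST k. P k)"
    have "P k" unfolding k_def using P' by (rule LeastI)
    have "k \<le> length u'" unfolding k_def using P' by (rule Least_le)
    have least: "\<not> P j" if "j < k" for j using that not_less_Least unfolding k_def by blast
    from \<open>P k\<close> obtain v y where v: "v \<in> lists S" "y \<in> lists {s, t}" "el (v @ y) = el u"
      "length v + length y = length u" "length v = k" unfolding P_def by blast
    have y: "y \<in> lists S" using v(2) us t by auto
    have vy: "reduced (v @ y)" by (rule reduced_cong[OF red]) (use v y in auto)
    note rv = reduced_append[OF vy]
    have pos: "act v (simple_root r) x \<ge> 0" if r: "r \<in> {s, t}" for r x
    proof -
      have rS: "r \<in> S" using r us t by auto
      \<comment> \<open>Otherwise \<open>v r\<close> has a word \<open>v'\<close> shorter than
        \<open>v\<close>, and then \<open>v'\<close> with \<open>r # y\<close> is again an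
        admissible factorization of \<open>u\<close>, against the minimality of
        \<open>v\<close>.\<close>
      have "reduced (v @ [r])"
      proof (rule ccontr)
        assume "\<not> reduced (v @ [r])"
        with rv(1) rS obtain v' where v': "v' \<in> lists S" "el v' = el (v @ [r])" "length v' < length v"
          by (rule not_reduced_snoc)
        have "el (v' @ r # y) = el (v @ [r, r] @ y)"
          using v' v(1) y rS by (simp add: el_append el_Cons[of r y]
              el_Cons[of r "r # y"] G.m_assoc el_closed)
        also have "\<dots> = el v \<cdot> (el [r, r] \<cdot> el y)"
          using v(1) y rS el_append[of v "[r, r] @ y"] el_append[of "[r, r]" y] by simp
        also have "\<dots> = el u"
          using v(1,3) y rS by (simp add: el_square el_append el_closed)
        finally have e: "el (v' @ r # y) = el u" .
        then have "length u \<le> length (v' @ r # y)"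
          using reducedD[OF red, of "v' @ r # y"] v' y rS by simp
        then have "length v' + length (r # y) = length u" using v'(3) v(4) by simp
        then have "P (length v')"
          unfolding P_def using v' v(2) r e by (intro exI[of _ v'] exI[of _ "r # y"]) auto
        then show False using least v'(3) v(5) by blast
      qed
      moreover have "length v < length u" using v(5) \<open>k \<le> length u'\<close> snoc by simp
      ultimately show ?thesis using less.hyps by blast
    qed
    \<comment> \<open>This word has the element and the length of \<open>u @ [s]\<close>. So
      \<open>y @ [s]\<close> is reduced, which forces \<open>y\<close> to alternate and to end in
      \<open>t\<close> unless it is empty.\<close>
    have "reduced (v @ (y @ [s]))"
      by (rule reduced_cong[OF less.prems])
        (use v y us el_append[of "v @ y" "[s]"] in \<open>auto simp: el_append[of u]\<close>)
    then have ys: "reduced (y @ [s])" by (rule reduced_append(2))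
    have alt: "y @ [s] = alternating (Suc (length y)) s t"
      by (rule reduced_imp_alternating[OF v(2) ys])
    then have y_alt: "y = alternating (length y) t s" by simp
    let ?c = "cartan s t" and ?n = "length y"
    \<comment> \<open>The alternating word \<open>y s\<close> is reduced, so its length is at most
      \<open>m s t\<close> when that is finite; up to this index the sines are nonnegative.\<close>
    have nonneg: "cheb ?c ?n \<ge> 0 \<and> cheb ?c (Suc ?n) \<ge> 0"
    proof (cases "m s t = 0")
      case True
      then show ?thesis by (simp add: cartan_def cheb_2)
    next
      case False
      then have "0 < m t s" using m_sym us t by simp
      moreover have "reduced (alternating (Suc ?n) s t)" using ys alt by simp
      ultimately have "Suc ?n \<le> m t s" using reduced_alternating_le us t by blast
      then have "Suc ?n \<le> m s t" using m_sym us t by simp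
      moreover have "m s t \<ge> 2" using m_cases[OF us(2) t(1)] ts False by auto
      ultimately show ?thesis using False by (simp add: cartan_def cheb_nonneg)
    qed
    have "act (v @ y) = act u"
      by (rule act_cong) (use v y us in auto)
    then have "act u (simple_root s) = act v (act y (simple_root s))"
      by (metis act_append)
    also have "act y (simple_root s) =
        (if even ?n then (\<lambda>x. cheb ?c (Suc ?n) * simple_root s x + cheb ?c ?n * simple_root t x)
         else (\<lambda>x. cheb ?c ?n * simple_root s x + cheb ?c (Suc ?n) * simple_root t x))"
      using act_alternating[OF us(2) t(1), of ?n] ts y_alt by metis
    finally show ?thesis
      using nonneg pos by (auto simp: act_linear)
  qed
qed

text \<open>It suffices that a reduced word \<open>z\<close> with trivial action is empty. If
  \<open>z = z' s\<close>, then \<open>z\<close> sends \<open>simple_root s\<close> to the negative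
  of a vector that is nonnegative by \<open>reduced_imp_positive\<close>, while the coordinate at
  \<open>s\<close> would have to be 1.\<close>

theorem act_faithful:
  assumes "u \<in> lists S" "v \<in> lists S"
  shows "el u = el v \<longleftrightarrow> (\<forall>s\<in>S. act u (simple_root s) = act v (simple_root s))"
proof
  assume "el u = el v"
  then show "\<forall>s\<in>S. act u (simple_root s) = act v (simple_root s)"
    using act_cong assms by metis
next
  assume *: "\<forall>s\<in>S. act u (simple_root s) = act v (simple_root s)"
  have rv: "rev v \<in> lists S" using assms(2) by (auto simp: in_lists_conv_set)
  have one: "el (rev v @ v) = el []"
    using assms(2) rv by (simp add: el_append el_rev el_closed el_Nil)
  have id: "act (rev v @ u) (simple_root s) = simple_root s" if "s \<in> S" for s
  proof -
    have "act (rev v @ u) (simple_root s) = act (rev v @ v) (simple_root s)"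
      using * that by (simp add: act_append)
    also have "\<dots> = simple_root s" using act_cong[OF _ _ one] rv assms(2) by simp
    finally show ?thesis .
  qed
  have w: "rev v @ u \<in> lists S" using rv assms by simp
  from ex_reduced[OF w] obtain z where z: "reduced z" "el z = el (rev v @ u)" by blast
  then have az: "act z = act (rev v @ u)" using act_cong w by (simp add: reduced_def)
  have "z = []"
  proof (cases z rule: rev_cases)
    case (snoc z' s)
    have s: "s \<in> S" using z(1) snoc by (simp add: reduced_def)
    have "act z (simple_root s) = (\<lambda>x. - 1 * act z' (simple_root s) x)"
      using act_linear[of z' "- 1" "simple_root s" 0 "simple_root s"]
      by (simp add: snoc act_append reflect_simple_root)
    then have "- act z' (simple_root s) s = simple_root s s"
      using id[OF s] az by (metis mult_minus1)
    moreover have "act z' (simple_root s) s \<ge> 0"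
      using reduced_imp_positive z(1) snoc by blast
    ultimately show ?thesis by (simp add: simple_root_def)
  qed
  then have "inv\<^bsub>G\<^esub> el v \<cdot> el u = \<one>\<^bsub>G\<^esub>"
    using z(2) assms rv by (simp add: el_append el_rev el_Nil)
  then show "el u = el v"
    using assms el_closed by (metis G.inv_equality G.inv_inv G.inv_closed G.inv_comm)
qed

end

section \<open>Structured programs for transducers\<close>

datatype ('a, 'o) com =
    Skip
  | Act "'a input_symbol \<Rightarrow> nat \<Rightarrow> nat \<times> move \<times> move \<times> 'o option"
  | Seq "('a, 'o) com" "('a, 'o) com" (infixr ";;" 60)
  | Cond "'a input_symbol \<Rightarrow> nat \<Rightarrow> bool" "('a, 'o) com" "('a, 'o) com"
  | Loop "'a input_symbol \<Rightarrow> nat \<Rightarrow> bool" "('a, 'o) com"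

type_synonym 'o mem = "nat \<times> (nat \<Rightarrow> nat) \<times> nat \<times> 'o list"

fun upd :: "'a list \<Rightarrow> nat \<times> move \<times> move \<times> 'o option \<Rightarrow> 'o mem \<Rightarrow> 'o mem" where
  "upd w (b, d, e, x) (h, \<tau>, p, out) =
     (min (length w + 1) (move_head d h), \<tau>(p := b), move_head e p,
      out @ (case x of None \<Rightarrow> [] | Some y \<Rightarrow> [y]))"

fun on_mem :: "'a list \<Rightarrow> ('a input_symbol \<Rightarrow> nat \<Rightarrow> 'b) \<Rightarrow> 'o mem \<Rightarrow> 'b" where
  "on_mem w f (h, \<tau>, p, out) = f (input_cell w h) (\<tau> p)"

fun head_pos :: "'o mem \<Rightarrow> nat" where
  "head_pos (h, \<tau>, p, out) = p"

text \<open>Big-step semantics with the space bound built in: after each action the work head has to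
  be below \<open>B\<close>. One derivation thus gives termination, the result and the space
  used.\<close>

inductive exec :: "'a list \<Rightarrow> nat \<Rightarrow> ('a, 'o) com \<Rightarrow> 'o mem \<Rightarrow> 'o mem \<Rightarrow> bool"
  for w B where
  Skip: "exec w B Skip \<mu> \<mu>"
| Act: "\<mu>' = upd w (on_mem w f \<mu>) \<mu> \<Longrightarrow> head_pos \<mu>' < B \<Longrightarrow> exec w B (Act f) \<mu> \<mu>'"
| Seq: "exec w B c \<mu> \<mu>' \<Longrightarrow> exec w B d \<mu>' \<mu>'' \<Longrightarrow> exec w B (c ;; d) \<mu> \<mu>''"
| CondT: "on_mem w b \<mu> \<Longrightarrow> exec w B c \<mu> \<mu>' \<Longrightarrow> exec w B (Cond b c d) \<mu> \<mu>'"
| CondF: "\<not> on_mem w b \<mu> \<Longrightarrow> exec w B d \<mu> \<mu>' \<Longrightarrow> exec w B (Cond b c d) \<mu> \<mu>'"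
| LoopF: "\<not> on_mem w b \<mu> \<Longrightarrow> exec w B (Loop b c) \<mu> \<mu>"
| LoopT: "on_mem w b \<mu> \<Longrightarrow> exec w B c \<mu> \<mu>' \<Longrightarrow> exec w B (Loop b c) \<mu>' \<mu>'' \<Longrightarrow>
    exec w B (Loop b c) \<mu> \<mu>''"

text \<open>The control states of the machine are the programs that remain to be executed.\<close>

primrec next_com ::
    "('a, 'o) com \<Rightarrow> 'a input_symbol \<Rightarrow> nat \<Rightarrow> ('a, 'o) com \<times> nat \<times> move \<times> move \<times> 'o option" where
  "next_com Skip x s = (Skip, s, Stay, Stay, None)"
| "next_com (Act f) x s = (Skip, f x s)"
| "next_com (c ;; d) x s =
     (if c = Skip then (d, s, Stay, Stay, None)
      else (fst (next_com c x s) ;; d, snd (next_com c x s)))"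
| "next_com (Cond b c d) x s = (if b x s then c else d, s, Stay, Stay, None)"
| "next_com (Loop b c) x s = (if b x s then c ;; Loop b c else Skip, s, Stay, Stay, None)"

text \<open>A finite set containing the program and closed under \<open>next_com\<close>, similar to
  the partial derivatives of a regular expression. It provides the finite set of states.\<close>

primrec residuals :: "('a, 'o) com \<Rightarrow> ('a, 'o) com set" where
  "residuals Skip = {Skip}"
| "residuals (Act f) = {Act f, Skip}"
| "residuals (c ;; d) = (\<lambda>c'. c' ;; d) ` residuals c \<union> residuals d"
| "residuals (Cond b c d) = insert (Cond b c d) (residuals c \<union> residuals d)"
| "residuals (Loop b c) = {Loop b c, Skip} \<union> (\<lambda>c'. c' ;; Loop b c) ` residuals c"

lemma finite_residuals: "finite (residuals c)"
  by (induction c) auto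

lemma residuals_self: "c \<in> residuals c"
  by (induction c) auto

lemma Skip_residuals: "Skip \<in> residuals c"
  by (induction c) auto

lemma next_com_residuals: "d \<in> residuals c \<Longrightarrow> fst (next_com d x s) \<in> residuals c"
  by (induction c arbitrary: d) (auto simp: residuals_self split: if_splits)

definition act_below :: "nat \<Rightarrow> ('a input_symbol \<Rightarrow> nat \<Rightarrow> nat \<times> move \<times> move \<times> 'o option) \<Rightarrow> bool" where
  "act_below K f \<longleftrightarrow> (\<forall>x s. s < K \<longrightarrow> fst (f x s) < K)"

primrec symbols_below :: "nat \<Rightarrow> ('a, 'o) com \<Rightarrow> bool" where
  "symbols_below K Skip = True"
| "symbols_below K (Act f) = act_below K f"
| "symbols_below K (c ;; d) = (symbols_below K c \<and> symbols_below K d)"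
| "symbols_below K (Cond b c d) = (symbols_below K c \<and> symbols_below K d)"
| "symbols_below K (Loop b c) = symbols_below K c"

lemma symbols_below_residuals: "symbols_below K c \<Longrightarrow> d \<in> residuals c \<Longrightarrow> symbols_below K d"
proof (induction c arbitrary: d)
  case Skip
  then show ?case by simp
next
  case (Act f)
  then have "d = Act f \<or> d = Skip" by simp
  then show ?case using Act.prems(1) by (elim disjE) simp_all
next
  case (Seq c1 c2)
  have "symbols_below K c1" "symbols_below K c2" using Seq.prems(1) by simp_all
  note IH = Seq.IH(1)[OF this(1)] Seq.IH(2)[OF this(2)]
  from Seq.prems(2) consider d' where "d' \<in> residuals c1" "d = d' ;; c2" | "d \<in> residuals c2" by auto
  then show ?case using IH \<open>symbols_below K c2\<close> by cases (metis symbols_below.simps(3))+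
next
  case (Cond b c1 c2)
  have "symbols_below K c1" "symbols_below K c2" using Cond.prems(1) by simp_all
  note IH = Cond.IH(1)[OF this(1)] Cond.IH(2)[OF this(2)]
  from Cond.prems(2) have "d = Cond b c1 c2 \<or> d \<in> residuals c1 \<or> d \<in> residuals c2" by simp
  then show ?case using IH Cond.prems(1) by metis
next
  case (Loop b c)
  have "symbols_below K c" using Loop.prems(1) by simp
  note IH = Loop.IH[OF this]
  from Loop.prems(2) have "d = Loop b c \<or> d = Skip \<or> (\<exists>d'\<in>residuals c. d = d' ;; Loop b c)" by auto
  then show ?case using IH Loop.prems(1) by (metis symbols_below.simps(1,3))
qed

lemma symbols_below_next_com:
  "symbols_below K c \<Longrightarrow> s < K \<Longrightarrow> fst (snd (next_com c x s)) < K"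
  by (induction c) (auto simp: act_below_def)

section \<open>From programs to machine runs\<close>

definition small_step :: "'a list \<Rightarrow> ('a, 'o) com \<times> 'o mem \<Rightarrow> ('a, 'o) com \<times> 'o mem" where
  "small_step w = (\<lambda>(c, \<mu>). (fst (on_mem w (next_com c) \<mu>), upd w (snd (on_mem w (next_com c) \<mu>)) \<mu>))"

inductive small_steps ::
    "'a list \<Rightarrow> nat \<Rightarrow> ('a, 'o) com \<times> 'o mem \<Rightarrow> ('a, 'o) com \<times> 'o mem \<Rightarrow> bool"
  for w B where
  refl: "small_steps w B x x"
| step: "fst x \<noteq> Skip \<Longrightarrow> head_pos (snd (small_step w x)) < B \<Longrightarrow> small_steps w B (small_step w x) y \<Longrightarrow>
    small_steps w B x y"

lemma small_steps_trans: "small_steps w B x y \<Longrightarrow> small_steps w B y z \<Longrightarrow> small_steps w B x z"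
  by (induction rule: small_steps.induct) (auto intro: small_steps.step)

lemma small_step_Seq:
  "c \<noteq> Skip \<Longrightarrow> small_step w (c ;; d, \<mu>) = (fst (small_step w (c, \<mu>)) ;; d, snd (small_step w (c, \<mu>)))"
  by (cases \<mu>) (auto simp: small_step_def)

lemma small_steps_Seq:
  "small_steps w B x y \<Longrightarrow> small_steps w B (fst x ;; d, snd x) (fst y ;; d, snd y)"
proof (induction rule: small_steps.induct)
  case (refl x)
  show ?case by (rule small_steps.refl)
next
  case (step x y)
  obtain c \<mu> where x: "x = (c, \<mu>)" by (cases x)
  show ?case
    by (rule small_steps.step) (use step in \<open>auto simp: x small_step_Seq\<close>)
qed

lemma small_steps_step:
  "small_step w (c, \<mu>) = x \<Longrightarrow> c \<noteq> Skip \<Longrightarrow> head_pos (snd x) < B \<Longrightarrow> small_steps w B x y \<Longrightarrow>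
    small_steps w B (c, \<mu>) y"
  by (rule small_steps.step) auto

lemma upd_input_head: "fst (upd w a \<mu>) \<le> length w + 1"
  by (cases a; cases \<mu>) (auto simp: min_def)

lemma exec_input_head: "exec w B c \<mu> \<mu>' \<Longrightarrow> fst \<mu> \<le> length w + 1 \<Longrightarrow> fst \<mu>' \<le> length w + 1"
  by (induction rule: exec.induct) (auto simp: upd_input_head simp del: upd.simps One_nat_def split_paired_All)

lemma exec_head_pos: "exec w B c \<mu> \<mu>' \<Longrightarrow> head_pos \<mu> < B \<Longrightarrow> head_pos \<mu>' < B"
  by (induction rule: exec.induct) auto

text \<open>Unfolding a test or a sequence costs a machine step that should leave the memory alone.
  As \<open>upd\<close> truncates the input head to the tape, this holds only for a head within the
  tape, whence the bound on \<open>fst \<mu>\<close>.\<close>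

lemma exec_small_steps:
  "exec w B c \<mu> \<mu>' \<Longrightarrow> head_pos \<mu> < B \<Longrightarrow> fst \<mu> \<le> length w + 1 \<Longrightarrow> small_steps w B (c, \<mu>) (Skip, \<mu>')"
proof (induction rule: exec.induct)
  case (Skip \<mu>)
  show ?case by (rule small_steps.refl)
next
  case (Act \<mu>' f \<mu>)
  have "small_step w (Act f, \<mu>) = (Skip, \<mu>')"
    using Act by (cases \<mu>) (simp add: small_step_def)
  then show ?case
    by (rule small_steps_step) (use Act in \<open>auto intro: small_steps.refl\<close>)
next
  case (Seq c \<mu> \<mu>' d \<mu>'')
  have h: "head_pos \<mu>' < B" "fst \<mu>' \<le> length w + 1"
    using Seq exec_head_pos exec_input_head by metis+
  have "small_steps w B (c ;; d, \<mu>) (Skip ;; d, \<mu>')"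
    using small_steps_Seq[OF Seq.IH(1), of d] Seq.prems by simp
  moreover have "small_step w (Skip ;; d, \<mu>') = (d, \<mu>')"
    using h(2) by (cases \<mu>') (simp add: small_step_def)
  then have "small_steps w B (Skip ;; d, \<mu>') (Skip, \<mu>'')"
    by (rule small_steps_step) (use Seq.IH(2) h in auto)
  ultimately show ?case by (rule small_steps_trans)
next
  case (CondT b \<mu> c \<mu>' d)
  have "small_step w (Cond b c d, \<mu>) = (c, \<mu>)"
    using CondT by (cases \<mu>) (simp add: small_step_def)
  then show ?case by (rule small_steps_step) (use CondT in auto)
next
  case (CondF b \<mu> d \<mu>' c)
  have "small_step w (Cond b c d, \<mu>) = (d, \<mu>)"
    using CondF by (cases \<mu>) (simp add: small_step_def)
  then show ?case by (rule small_steps_step) (use CondF in auto)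
next
  case (LoopF b \<mu> c)
  have "small_step w (Loop b c, \<mu>) = (Skip, \<mu>)"
    using LoopF by (cases \<mu>) (simp add: small_step_def)
  then show ?case by (rule small_steps_step) (use LoopF in \<open>auto intro: small_steps.refl\<close>)
next
  case (LoopT b \<mu> c \<mu>' \<mu>'')
  have h: "head_pos \<mu>' < B" "fst \<mu>' \<le> length w + 1"
    using LoopT exec_head_pos exec_input_head by metis+
  have 1: "small_step w (Loop b c, \<mu>) = (c ;; Loop b c, \<mu>)"
    using LoopT by (cases \<mu>) (simp add: small_step_def)
  have 2: "small_steps w B (c ;; Loop b c, \<mu>) (Skip ;; Loop b c, \<mu>')"
    using small_steps_Seq[OF LoopT.IH(1), of "Loop b c"] LoopT.prems by simp
  have "small_step w (Skip ;; Loop b c, \<mu>') = (Loop b c, \<mu>')"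
    using h(2) by (cases \<mu>') (simp add: small_step_def)
  then have "small_steps w B (Skip ;; Loop b c, \<mu>') (Skip, \<mu>'')"
    by (rule small_steps_step) (use LoopT.IH(2) h in auto)
  with 2 have "small_steps w B (c ;; Loop b c, \<mu>) (Skip, \<mu>'')"
    by (rule small_steps_trans)
  from small_steps_step[OF 1 _ _ this] show ?case
    using LoopT.prems by simp
qed

definition com_transducer :: "nat \<Rightarrow> ('a, 'o) com \<Rightarrow> (('a, 'o) com \<Rightarrow> nat) \<Rightarrow> ('a, 'o) transducer" where
  "com_transducer K c code =
     \<lparr>states = code ` residuals c, work_symbols = {..<K}, initial_state = code c,
      halting_states = {code Skip}, blank_symbol = 0,
      transition = (\<lambda>q x s. apfst code (next_com (inv_into (residuals c) code q) x s))\<rparr>"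

lemma transducer_com_transducer:
  assumes "symbols_below K c" "inj_on code (residuals c)" "0 < K"
  shows "transducer S (com_transducer K c code)"
proof -
  let ?T = "com_transducer K c code"
  have 1: "case transition ?T q x s of (q', s', _) \<Rightarrow> q' \<in> states ?T \<and> s' \<in> work_symbols ?T"
    if "q \<in> states ?T" "s \<in> work_symbols ?T" for q x s
  proof -
    from that obtain d where d: "d \<in> residuals c" "q = code d" and s: "s < K"
      by (auto simp: com_transducer_def)
    obtain d' y where n: "next_com d x s = (d', y)" by (cases "next_com d x s")
    have "inv_into (residuals c) code q = d"
      using assms(2) d by simp
    then show ?thesis
      using symbols_below_next_com[OF symbols_below_residuals[OF assms(1) d(1)] s, of x]
        next_com_residuals[OF d(1), of x s]
      by (cases y) (simp add: com_transducer_def n)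
  qed
  have 2: "finite (states ?T)" "finite (work_symbols ?T)" "initial_state ?T \<in> states ?T"
    "halting_states ?T \<subseteq> states ?T" "blank_symbol ?T \<in> work_symbols ?T"
    using finite_residuals[of c] residuals_self[of c] Skip_residuals[of c]
    by (simp_all add: com_transducer_def assms(3))
  show ?thesis
    unfolding transducer_def by (intro conjI ballI 1 2)
qed

fun com_config :: "(('a, 'o) com \<Rightarrow> nat) \<Rightarrow> ('a, 'o) com \<times> 'o mem \<Rightarrow> 'o config" where
  "com_config code (c, h, \<tau>, p, out) =
     \<lparr>cur_state = code c, input_head = h, work_tape = \<tau>, work_head = p, output_tape = out\<rparr>"

lemma work_head_com_config: "work_head (com_config code x) = head_pos (snd x)"
  by (cases x) auto

lemma step_com_config:
  assumes "inj_on code (residuals c)" "fst x \<in> residuals c" "fst x \<noteq> Skip"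
  shows "step (com_transducer K c code) w (com_config code x) = com_config code (small_step w x)"
proof -
  obtain d h \<tau> p out where x: "x = (d, h, \<tau>, p, out)" by (cases x) auto
  obtain d' b e g z where n: "next_com d (input_cell w h) (\<tau> p) = (d', b, e, g, z)"
    by (rule prod_cases5)
  have "code d \<noteq> code Skip"
    using assms Skip_residuals[of c] by (auto simp: x inj_on_def)
  moreover have "inv_into (residuals c) code (code d) = d"
    using assms by (simp add: x)
  ultimately show ?thesis
    by (simp add: x n step_def com_transducer_def small_step_def)
qed

lemma small_steps_run:
  assumes "inj_on code (residuals c)"
  shows "small_steps w B x y \<Longrightarrow> fst x \<in> residuals c \<Longrightarrow> head_pos (snd x) < B \<Longrightarrow>
    \<exists>t. (step (com_transducer K c code) w ^^ t) (com_config code x) = com_config code y \<and>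
      (\<forall>i\<le>t. work_head ((step (com_transducer K c code) w ^^ i) (com_config code x)) < B)"
proof (induction rule: small_steps.induct)
  case (refl x)
  then show ?case by (intro exI[of _ 0]) (auto simp: work_head_com_config)
next
  case (step x y)
  let ?s = "step (com_transducer K c code) w"
  have 1: "?s (com_config code x) = com_config code (small_step w x)"
    by (rule step_com_config) (use assms step in auto)
  have "fst (small_step w x) \<in> residuals c"
    using step.prems next_com_residuals by (cases x) (auto simp: small_step_def)
  from step.IH[OF this step.hyps(2)] obtain t where
    t: "(?s ^^ t) (com_config code (small_step w x)) = com_config code y"
      "\<And>i. i \<le> t \<Longrightarrow> work_head ((?s ^^ i) (com_config code (small_step w x))) < B" by blast
  show ?case
  proof (intro exI[of _ "Suc t"] conjI allI impI)
    show "(?s ^^ Suc t) (com_config code x) = com_config code y"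
      using t(1) by (simp add: funpow_Suc_right 1 del: funpow.simps)
    show "work_head ((?s ^^ i) (com_config code x)) < B" if "i \<le> Suc t" for i
      using that t(2) step.prems
      by (cases i) (auto simp: funpow_Suc_right 1 work_head_com_config simp del: funpow.simps(2))
  qed
qed

lemma step_halted: "cur_state x \<in> halting_states T \<Longrightarrow> (step T w ^^ i) x = x"
  by (induction i) (auto simp: step_def)

theorem logspace_transducer_of_com:
  fixes c :: "('a, 'o) com"
  assumes wf: "symbols_below K c" "0 < K"
    and space: "(\<lambda>n. real (s n)) \<in> O(\<lambda>n. ln (real n))" "\<And>n. s n > 0"
    and exec: "\<And>w. w \<in> lists S \<Longrightarrow> \<exists>h \<tau> p. exec w (s (length w)) c (0, \<lambda>_. 0, 0, []) (h, \<tau>, p, f w)"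
  shows "\<exists>T :: ('a, 'o) transducer. logspace_transducer S T \<and> (\<forall>w\<in>lists S. computes T w (f w))"
proof -
  obtain code :: "('a, 'o) com \<Rightarrow> nat" where code: "inj_on code (residuals c)"
    using finite_imp_inj_to_nat_seg[OF finite_residuals] by blast
  let ?T = "com_transducer K c code"
  have main: "(\<exists>t. cur_state (run ?T w t) \<in> halting_states ?T \<and> output_tape (run ?T w t) = f w) \<and>
      (\<forall>t. work_head (run ?T w t) < s (length w))" if w: "w \<in> lists S" for w
  proof -
    let ?x = "(c, 0::nat, \<lambda>_. 0::nat, 0::nat, [])"
    from exec[OF w] obtain h \<tau> p where
      "exec w (s (length w)) c (0, \<lambda>_. 0, 0, []) (h, \<tau>, p, f w)" by blast
    then have "small_steps w (s (length w)) ?x (Skip, h, \<tau>, p, f w)"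
      by (rule exec_small_steps) (use space in auto)
    from small_steps_run[OF code this] obtain t where
      t: "(step ?T w ^^ t) (com_config code ?x) = com_config code (Skip, h, \<tau>, p, f w)"
        "\<And>i. i \<le> t \<Longrightarrow> work_head ((step ?T w ^^ i) (com_config code ?x)) < s (length w)"
      using space residuals_self by fastforce
    have init: "com_config code ?x = initial_config ?T"
      by (simp add: initial_config_def com_transducer_def)
    have t': "run ?T w t = com_config code (Skip, h, \<tau>, p, f w)"
      unfolding run_def init[symmetric] by (rule t(1))
    have halt: "cur_state (run ?T w t) \<in> halting_states ?T"
      unfolding t' by (simp add: com_transducer_def)
    have "work_head (run ?T w i) < s (length w)" for i
    proof (cases "i \<le> t")
      case True
      then show ?thesis using t(2) unfolding run_def init by blast
    next
      case False
      \<comment> \<open>From time \<open>t\<close> on the machine has halted and its configuration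
        is constant, so the space bound holds at all times.\<close>
      then have "run ?T w i = run ?T w ((i - t) + t)" by simp
      also have "\<dots> = (step ?T w ^^ (i - t)) (run ?T w t)"
        unfolding run_def funpow_add by simp
      also have "\<dots> = run ?T w t" using halt by (rule step_halted)
      finally have "run ?T w i = run ?T w t" .
      then show ?thesis using t(2)[of t] unfolding run_def init by simp
    qed
    moreover have "output_tape (run ?T w t) = f w" unfolding t' by simp
    ultimately show ?thesis using halt by blast
  qed
  have "logspace_transducer S ?T"
    unfolding logspace_transducer_def
    using main space(1) transducer_com_transducer[OF wf(1) code wf(2)] by blast
  moreover have "\<forall>w\<in>lists S. computes ?T w (f w)"
    unfolding computes_def using main by blast
  ultimately show ?thesis by blast
qed

section \<open>Binary counters on the tracks of the work tape\<close>

lemma nat_less_power_iff_bits: "n < 2 ^ m \<longleftrightarrow> (\<forall>i\<ge>m. \<not> bit n i)" for n :: nat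
proof -
  have "n < 2 ^ m \<longleftrightarrow> take_bit m n = n" by (simp add: take_bit_nat_eq_self_iff)
  also have "\<dots> \<longleftrightarrow> (\<forall>i\<ge>m. \<not> bit n i)"
    by (simp add: bit_eq_iff bit_take_bit_iff) (meson not_le)
  finally show ?thesis .
qed

text \<open>The carry passes through the run of trailing ones and stops at the first zero.
  Decrement, in \<open>bit_pred_value\<close>, is the same with zeros and ones exchanged, so one
  program \<open>carry\<close> can do both.\<close>

lemma bit_Suc_value:
  "\<forall>i<q. bit n i \<Longrightarrow> \<not> bit n q \<Longrightarrow>
    bit (Suc n) i \<longleftrightarrow> (if i < q then False else if i = q then True else bit n i)" for n :: nat
proof (induction q arbitrary: n i)
  case 0
  then have "even n" by (simp add: bit_0)
  then show ?case by (cases i) (auto simp: bit_0 bit_Suc)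
next
  case (Suc q)
  from Suc.prems have "odd n" by (auto simp: bit_0)
  then have d: "Suc n div 2 = Suc (n div 2)" by simp
  have "\<forall>i<q. bit (n div 2) i" "\<not> bit (n div 2) q"
    using Suc.prems by (auto simp: bit_Suc[symmetric])
  from Suc.IH[OF this] show ?case
    using \<open>odd n\<close> by (cases i) (auto simp: bit_0 bit_Suc d)
qed

lemma bit_pred_value:
  fixes n :: nat
  assumes "\<forall>i<q. \<not> bit n i" "bit n q"
  shows "bit (n - 1) i \<longleftrightarrow> (if i < q then True else if i = q then False else bit n i)"
  using assms
proof (induction q arbitrary: n i)
  case 0
  then have "odd n" by (simp add: bit_0)
  then show ?case by (cases i) (auto simp: bit_0 bit_Suc elim!: oddE)
next
  case (Suc q)
  from Suc.prems have "even n" by (auto simp: bit_0)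
  moreover have "n \<noteq> 0" using Suc.prems(2) by (intro notI) simp
  ultimately have o: "odd (n - 1)" and d: "(n - 1) div 2 = n div 2 - 1" by (auto elim!: evenE)
  have "\<forall>i<q. \<not> bit (n div 2) i" "bit (n div 2) q"
    using Suc.prems by (auto simp: bit_Suc[symmetric])
  from Suc.IH[OF this] show ?case
    using o d by (cases i) (auto simp: bit_0 bit_Suc d simp del: One_nat_def)
qed

section \<open>Registers on tracks and the rules for programs on them\<close>

definition upd_bit :: "nat \<Rightarrow> bool \<Rightarrow> nat \<Rightarrow> nat" where
  "upd_bit r b s = (if b then set_bit r s else unset_bit r s)"

lemma bit_upd_bit [simp]: "bit (upd_bit r b s) i \<longleftrightarrow> (if i = r then b else bit s i)"
  by (auto simp: upd_bit_def bit_set_bit_iff bit_unset_bit_iff)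

lemma upd_bit_less: "r < R \<Longrightarrow> s < 2 ^ R \<Longrightarrow> upd_bit r b s < 2 ^ R"
  by (auto simp: nat_less_power_iff_bits)

text \<open>
  Bit 0 of a work symbol marks cell 0, bit 1 marks the cells in use, and bit \<open>i\<close> of register \<open>r\<close>
  is bit \<open>r + 2\<close> of the symbol in cell \<open>i\<close>.
\<close>

definition represents :: "nat \<Rightarrow> (nat \<Rightarrow> nat) \<Rightarrow> (nat \<Rightarrow> nat) \<Rightarrow> bool" where
  "represents L \<rho> \<tau> \<longleftrightarrow> (\<exists>u. 0 < u \<and> u \<le> L \<and> (\<forall>i. bit (\<tau> i) 0 \<longleftrightarrow> i = 0) \<and>
     (\<forall>i. bit (\<tau> i) 1 \<longleftrightarrow> i < u) \<and> (\<forall>i r. bit (\<tau> i) (r + 2) \<longleftrightarrow> bit (\<rho> r) i) \<and> (\<forall>r. \<rho> r < 2 ^ u))"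

text \<open>A total correctness statement on register contents, for every tape that represents them;
  the work head starts and ends in cell 0. The head bound is \<open>Suc L\<close> because a sweep
  over \<open>L\<close> used cells stops in the cell after them.\<close>

definition impl ::
    "'a list \<Rightarrow> nat \<Rightarrow> ('a, 'o) com \<Rightarrow> (nat \<Rightarrow> nat) \<times> nat \<times> 'o list \<Rightarrow> (nat \<Rightarrow> nat) \<times> nat \<times> 'o list \<Rightarrow> bool"
  where
  "impl w L c = (\<lambda>(\<rho>, h, out) (\<rho>', h', out'). \<forall>\<tau>. h \<le> length w + 1 \<longrightarrow> represents L \<rho> \<tau> \<longrightarrow>
     (\<exists>\<tau>'. represents L \<rho>' \<tau>' \<and> exec w (Suc L) c (h, \<tau>, 0, out) (h', \<tau>', 0, out')))"

lemma implI:
  assumes "\<And>\<tau>. h \<le> length w + 1 \<Longrightarrow> represents L \<rho> \<tau> \<Longrightarrow>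
    \<exists>\<tau>'. represents L \<rho>' \<tau>' \<and> exec w (Suc L) c (h, \<tau>, 0, out) (h', \<tau>', 0, out')"
  shows "impl w L c (\<rho>, h, out) (\<rho>', h', out')"
  using assms by (simp add: impl_def)

lemma implE:
  assumes "impl w L c (\<rho>, h, out) (\<rho>', h', out')" "h \<le> length w + 1" "represents L \<rho> \<tau>"
  obtains \<tau>' where "represents L \<rho>' \<tau>'" "exec w (Suc L) c (h, \<tau>, 0, out) (h', \<tau>', 0, out')"
    "h' \<le> length w + 1"
proof -
  from assms obtain \<tau>' where "represents L \<rho>' \<tau>'"
    and e: "exec w (Suc L) c (h, \<tau>, 0, out) (h', \<tau>', 0, out')" by (auto simp: impl_def)
  then show ?thesis using that exec_input_head[OF e] assms(2) by simp
qed

lemma impl_Skip: "impl w L Skip x x"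
  by (cases x) (auto intro: implI exec.Skip)

lemma impl_Seq:
  assumes "impl w L c x y" "impl w L d y z"
  shows "impl w L (c ;; d) x z"
proof -
  obtain \<rho> h out \<rho>' h' out' \<rho>'' h'' out'' where
    xyz: "x = (\<rho>, h, out)" "y = (\<rho>', h', out')" "z = (\<rho>'', h'', out'')"
    by (cases x; cases y; cases z) blast
  show ?thesis unfolding xyz(1,3)
  proof (rule implI)
    fix \<tau> assume *: "h \<le> length w + 1" "represents L \<rho> \<tau>"
    from assms(1)[unfolded xyz] * obtain \<tau>' where
      1: "represents L \<rho>' \<tau>'" "exec w (Suc L) c (h, \<tau>, 0, out) (h', \<tau>', 0, out')" "h' \<le> length w + 1"
      by (rule implE)
    from assms(2)[unfolded xyz] 1(3,1) obtain \<tau>'' where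
      "represents L \<rho>'' \<tau>''" "exec w (Suc L) d (h', \<tau>', 0, out') (h'', \<tau>'', 0, out'')" by (rule implE)
    then show "\<exists>\<tau>'. represents L \<rho>'' \<tau>' \<and> exec w (Suc L) (c ;; d) (h, \<tau>, 0, out) (h'', \<tau>', 0, out'')"
      using 1(2) by (blast intro: exec.Seq)
  qed
qed

lemma exec_CondT:
  "b (input_cell w h) (\<tau> p) \<Longrightarrow> exec w B c (h, \<tau>, p, out) \<mu> \<Longrightarrow> exec w B (Cond b c d) (h, \<tau>, p, out) \<mu>"
  by (rule exec.CondT) simp_all

lemma exec_CondF:
  "\<not> b (input_cell w h) (\<tau> p) \<Longrightarrow> exec w B d (h, \<tau>, p, out) \<mu> \<Longrightarrow> exec w B (Cond b c d) (h, \<tau>, p, out) \<mu>"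
  by (rule exec.CondF) simp_all

lemma exec_LoopF:
  "\<not> b (input_cell w h) (\<tau> p) \<Longrightarrow> exec w B (Loop b c) (h, \<tau>, p, out) (h, \<tau>, p, out)"
  by (rule exec.LoopF) simp

lemma exec_LoopT:
  "b (input_cell w h) (\<tau> p) \<Longrightarrow> exec w B c (h, \<tau>, p, out) \<mu> \<Longrightarrow> exec w B (Loop b c) \<mu> \<mu>' \<Longrightarrow>
    exec w B (Loop b c) (h, \<tau>, p, out) \<mu>'"
  by (rule exec.LoopT) simp_all

lemma impl_Cond_input:
  assumes "p (input_cell w h) \<Longrightarrow> impl w L c (\<rho>, h, out) x"
    and "\<not> p (input_cell w h) \<Longrightarrow> impl w L d (\<rho>, h, out) x"
  shows "impl w L (Cond (\<lambda>x _. p x) c d) (\<rho>, h, out) x"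
proof -
  obtain \<rho>' h' out' where x: "x = (\<rho>', h', out')" by (cases x)
  show ?thesis unfolding x
  proof (rule implI)
    fix \<tau> assume *: "h \<le> length w + 1" "represents L \<rho> \<tau>"
    show "\<exists>\<tau>'. represents L \<rho>' \<tau>' \<and>
        exec w (Suc L) (Cond (\<lambda>x _. p x) c d) (h, \<tau>, 0, out) (h', \<tau>', 0, out')"
    proof (cases "p (input_cell w h)")
      case True
      from assms(1)[OF this, unfolded x] * obtain \<tau>' where
        "represents L \<rho>' \<tau>'" "exec w (Suc L) c (h, \<tau>, 0, out) (h', \<tau>', 0, out')" by (rule implE)
      then show ?thesis using True by (intro exI[of _ \<tau>'] conjI exec_CondT)
    next
      case False
      from assms(2)[OF this, unfolded x] * obtain \<tau>' where
        "represents L \<rho>' \<tau>'" "exec w (Suc L) d (h, \<tau>, 0, out) (h', \<tau>', 0, out')" by (rule implE)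
      then show ?thesis using False by (intro exI[of _ \<tau>'] conjI exec_CondF)
    qed
  qed
qed

text \<open>The states before each round are given as explicit sequences of length \<open>m\<close>,
  so the rule needs no separate termination argument.\<close>

lemma impl_Loop_input:
  assumes body: "\<And>i. i < m \<Longrightarrow> p (input_cell w (h i))"
      "\<And>i. i < m \<Longrightarrow> impl w L c (\<rho> i, h i, out i) (\<rho> (Suc i), h (Suc i), out (Suc i))"
    and stop: "\<not> p (input_cell w (h m))"
  shows "impl w L (Loop (\<lambda>x _. p x) c) (\<rho> 0, h 0, out 0) (\<rho> m, h m, out m)"
proof (rule implI)
  fix \<tau> assume *: "h 0 \<le> length w + 1" "represents L (\<rho> 0) \<tau>"
  have "\<exists>\<tau>'. represents L (\<rho> m) \<tau>' \<and>
      exec w (Suc L) (Loop (\<lambda>x _. p x) c) (h i, \<tau>, 0, out i) (h m, \<tau>', 0, out m)"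
    if "i \<le> m" "h i \<le> length w + 1" "represents L (\<rho> i) \<tau>" for i \<tau>
    using that
  proof (induction i arbitrary: \<tau> rule: inc_induct)
    case base
    then show ?case using stop by (intro exI[of _ \<tau>] conjI exec_LoopF)
  next
    case (step i)
    from body(2)[OF step.hyps(2)] step.prems obtain \<tau>' where
      1: "represents L (\<rho> (Suc i)) \<tau>'" "h (Suc i) \<le> length w + 1"
        "exec w (Suc L) c (h i, \<tau>, 0, out i) (h (Suc i), \<tau>', 0, out (Suc i))" by (rule implE)
    from step.IH[OF 1(2,1)] obtain \<tau>'' where "represents L (\<rho> m) \<tau>''"
      "exec w (Suc L) (Loop (\<lambda>x _. p x) c) (h (Suc i), \<tau>', 0, out (Suc i)) (h m, \<tau>'', 0, out m)"
      by blast
    then show ?case using 1(3) body(1)[OF step.hyps(2)] by (intro exI[of _ \<tau>''] conjI exec_LoopT)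
  qed
  then show "\<exists>\<tau>'. represents L (\<rho> m) \<tau>' \<and>
      exec w (Suc L) (Loop (\<lambda>x _. p x) c) (h 0, \<tau>, 0, out 0) (h m, \<tau>', 0, out m)"
    using * by blast
qed

lemma exec_Act:
  "f (input_cell w h) (\<tau> p) = (s, d, e, x) \<Longrightarrow> h' = min (length w + 1) (move_head d h) \<Longrightarrow> \<tau>' = \<tau>(p := s) \<Longrightarrow>
    p' = move_head e p \<Longrightarrow> p' < B \<Longrightarrow> out' = out @ (case x of None \<Rightarrow> [] | Some y \<Rightarrow> [y]) \<Longrightarrow>
    exec w B (Act f) (h, \<tau>, p, out) (h', \<tau>', p', out')"
  by (rule exec.Act) simp_all

definition move_input :: "move \<Rightarrow> ('a, 'o) com" where
  "move_input d = Act (\<lambda>_ s. (s, d, Stay, None))"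

definition emit :: "'o \<Rightarrow> ('a, 'o) com" where
  "emit x = Act (\<lambda>_ s. (s, Stay, Stay, Some x))"

lemma impl_move_input:
  "impl w L (move_input d) (\<rho>, h, out) (\<rho>, min (length w + 1) (move_head d h), out)"
  unfolding move_input_def
proof (rule implI)
  fix \<tau> assume "represents L \<rho> \<tau>"
  moreover have "exec w (Suc L) (Act (\<lambda>_ s. (s, d, Stay, None))) (h, \<tau>, 0, out)
      (min (length w + 1) (move_head d h), \<tau>, 0, out)"
    by (rule exec_Act, simp, simp_all)
  ultimately show "\<exists>\<tau>'. represents L \<rho> \<tau>' \<and> exec w (Suc L) (Act (\<lambda>_ s. (s, d, Stay, None))) (h, \<tau>, 0, out)
      (min (length w + 1) (move_head d h), \<tau>', 0, out)" by blast
qed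

lemma impl_emit: "h \<le> length w + 1 \<Longrightarrow> impl w L (emit x) (\<rho>, h, out) (\<rho>, h, out @ [x])"
  unfolding emit_def
proof (rule implI)
  fix \<tau> assume "represents L \<rho> \<tau>" "h \<le> length w + 1"
  moreover from this(2) have "exec w (Suc L) (Act (\<lambda>_ s. (s, Stay, Stay, Some x))) (h, \<tau>, 0, out)
      (h, \<tau>, 0, out @ [x])"
    by - (rule exec_Act, simp, simp_all)
  ultimately show "\<exists>\<tau>'. represents L \<rho> \<tau>' \<and> exec w (Suc L) (Act (\<lambda>_ s. (s, Stay, Stay, Some x))) (h, \<tau>, 0, out)
      (h, \<tau>', 0, out @ [x])" by blast
qed

definition sweep :: "(nat \<Rightarrow> bool) \<Rightarrow> (nat \<Rightarrow> nat) \<Rightarrow> ('a, 'o) com" where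
  "sweep b g = Loop (\<lambda>_ s. b s) (Act (\<lambda>_ s. (g s, Stay, MoveRight, None)))"

definition rewind :: "('a, 'o) com" where
  "rewind = Loop (\<lambda>_ s. \<not> bit s 0) (Act (\<lambda>_ s. (s, Stay, MoveLeft, None)))"

lemma exec_rewind:
  assumes "h \<le> length w + 1" "\<And>i. bit (\<tau> i) 0 \<longleftrightarrow> i = 0" "p < B"
  shows "exec w B rewind (h, \<tau>, p, out) (h, \<tau>, 0, out)"
  using assms(3)
proof (induction p)
  case 0
  then show ?case unfolding rewind_def by (intro exec_LoopF) (simp add: assms)
next
  case (Suc p)
  have "exec w B (Act (\<lambda>_ s. (s, Stay, MoveLeft, None))) (h, \<tau>, Suc p, out) (h, \<tau>, p, out)"
    by (rule exec_Act, simp, use Suc.prems assms(1) in simp_all)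
  moreover have "exec w B rewind (h, \<tau>, p, out) (h, \<tau>, 0, out)"
    using Suc by simp
  ultimately show ?case unfolding rewind_def
    by (intro exec_LoopT) (simp add: assms(2) del: bit_0)
qed

lemma exec_sweep:
  assumes "h \<le> length w + 1" "\<And>i. i < q \<Longrightarrow> b (\<tau> i)" "\<not> b (\<tau> q)" "q < B"
  shows "exec w B (sweep b g) (h, \<tau>, 0, out) (h, \<lambda>i. if i < q then g (\<tau> i) else \<tau> i, q, out)"
proof -
  let ?t = "\<lambda>p i. if i < p then g (\<tau> i) else \<tau> i"
  have "exec w B (sweep b g) (h, ?t p, p, out) (h, ?t q, q, out)" if "p \<le> q" for p
    using that
  proof (induction p rule: inc_induct)
    case base
    then show ?case unfolding sweep_def by (intro exec_LoopF) (simp add: assms)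
  next
    case (step p)
    have *: "(?t p)(p := g (\<tau> p)) = ?t (Suc p)" by (auto simp: fun_eq_iff less_Suc_eq)
    have "exec w B (Act (\<lambda>_ s. (g s, Stay, MoveRight, None))) (h, ?t p, p, out) (h, ?t (Suc p), Suc p, out)"
      by (rule exec_Act, simp, use step.hyps assms(1,4) * in simp_all)
    then show ?case using step.IH assms(2)[OF step.hyps(2)] unfolding sweep_def
      by (intro exec_LoopT) simp_all
  qed
  from this[of 0] show ?thesis by simp
qed

text \<open>
  A bitwise query \<open>Q\<close> looks at one cell of all registers at a time; it has to be false on empty cells.
\<close>

definition holds_somewhere :: "((nat \<Rightarrow> bool) \<Rightarrow> bool) \<Rightarrow> (nat \<Rightarrow> nat) \<Rightarrow> bool" where
  "holds_somewhere Q \<rho> \<longleftrightarrow> (\<exists>i. Q (\<lambda>r. bit (\<rho> r) i))"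

definition found :: "((nat \<Rightarrow> bool) \<Rightarrow> bool) \<Rightarrow> nat \<Rightarrow> bool" where
  "found Q s \<longleftrightarrow> bit s 1 \<and> Q (\<lambda>r. bit s (r + 2))"

definition seek :: "((nat \<Rightarrow> bool) \<Rightarrow> bool) \<Rightarrow> ('a, 'o) com" where
  "seek Q = sweep (\<lambda>s. bit s 1 \<and> \<not> Q (\<lambda>r. bit s (r + 2))) (\<lambda>s. s)"

lemma exec_seek:
  assumes "h \<le> length w + 1" "represents L \<rho> \<tau>" "\<not> Q (\<lambda>_. False)"
  obtains q where "exec w (Suc L) (seek Q) (h, \<tau>, 0, out) (h, \<tau>, q, out)" "q \<le> L"
    "found Q (\<tau> q) \<longleftrightarrow> holds_somewhere Q \<rho>"
proof -
  from assms(2) obtain u where u: "0 < u" "u \<le> L" "\<And>i. bit (\<tau> i) 1 \<longleftrightarrow> i < u"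
    "\<And>i r. bit (\<tau> i) (r + 2) \<longleftrightarrow> bit (\<rho> r) i" "\<And>r. \<rho> r < 2 ^ u"
    unfolding represents_def by blast
  define q where "q = (LEAST i. i = u \<or> Q (\<lambda>r. bit (\<rho> r) i))"
  have q: "q = u \<or> Q (\<lambda>r. bit (\<rho> r) q)" unfolding q_def by (rule LeastI[of _ u]) simp
  have less: "i \<noteq> u \<and> \<not> Q (\<lambda>r. bit (\<rho> r) i)" if "i < q" for i
    using not_less_Least[OF that[unfolded q_def]] by simp
  have "q \<le> u" unfolding q_def by (rule Least_le) simp
  have off: "\<not> Q (\<lambda>r. bit (\<rho> r) i)" if "i \<ge> u" for i
  proof -
    have "(\<lambda>r. bit (\<rho> r) i) = (\<lambda>_. False)"
      using u(5) that by (simp add: nat_less_power_iff_bits)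
    with assms(3) show ?thesis by simp
  qed
  have "exec w (Suc L) (seek Q) (h, \<tau>, 0, out) (h, \<lambda>i. if i < q then \<tau> i else \<tau> i, q, out)"
    unfolding seek_def
    by (rule exec_sweep) (use assms(1) u q less \<open>q \<le> u\<close> in auto)
  moreover have "found Q (\<tau> q) \<longleftrightarrow> holds_somewhere Q \<rho>"
    unfolding found_def holds_somewhere_def u using q less off \<open>q \<le> u\<close>
    by (metis le_less linorder_not_less)
  ultimately show ?thesis using that \<open>q \<le> u\<close> u(2) by simp
qed

text \<open>The answer of \<open>seek\<close> is visible only in the cell where the head has
  stopped, so the branch is taken first and each branch rewinds.\<close>

definition if_some :: "((nat \<Rightarrow> bool) \<Rightarrow> bool) \<Rightarrow> ('a, 'o) com \<Rightarrow> ('a, 'o) com \<Rightarrow> ('a, 'o) com" where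
  "if_some Q c d = seek Q ;; Cond (\<lambda>_. found Q) (rewind ;; c) (rewind ;; d)"

definition while_some :: "((nat \<Rightarrow> bool) \<Rightarrow> bool) \<Rightarrow> ('a, 'o) com \<Rightarrow> ('a, 'o) com" where
  "while_some Q c = seek Q ;; Loop (\<lambda>_. found Q) (rewind ;; c ;; seek Q) ;; rewind"

lemma exec_rewind_represents:
  "h \<le> length w + 1 \<Longrightarrow> represents L \<rho> \<tau> \<Longrightarrow> p \<le> L \<Longrightarrow>
    exec w (Suc L) rewind (h, \<tau>, p, out) (h, \<tau>, 0, out)"
  by (rule exec_rewind) (auto simp: represents_def)

lemma impl_if_some:
  assumes "\<not> Q (\<lambda>_. False)"
    and "holds_somewhere Q \<rho> \<Longrightarrow> impl w L c (\<rho>, h, out) x"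
    and "\<not> holds_somewhere Q \<rho> \<Longrightarrow> impl w L d (\<rho>, h, out) x"
  shows "impl w L (if_some Q c d) (\<rho>, h, out) x"
proof -
  obtain \<rho>' h' out' where x: "x = (\<rho>', h', out')" by (cases x)
  show ?thesis unfolding x
  proof (rule implI)
    fix \<tau> assume *: "h \<le> length w + 1" "represents L \<rho> \<tau>"
    from exec_seek[where Q = Q, OF * assms(1)] obtain q where
      q: "exec w (Suc L) (seek Q) (h, \<tau>, 0, out) (h, \<tau>, q, out)" "q \<le> L"
        "found Q (\<tau> q) \<longleftrightarrow> holds_somewhere Q \<rho>" by blast
    note ret = exec_rewind_represents[OF * q(2)]
    show "\<exists>\<tau>'. represents L \<rho>' \<tau>' \<and>
        exec w (Suc L) (if_some Q c d) (h, \<tau>, 0, out) (h', \<tau>', 0, out')"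
    proof (cases "holds_somewhere Q \<rho>")
      case True
      from assms(2)[OF this, unfolded x] * obtain \<tau>' where
        1: "represents L \<rho>' \<tau>'" "exec w (Suc L) c (h, \<tau>, 0, out) (h', \<tau>', 0, out')" by (rule implE)
      have "exec w (Suc L) (if_some Q c d) (h, \<tau>, 0, out) (h', \<tau>', 0, out')"
        unfolding if_some_def
        by (rule exec.Seq[OF q(1)], rule exec_CondT, use q(3) True in simp, rule exec.Seq[OF ret 1(2)])
      then show ?thesis using 1(1) by blast
    next
      case False
      from assms(3)[OF this, unfolded x] * obtain \<tau>' where
        1: "represents L \<rho>' \<tau>'" "exec w (Suc L) d (h, \<tau>, 0, out) (h', \<tau>', 0, out')" by (rule implE)
      have "exec w (Suc L) (if_some Q c d) (h, \<tau>, 0, out) (h', \<tau>', 0, out')"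
        unfolding if_some_def
        by (rule exec.Seq[OF q(1)], rule exec_CondF, use q(3) False in simp, rule exec.Seq[OF ret 1(2)])
      then show ?thesis using 1(1) by blast
    qed
  qed
qed

lemma impl_while_some:
  assumes Q: "\<not> Q (\<lambda>_. False)"
    and body: "\<And>i. i < m \<Longrightarrow> holds_somewhere Q (\<rho> i)"
      "\<And>i. i < m \<Longrightarrow> impl w L c (\<rho> i, h i, out i) (\<rho> (Suc i), h (Suc i), out (Suc i))"
    and stop: "\<not> holds_somewhere Q (\<rho> m)"
  shows "impl w L (while_some Q c) (\<rho> 0, h 0, out 0) (\<rho> m, h m, out m)"
proof (rule implI)
  fix \<tau> assume *: "h 0 \<le> length w + 1" "represents L (\<rho> 0) \<tau>"
  let ?l = "Loop (\<lambda>_. found Q) (rewind ;; c ;; seek Q)"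
  \<comment> \<open>The induction starts after a search, with the head still in the cell
    \<open>q\<close> where it stopped, since this is where the loop tests its condition.\<close>
  have loop: "\<exists>\<tau>'. represents L (\<rho> m) \<tau>' \<and>
      exec w (Suc L) (?l ;; rewind) (h i, \<tau>, q, out i) (h m, \<tau>', 0, out m)"
    if "i \<le> m" "h i \<le> length w + 1" "represents L (\<rho> i) \<tau>" "q \<le> L"
      "found Q (\<tau> q) \<longleftrightarrow> holds_somewhere Q (\<rho> i)" for i \<tau> q
    using that
  proof (induction i arbitrary: \<tau> q rule: inc_induct)
    case base
    then show ?case
      by (intro exI[of _ \<tau>] conjI exec.Seq[OF exec_LoopF] exec_rewind_represents) (use stop in auto)
  next
    case (step i)
    note ret = exec_rewind_represents[OF step.prems(1,2,3)]
    from body(2)[OF step.hyps(2)] step.prems(1,2) obtain \<tau>' where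
      1: "represents L (\<rho> (Suc i)) \<tau>'" "h (Suc i) \<le> length w + 1"
        "exec w (Suc L) c (h i, \<tau>, 0, out i) (h (Suc i), \<tau>', 0, out (Suc i))" by (rule implE)
    from exec_seek[where Q = Q, OF 1(2,1) Q] obtain q' where
      q': "exec w (Suc L) (seek Q) (h (Suc i), \<tau>', 0, out (Suc i)) (h (Suc i), \<tau>', q', out (Suc i))"
        "q' \<le> L" "found Q (\<tau>' q') \<longleftrightarrow> holds_somewhere Q (\<rho> (Suc i))" by blast
    from step.IH[OF 1(2,1) q'(2,3)] obtain \<tau>'' where 2: "represents L (\<rho> m) \<tau>''"
      "exec w (Suc L) (?l ;; rewind) (h (Suc i), \<tau>', q', out (Suc i)) (h m, \<tau>'', 0, out m)" by blast
    from 2(2) obtain \<mu> where \<mu>: "exec w (Suc L) ?l (h (Suc i), \<tau>', q', out (Suc i)) \<mu>"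
      "exec w (Suc L) rewind \<mu> (h m, \<tau>'', 0, out m)" by (cases rule: exec.cases) auto
    have "exec w (Suc L) ?l (h i, \<tau>, q, out i) \<mu>"
      by (rule exec_LoopT[OF _ exec.Seq[OF ret exec.Seq[OF 1(3) q'(1)]] \<mu>(1)])
        (use step.prems body(1)[OF step.hyps(2)] in simp)
    from exec.Seq[OF this \<mu>(2)] 2(1) show ?case by blast
  qed
  from exec_seek[where Q = Q, OF * Q] obtain q where
    q: "exec w (Suc L) (seek Q) (h 0, \<tau>, 0, out 0) (h 0, \<tau>, q, out 0)" "q \<le> L"
      "found Q (\<tau> q) \<longleftrightarrow> holds_somewhere Q (\<rho> 0)" by blast
  from loop[OF _ * q(2,3)] obtain \<tau>' where "represents L (\<rho> m) \<tau>'"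
    "exec w (Suc L) (?l ;; rewind) (h 0, \<tau>, q, out 0) (h m, \<tau>', 0, out m)" by blast
  with q(1) show "\<exists>\<tau>'. represents L (\<rho> m) \<tau>' \<and>
      exec w (Suc L) (while_some Q c) (h 0, \<tau>, 0, out 0) (h m, \<tau>', 0, out m)"
    unfolding while_some_def by (blast intro: exec.Seq)
qed

section \<open>Writing, incrementing and printing registers\<close>

definition assign :: "nat \<Rightarrow> ((nat \<Rightarrow> bool) \<Rightarrow> bool) \<Rightarrow> ('a, 'o) com" where
  "assign a Q = sweep (\<lambda>s. bit s 1) (\<lambda>s. upd_bit (a + 2) (Q (\<lambda>r. bit s (r + 2))) s) ;; rewind"

lemma impl_assign:
  assumes "\<not> Q (\<lambda>_. False)" and k: "\<And>i. bit k i \<longleftrightarrow> Q (\<lambda>r. bit (\<rho> r) i)"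
  shows "impl w L (assign a Q) (\<rho>, h, out) (\<rho>(a := k), h, out)"
proof (rule implI)
  fix \<tau> assume h: "h \<le> length w + 1" and r: "represents L \<rho> \<tau>"
  from r obtain u where u: "0 < u" "u \<le> L" "\<And>i. bit (\<tau> i) 0 \<longleftrightarrow> i = 0" "\<And>i. bit (\<tau> i) 1 \<longleftrightarrow> i < u"
    "\<And>i r. bit (\<tau> i) (r + 2) \<longleftrightarrow> bit (\<rho> r) i" "\<And>r. \<rho> r < 2 ^ u"
    unfolding represents_def by blast
  let ?g = "\<lambda>s. upd_bit (a + 2) (Q (\<lambda>r. bit s (r + 2))) s"
  let ?t = "\<lambda>i. if i < u then ?g (\<tau> i) else \<tau> i"
  have sw: "exec w (Suc L) (sweep (\<lambda>s. bit s 1) ?g) (h, \<tau>, 0, out) (h, ?t, u, out)"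
    by (rule exec_sweep) (use h u in auto)
  have off: "\<not> Q (\<lambda>r. bit (\<rho> r) i)" if "i \<ge> u" for i
  proof -
    have "(\<lambda>r. bit (\<rho> r) i) = (\<lambda>_. False)"
      using u(6) that by (simp add: nat_less_power_iff_bits)
    with assms(1) show ?thesis by simp
  qed
  have "k < 2 ^ u" using off k by (simp add: nat_less_power_iff_bits)
  have b2: "bit (\<tau> i) (Suc (Suc r)) \<longleftrightarrow> bit (\<rho> r) i" for i r using u(5)[of i r] by simp
  have b1: "bit (\<tau> i) (Suc 0) \<longleftrightarrow> i < u" for i using u(4)[of i] by simp
  have "represents L (\<rho>(a := k)) ?t"
    unfolding represents_def
  proof (intro exI[of _ u] conjI allI)
    fix i r
    show "bit (?t i) (r + 2) \<longleftrightarrow> bit ((\<rho>(a := k)) r) i"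
      using off[of i] u(6)[of a] k[of i] by (auto simp: b2 nat_less_power_iff_bits)
  qed (use u \<open>k < 2 ^ u\<close> b1 in auto)
  moreover from this have "exec w (Suc L) rewind (h, ?t, u, out) (h, ?t, 0, out)"
    by (rule exec_rewind_represents[OF h]) (use u in auto)
  ultimately show "\<exists>\<tau>'. represents L (\<rho>(a := k)) \<tau>' \<and>
      exec w (Suc L) (assign a Q) (h, \<tau>, 0, out) (h, \<tau>', 0, out)"
    using sw unfolding assign_def by (blast intro: exec.Seq)
qed

text \<open>With \<open>v = True\<close> this increments, with \<open>v = False\<close> it
  decrements. The cell where the carry ends is also marked as used; this is how numbers grow without
  the machine knowing \<open>L\<close>.\<close>

definition carry :: "bool \<Rightarrow> nat \<Rightarrow> ('a, 'o) com" where
  "carry v a = sweep (\<lambda>s. bit s (a + 2) = v) (\<lambda>s. upd_bit (a + 2) (\<not> v) s) ;;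
     Act (\<lambda>_ s. (upd_bit (a + 2) v (upd_bit 1 True s), Stay, Stay, None)) ;; rewind"

lemma impl_carry:
  assumes q: "\<And>i. i < q \<Longrightarrow> bit (\<rho> a) i = v" "bit (\<rho> a) q = (\<not> v)" "q < L"
    and k: "\<And>i. bit k i \<longleftrightarrow> (if i < q then \<not> v else if i = q then v else bit (\<rho> a) i)"
  shows "impl w L (carry v a) (\<rho>, h, out) (\<rho>(a := k), h, out)"
proof (rule implI)
  fix \<tau> assume h: "h \<le> length w + 1" and r: "represents L \<rho> \<tau>"
  from r obtain u where u: "0 < u" "u \<le> L" "\<And>i. bit (\<tau> i) 0 \<longleftrightarrow> i = 0" "\<And>i. bit (\<tau> i) 1 \<longleftrightarrow> i < u"
    "\<And>i r. bit (\<tau> i) (r + 2) \<longleftrightarrow> bit (\<rho> r) i" "\<And>r. \<rho> r < 2 ^ u"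
    unfolding represents_def by blast
  \<comment> \<open>All bits from cell \<open>u\<close> on are zero. If \<open>q\<close> were beyond
    \<open>u\<close>, the bits at \<open>u\<close> and \<open>q\<close> would agree, but one equals
    \<open>v\<close> and the other does not.\<close>
  have "q \<le> u"
  proof (rule ccontr)
    assume "\<not> q \<le> u"
    then have "bit (\<rho> a) u = v" "bit (\<rho> a) q = (\<not> v)" using q by auto
    then show False using u(6)[of a] \<open>\<not> q \<le> u\<close> by (auto simp: nat_less_power_iff_bits)
  qed
  let ?t = "\<lambda>i. if i < q then upd_bit (a + 2) (\<not> v) (\<tau> i) else \<tau> i"
  let ?t' = "?t(q := upd_bit (a + 2) v (upd_bit 1 True (\<tau> q)))"
  have sw: "exec w (Suc L) (sweep (\<lambda>s. bit s (a + 2) = v) (\<lambda>s. upd_bit (a + 2) (\<not> v) s))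
      (h, \<tau>, 0, out) (h, ?t, q, out)"
    by (rule exec_sweep) (use h q u(5)[of _ a] in auto)
  have act: "exec w (Suc L) (Act (\<lambda>_ s. (upd_bit (a + 2) v (upd_bit 1 True s), Stay, Stay, None)))
      (h, ?t, q, out) (h, ?t', q, out)"
    by (rule exec_Act, simp, use h q in auto)
  have b2: "bit (\<tau> i) (Suc (Suc r)) \<longleftrightarrow> bit (\<rho> r) i" for i r using u(5)[of i r] by simp
  have b1: "bit (\<tau> i) (Suc 0) \<longleftrightarrow> i < u" for i using u(4)[of i] by simp
  let ?u = "max u (Suc q)"
  have rep: "represents L (\<rho>(a := k)) ?t'"
    unfolding represents_def
  proof (intro exI[of _ ?u] conjI allI)
    fix i r
    show "bit (?t' i) (r + 2) \<longleftrightarrow> bit ((\<rho>(a := k)) r) i"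
      using k[of i] by (auto simp: b2)
    show "bit (?t' i) 1 \<longleftrightarrow> i < ?u"
      using \<open>q \<le> u\<close> by (auto simp: b1 max_def)
    show "(\<rho>(a := k)) r < 2 ^ ?u"
      using u(6)[of r] u(6)[of a] k by (auto simp: nat_less_power_iff_bits)
  qed (use u q(3) in auto)
  moreover from this have "exec w (Suc L) rewind (h, ?t', q, out) (h, ?t', 0, out)"
    by (rule exec_rewind_represents[OF h]) (use q in auto)
  ultimately show "\<exists>\<tau>'. represents L (\<rho>(a := k)) \<tau>' \<and>
      exec w (Suc L) (carry v a) (h, \<tau>, 0, out) (h, \<tau>', 0, out)"
    using sw act unfolding carry_def by (blast intro: exec.Seq)
qed

abbreviation inc :: "nat \<Rightarrow> ('a, 'o) com" where "inc \<equiv> carry True"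
abbreviation dec :: "nat \<Rightarrow> ('a, 'o) com" where "dec \<equiv> carry False"

lemma impl_inc:
  assumes "\<rho> a + 1 < 2 ^ L"
  shows "impl w L (inc a) (\<rho>, h, out) (\<rho>(a := \<rho> a + 1), h, out)"
proof -
  define q where "q = (LEAST i. \<not> bit (\<rho> a) i)"
  \<comment> \<open>\<open>n < 2\<^sup>n\<close> supplies a zero bit, so the least one
    exists.\<close>
  have "\<not> bit (\<rho> a) (\<rho> a)"
    using iffD1[OF nat_less_power_iff_bits less_exp, of "\<rho> a"] by blast
  then have q: "\<not> bit (\<rho> a) q" unfolding q_def by (rule LeastI)
  have less: "\<forall>i<q. bit (\<rho> a) i" unfolding q_def using not_less_Least by blast
  note b = bit_Suc_value[OF less q]
  have "q < L"
    using assms b[of q] iffD1[OF nat_less_power_iff_bits, of "Suc (\<rho> a)" L] by (auto simp: not_le[symmetric])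
  then show ?thesis
    by (intro impl_carry[of q]) (use less q b in auto)
qed

lemma impl_dec:
  assumes "\<rho> a > 0" "\<rho> a < 2 ^ L"
  shows "impl w L (dec a) (\<rho>, h, out) (\<rho>(a := \<rho> a - 1), h, out)"
proof -
  define q where "q = (LEAST i. bit (\<rho> a) i)"
  have "\<exists>i. bit (\<rho> a) i"
  proof (rule ccontr)
    assume "\<nexists>i. bit (\<rho> a) i"
    then have "\<rho> a < 2 ^ 0" unfolding nat_less_power_iff_bits by blast
    then show False using assms(1) by simp
  qed
  then have q: "bit (\<rho> a) q" unfolding q_def by (rule LeastI_ex)
  have less: "\<forall>i<q. \<not> bit (\<rho> a) i" unfolding q_def using not_less_Least by blast
  note b = bit_pred_value[OF less q]
  have "q < L"
    using assms(2) q iffD1[OF nat_less_power_iff_bits, of "\<rho> a" L] by (auto simp: not_le[symmetric])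
  then show ?thesis
    by (intro impl_carry[of q]) (use less q b in auto)
qed

text \<open>The second assumption says that \<open>q\<close> is the leading bit, except that zero is
  still printed with one digit.\<close>

lemma binary_eq_bits:
  "n < 2 ^ Suc q \<Longrightarrow> q = 0 \<or> bit n q \<Longrightarrow> binary n = map (bit n) (rev [0..<Suc q])"
proof (induction q arbitrary: n)
  case 0
  then have "n = 0 \<or> n = 1" by auto
  then show ?case by (subst binary.simps) (auto simp: bit_0)
next
  case (Suc q)
  from Suc.prems have b: "bit n (Suc q)" by simp
  have "n \<ge> 2"
  proof (rule ccontr)
    assume "\<not> 2 \<le> n"
    then have "n < 2 ^ 1" by simp
    with b show False unfolding nat_less_power_iff_bits by auto
  qed
  moreover have "n div 2 < 2 ^ Suc q" "bit (n div 2) q"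
    using Suc.prems(1) b by (auto simp: bit_Suc)
  then have "binary (n div 2) = map (bit (n div 2)) (rev [0..<Suc q])"
    by (intro Suc.IH) auto
  moreover have "map (bit n) (rev [0..<Suc (Suc q)]) = map (bit n) (rev (map Suc [0..<Suc q])) @ [bit n 0]"
    by (subst upt_conv_Cons) (simp_all add: map_Suc_upt del: upt_Suc)
  ultimately show ?case
    by (subst binary.simps) (simp add: rev_map bit_Suc o_def bit_0 del: upt_Suc)
qed

definition step_left :: "('a, 'o) com" where
  "step_left = Act (\<lambda>_ s. (s, Stay, MoveLeft, None))"

definition emit_bit :: "nat \<Rightarrow> ('a, output_symbol) com" where
  "emit_bit r = Act (\<lambda>_ s. (s, Stay, Stay, Some (Bit (bit s (r + 2)))))"

text \<open>The head goes to the last used cell and back over leading zeros, but never beyond cell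
  0, so that zero yields a single digit. From there the bits are printed downwards.\<close>

definition emit_register :: "nat \<Rightarrow> ('a, output_symbol) com" where
  "emit_register r = sweep (\<lambda>s. bit s 1) (\<lambda>s. s) ;; step_left ;;
     Loop (\<lambda>_ s. \<not> bit s 0 \<and> \<not> bit s (r + 2)) step_left ;;
     emit_bit r ;; Loop (\<lambda>_ s. \<not> bit s 0) (step_left ;; emit_bit r)"

lemma exec_step_left:
  "h \<le> length w + 1 \<Longrightarrow> p < Suc B \<Longrightarrow> p' = p - 1 \<Longrightarrow> p' < B \<Longrightarrow> exec w B step_left (h, \<tau>, p, out) (h, \<tau>, p', out)"
  unfolding step_left_def by (rule exec_Act, simp, simp_all)

lemma exec_emit_bit:
  "h \<le> length w + 1 \<Longrightarrow> p < B \<Longrightarrow>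
    exec w B (emit_bit r) (h, \<tau>, p, out) (h, \<tau>, p, out @ [Bit (bit (\<tau> p) (r + 2))])"
  unfolding emit_bit_def by (rule exec_Act, simp, simp_all)

lemma impl_emit_register:
  "impl w L (emit_register r) (\<rho>, h, out) (\<rho>, h, out @ map Bit (binary (\<rho> r)))"
proof (rule implI)
  fix \<tau> assume h: "h \<le> length w + 1" and rep: "represents L \<rho> \<tau>"
  from rep obtain u where u: "0 < u" "u \<le> L" "\<And>i. bit (\<tau> i) 0 \<longleftrightarrow> i = 0" "\<And>i. bit (\<tau> i) 1 \<longleftrightarrow> i < u"
    "\<And>i r. bit (\<tau> i) (r + 2) \<longleftrightarrow> bit (\<rho> r) i" "\<And>r. \<rho> r < 2 ^ u"
    unfolding represents_def by blast
  let ?n = "\<rho> r"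
  have "exec w (Suc L) (sweep (\<lambda>s. bit s 1) (\<lambda>s. s)) (h, \<tau>, 0, out)
      (h, \<lambda>i. if i < u then \<tau> i else \<tau> i, u, out)"
    by (rule exec_sweep) (use h u in auto)
  then have 1: "exec w (Suc L) (sweep (\<lambda>s. bit s 1) (\<lambda>s. s)) (h, \<tau>, 0, out) (h, \<tau>, u, out)"
    by simp
  have 2: "exec w (Suc L) step_left (h, \<tau>, u, out) (h, \<tau>, u - 1, out)"
    by (rule exec_step_left) (use h u in auto)
  have 3: "\<exists>q\<le>p. ?n < 2 ^ Suc q \<and> (q = 0 \<or> bit ?n q) \<and>
      exec w (Suc L) (Loop (\<lambda>_ s. \<not> bit s 0 \<and> \<not> bit s (r + 2)) step_left) (h, \<tau>, p, out) (h, \<tau>, q, out)"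
    if "?n < 2 ^ Suc p" "p \<le> L" for p
    using that
  proof (induction p)
    case 0
    then show ?case
      by (intro exI[of _ 0] conjI exec_LoopF) (use u(3)[of 0] in auto)
  next
    case (Suc p)
    show ?case
    proof (cases "bit ?n (Suc p)")
      case True
      then show ?thesis
        by (intro exI[of _ "Suc p"] conjI exec_LoopF) (use Suc.prems u(5)[of "Suc p" r] in auto)
    next
      case False
      then have "?n < 2 ^ Suc p"
        using Suc.prems(1) unfolding nat_less_power_iff_bits by (metis le_antisym not_less_eq_eq)
      with Suc obtain q where q: "q \<le> p" "?n < 2 ^ Suc q" "q = 0 \<or> bit ?n q"
        "exec w (Suc L) (Loop (\<lambda>_ s. \<not> bit s 0 \<and> \<not> bit s (r + 2)) step_left) (h, \<tau>, p, out) (h, \<tau>, q, out)"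
        by auto
      have "exec w (Suc L) step_left (h, \<tau>, Suc p, out) (h, \<tau>, p, out)"
        by (rule exec_step_left) (use h Suc.prems in auto)
      from exec_LoopT[OF _ this q(4)] have
        "exec w (Suc L) (Loop (\<lambda>_ s. \<not> bit s 0 \<and> \<not> bit s (r + 2)) step_left) (h, \<tau>, Suc p, out) (h, \<tau>, q, out)"
        using False u(3)[of "Suc p"] u(5)[of "Suc p" r] by blast
      with q show ?thesis by (intro exI[of _ q]) auto
    qed
  qed
  have 4: "exec w (Suc L) (Loop (\<lambda>_ s. \<not> bit s 0) (step_left ;; emit_bit r)) (h, \<tau>, q, out)
      (h, \<tau>, 0, out @ map (\<lambda>i. Bit (bit ?n i)) (rev [0..<q]))" if "q \<le> L" for q out
    using that
  proof (induction q arbitrary: out)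
    case 0
    then show ?case using u(3)[of 0] by (auto intro: exec_LoopF)
  next
    case (Suc q)
    have "exec w (Suc L) step_left (h, \<tau>, Suc q, out) (h, \<tau>, q, out)"
      by (rule exec_step_left) (use h Suc.prems in auto)
    moreover have "exec w (Suc L) (emit_bit r) (h, \<tau>, q, out) (h, \<tau>, q, out @ [Bit (bit ?n q)])"
      using exec_emit_bit[OF h, of q "Suc L" r \<tau> out] Suc.prems unfolding u(5) by simp
    ultimately have "exec w (Suc L) (step_left ;; emit_bit r) (h, \<tau>, Suc q, out)
        (h, \<tau>, q, out @ [Bit (bit ?n q)])" by (rule exec.Seq)
    from exec_LoopT[OF _ this Suc.IH] show ?case
      using Suc.prems u(3)[of "Suc q"] by simp
  qed
  have "?n < 2 ^ Suc (u - 1)" using u(1) u(6)[of r] by simp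
  moreover have "u - 1 \<le> L" using u(2) by simp
  ultimately obtain q where q: "q \<le> u - 1" "?n < 2 ^ Suc q" "q = 0 \<or> bit ?n q"
    "exec w (Suc L) (Loop (\<lambda>_ s. \<not> bit s 0 \<and> \<not> bit s (r + 2)) step_left) (h, \<tau>, u - 1, out) (h, \<tau>, q, out)"
    using 3 by blast
  have 5: "exec w (Suc L) (emit_bit r) (h, \<tau>, q, out) (h, \<tau>, q, out @ [Bit (bit ?n q)])"
    using exec_emit_bit[OF h, of q "Suc L" r \<tau> out] q(1) u(2) unfolding u(5) by simp
  have 6: "exec w (Suc L) (Loop (\<lambda>_ s. \<not> bit s 0) (step_left ;; emit_bit r))
      (h, \<tau>, q, out @ [Bit (bit ?n q)]) (h, \<tau>, 0, out @ map Bit (binary ?n))"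
    using 4[of q "out @ [Bit (bit ?n q)]"] q(1) u(2) binary_eq_bits[OF q(2,3)] by (simp add: o_def)
  have "exec w (Suc L) (emit_register r) (h, \<tau>, 0, out) (h, \<tau>, 0, out @ map Bit (binary ?n))"
    unfolding emit_register_def by (intro exec.Seq[OF 1] exec.Seq[OF 2] exec.Seq[OF q(4)] exec.Seq[OF 5] 6)
  with rep show "\<exists>\<tau>'. represents L \<rho> \<tau>' \<and>
      exec w (Suc L) (emit_register r) (h, \<tau>, 0, out) (h, \<tau>', 0, out @ map Bit (binary ?n))" by blast
qed

definition if_neq :: "nat \<Rightarrow> nat \<Rightarrow> ('a, 'o) com \<Rightarrow> ('a, 'o) com \<Rightarrow> ('a, 'o) com" where
  "if_neq a b = if_some (\<lambda>\<beta>. \<beta> a \<noteq> \<beta> b)"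

definition while_neq :: "nat \<Rightarrow> nat \<Rightarrow> ('a, 'o) com \<Rightarrow> ('a, 'o) com" where
  "while_neq a b = while_some (\<lambda>\<beta>. \<beta> a \<noteq> \<beta> b)"

definition if_pos :: "nat \<Rightarrow> ('a, 'o) com \<Rightarrow> ('a, 'o) com \<Rightarrow> ('a, 'o) com" where
  "if_pos a = if_some (\<lambda>\<beta>. \<beta> a)"

definition clear :: "nat \<Rightarrow> ('a, 'o) com" where
  "clear a = assign a (\<lambda>_. False)"

definition copy :: "nat \<Rightarrow> nat \<Rightarrow> ('a, 'o) com" where
  "copy a b = assign a (\<lambda>\<beta>. \<beta> b)"

lemma impl_if_neq:
  assumes "\<rho> a \<noteq> \<rho> b \<Longrightarrow> impl w L c (\<rho>, h, out) x" "\<rho> a = \<rho> b \<Longrightarrow> impl w L d (\<rho>, h, out) x"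
  shows "impl w L (if_neq a b c d) (\<rho>, h, out) x"
  unfolding if_neq_def
  by (rule impl_if_some) (use assms in \<open>auto simp: holds_somewhere_def bit_eq_iff\<close>)

lemma impl_while_neq:
  assumes "\<And>i. i < m \<Longrightarrow> \<rho> i a \<noteq> \<rho> i b" "\<rho> m a = \<rho> m b"
    and "\<And>i. i < m \<Longrightarrow> impl w L c (\<rho> i, h i, out i) (\<rho> (Suc i), h (Suc i), out (Suc i))"
  shows "impl w L (while_neq a b c) (\<rho> 0, h 0, out 0) (\<rho> m, h m, out m)"
  unfolding while_neq_def
  by (rule impl_while_some[where \<rho> = \<rho> and h = h and out = out])
    (use assms in \<open>auto simp: holds_somewhere_def bit_eq_iff\<close>)

lemma impl_if_pos:
  assumes "\<rho> a > 0 \<Longrightarrow> impl w L c (\<rho>, h, out) x" "\<rho> a = 0 \<Longrightarrow> impl w L d (\<rho>, h, out) x"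
  shows "impl w L (if_pos a c d) (\<rho>, h, out) x"
  unfolding if_pos_def
proof (rule impl_if_some)
  have "holds_somewhere (\<lambda>\<beta>. \<beta> a) \<rho> \<longleftrightarrow> \<rho> a > 0"
    using bit_eq_iff[of "\<rho> a" 0] by (auto simp: holds_somewhere_def)
  then show "holds_somewhere (\<lambda>\<beta>. \<beta> a) \<rho> \<Longrightarrow> impl w L c (\<rho>, h, out) x"
    "\<not> holds_somewhere (\<lambda>\<beta>. \<beta> a) \<rho> \<Longrightarrow> impl w L d (\<rho>, h, out) x"
    using assms by auto
qed simp

lemma impl_clear: "impl w L (clear a) (\<rho>, h, out) (\<rho>(a := 0), h, out)"
  unfolding clear_def by (rule impl_assign) auto

lemma impl_copy: "impl w L (copy a b) (\<rho>, h, out) (\<rho>(a := \<rho> b), h, out)"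
  unfolding copy_def by (rule impl_assign) auto

text \<open>The symbol 3 has bits 0 and 1 set: it marks cell 0 as the first cell and as used, with
  all registers zero.\<close>

definition init_tape :: "('a, 'o) com" where
  "init_tape = Act (\<lambda>_ s. (3, Stay, Stay, None))"

lemma bit_3: "bit (3::nat) i \<longleftrightarrow> i < 2"
proof -
  have "(3::nat) = mask 2" by (simp add: mask_eq_exp_minus_1)
  then show ?thesis by (simp only: bit_mask_iff) simp
qed

lemma exec_of_impl:
  assumes "impl w L c (\<lambda>_. 0, 0, []) (\<rho>, h, out)" "0 < L"
  shows "\<exists>h \<tau> p. exec w (Suc L) (init_tape ;; c) (0, \<lambda>_. 0, 0, []) (h, \<tau>, p, out)"
proof -
  let ?t = "(\<lambda>_. 0)(0 := 3) :: nat \<Rightarrow> nat"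
  have 1: "exec w (Suc L) init_tape (0, \<lambda>_. 0, 0, []) (0, ?t, 0, [])"
    unfolding init_tape_def by (rule exec_Act, simp, simp_all)
  have "represents L (\<lambda>_. 0) ?t"
    unfolding represents_def by (rule exI[of _ 1]) (use assms(2) in \<open>auto simp: bit_3 bit_0\<close>)
  from assms(1) _ this obtain \<tau>' where "exec w (Suc L) c (0, ?t, 0, []) (h, \<tau>', 0, out)"
    by (rule implE) simp
  with 1 show ?thesis by (blast intro: exec.Seq)
qed

subsection \<open>The tracks used\<close>

lemma act_belowI: "(\<And>x s. s < K \<Longrightarrow> fst (f x s) < K) \<Longrightarrow> act_below K f"
  by (auto simp: act_below_def)

lemma symbols_below_basic [simp]:
  "symbols_below K (move_input mv)" "symbols_below K (emit x)" "symbols_below K rewind"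
  "symbols_below K (seek Q)" "symbols_below K (emit_register a)"
  "symbols_below K (if_some Q c d) \<longleftrightarrow> symbols_below K c \<and> symbols_below K d"
  "symbols_below K (if_neq a b c d) \<longleftrightarrow> symbols_below K c \<and> symbols_below K d"
  "symbols_below K (if_pos a c d) \<longleftrightarrow> symbols_below K c \<and> symbols_below K d"
  "symbols_below K (while_some Q c) \<longleftrightarrow> symbols_below K c"
  "symbols_below K (while_neq a b c) \<longleftrightarrow> symbols_below K c"
  by (auto simp: move_input_def emit_def rewind_def seek_def sweep_def if_some_def if_neq_def if_pos_def
    emit_register_def emit_bit_def step_left_def while_some_def while_neq_def act_below_def)

lemma symbols_below_write [simp]:
  assumes "a + 2 < R"
  shows "symbols_below (2 ^ R) (assign a Q)" "symbols_below (2 ^ R) (carry v a)"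
    "symbols_below (2 ^ R) (clear a)" "symbols_below (2 ^ R) (copy a b)"
  using assms
  by (auto simp: assign_def carry_def clear_def copy_def rewind_def sweep_def intro!: act_belowI upd_bit_less)

lemma symbols_below_init_tape:
  assumes "2 \<le> R"
  shows "symbols_below (2 ^ R) init_tape"
proof -
  have "(2::nat) ^ 2 \<le> 2 ^ R" using assms by (intro power_increasing) auto
  then show ?thesis by (auto simp: init_tape_def intro!: act_belowI)
qed

primrec seqs :: "('a, 'o) com list \<Rightarrow> ('a, 'o) com" where
  "seqs [] = Skip"
| "seqs (c # cs) = c ;; seqs cs"

lemma impl_seqs:
  "(\<And>i. i < length cs \<Longrightarrow> impl w L (cs ! i) (x i) (x (Suc i))) \<Longrightarrow> impl w L (seqs cs) (x 0) (x (length cs))"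
proof (induction cs arbitrary: x)
  case Nil
  then show ?case by (simp add: impl_Skip)
next
  case (Cons c cs)
  have "impl w L (seqs cs) (x (Suc 0)) (x (Suc (length cs)))"
    using Cons.IH[of "\<lambda>i. x (Suc i)"] Cons.prems[of "Suc _"] by simp
  with Cons.prems[of 0] show ?case by (auto intro: impl_Seq)
qed

lemma impl_seqs_map:
  assumes "\<And>i. i < length as \<Longrightarrow> impl w L (f (as ! i)) (x i) (x (Suc i))"
    and "y = x 0" "z = x (length as)"
  shows "impl w L (seqs (map f as)) y z"
  using impl_seqs[of "map f as" w L x] assms by simp

lemma impl_seqs_upt:
  assumes "\<And>i. i < n \<Longrightarrow> impl w L (f i) (x i) (x (Suc i))" and "y = x 0" "z = x n"
  shows "impl w L (seqs (map f [0..<n])) y z"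
  by (rule impl_seqs_map[of _ _ _ _ x]) (use assms in auto)

lemma impl_repeat:
  assumes "\<And>i. i < n \<Longrightarrow> impl w L c (x i) (x (Suc i))" and "y = x 0" "z = x n"
  shows "impl w L (seqs (replicate n c)) y z"
  using impl_seqs[of "replicate n c" w L x] assms by simp

lemma symbols_below_seqs [simp]: "symbols_below K (seqs cs) \<longleftrightarrow> (\<forall>c\<in>set cs. symbols_below K c)"
  by (induction cs) auto

lemma impl_eq: "impl w L c x y \<Longrightarrow> y = y' \<Longrightarrow> impl w L c x y'"
  by simp

lemma impl_while:
  assumes "\<And>i. i < m \<Longrightarrow> \<rho> i a \<noteq> \<rho> i b" "\<rho> m a = \<rho> m b"
    and "\<And>i. i < m \<Longrightarrow> impl w L c (\<rho> i, h i, out) (\<rho> (Suc i), h (Suc i), out)"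
    and "x = (\<rho> 0, h 0, out)" "y = (\<rho> m, h m, out)"
  shows "impl w L (while_neq a b c) x y"
  using impl_while_neq[of m \<rho> a b w L c h "\<lambda>_. out"] assms by simp

section \<open>Arithmetic with a modulus in a register\<close>

text \<open>
  Input length, bound for the moduli, modulus, the two positions compared, head position, parity,
  result, flag for unequal reflections, and three temporaries; \<open>rx\<close> and \<open>ry\<close> hold vectors.
\<close>

abbreviation (input) "rn \<equiv> 0 :: nat"  abbreviation (input) "rK \<equiv> 1 :: nat"  abbreviation (input) "rk \<equiv> 2 :: nat"
abbreviation (input) "ri \<equiv> 3 :: nat"  abbreviation (input) "rj \<equiv> 4 :: nat"  abbreviation (input) "rp \<equiv> 5 :: nat"
abbreviation (input) "rpar \<equiv> 6 :: nat"  abbreviation (input) "rcnt \<equiv> 7 :: nat"  abbreviation (input) "rne \<equiv> 8 :: nat"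
abbreviation (input) "rt \<equiv> 9 :: nat"  abbreviation (input) "rf \<equiv> 10 :: nat"  abbreviation (input) "rg \<equiv> 11 :: nat"

definition rx :: "nat \<Rightarrow> nat" where "rx l = 12 + 2 * l"
definition ry :: "nat \<Rightarrow> nat" where "ry l = 13 + 2 * l"

lemma rx_ry [simp]:
  "rx l = rx l' \<longleftrightarrow> l = l'" "ry l = ry l' \<longleftrightarrow> l = l'" "rx l \<noteq> ry l'" "ry l \<noteq> rx l'"
  "c < 12 \<Longrightarrow> rx l \<noteq> c" "c < 12 \<Longrightarrow> ry l \<noteq> c" "c < 12 \<Longrightarrow> c \<noteq> rx l" "c < 12 \<Longrightarrow> c \<noteq> ry l"
  unfolding rx_def ry_def by presburger+

lemma not_rx_ry_less [simp]: "\<not> rx l < 12" "\<not> ry l < 12"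
  by (simp_all add: rx_def ry_def)

definition incmod :: "nat \<Rightarrow> ('a, 'o) com" where
  "incmod z = inc z ;; if_neq z rk Skip (clear z)"

lemma impl_incmod:
  assumes "\<rho> z < \<rho> rk" "\<rho> rk < 2 ^ L" "z \<noteq> rk"
  shows "impl w L (incmod z) (\<rho>, h, out) (\<rho>(z := (\<rho> z + 1) mod \<rho> rk), h, out)"
  unfolding incmod_def
proof (rule impl_Seq[OF impl_inc])
  let ?\<rho> = "\<rho>(z := \<rho> z + 1)"
  show "impl w L (if_neq z rk Skip (clear z)) (?\<rho>, h, out) (\<rho>(z := (\<rho> z + 1) mod \<rho> rk), h, out)"
  proof (rule impl_if_neq)
    assume "?\<rho> z \<noteq> ?\<rho> rk"
    then show "impl w L Skip (?\<rho>, h, out) (\<rho>(z := (\<rho> z + 1) mod \<rho> rk), h, out)"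
      using assms by (intro impl_eq[OF impl_Skip]) auto
  next
    assume "?\<rho> z = ?\<rho> rk"
    then show "impl w L (clear z) (?\<rho>, h, out) (\<rho>(z := (\<rho> z + 1) mod \<rho> rk), h, out)"
      using assms by (intro impl_eq[OF impl_clear]) auto
  qed
qed (use assms in auto)

definition addmod :: "nat \<Rightarrow> nat \<Rightarrow> ('a, 'o) com" where
  "addmod z y = while_neq rt y (incmod z ;; inc rt) ;; clear rt"

text \<open>Subtraction of \<open>y\<close> as addition of \<open>k - y\<close>: the counter runs
  from \<open>y\<close> up to the modulus.\<close>

definition submod :: "nat \<Rightarrow> nat \<Rightarrow> ('a, 'o) com" where
  "submod z y = copy rt y ;; while_neq rt rk (incmod z ;; inc rt) ;; clear rt"

lemma impl_addmod:
  assumes "\<rho> rt = 0" "\<rho> z < \<rho> rk" "\<rho> y \<le> \<rho> rk" "\<rho> rk < 2 ^ L" "z \<notin> {rk, rt}" "y \<notin> {z, rt}"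
  shows "impl w L (addmod z y) (\<rho>, h, out) (\<rho>(z := (\<rho> z + \<rho> y) mod \<rho> rk), h, out)"
  unfolding addmod_def
proof (rule impl_Seq)
  let ?s = "\<lambda>i. \<rho>(rt := i, z := (\<rho> z + i) mod \<rho> rk)"
  show "impl w L (while_neq rt y (incmod z ;; inc rt)) (\<rho>, h, out) (?s (\<rho> y), h, out)"
  proof (rule impl_while[where m = "\<rho> y" and \<rho> = ?s and h = "\<lambda>_. h"])
    fix i assume i: "i < \<rho> y"
    show "impl w L (incmod z ;; inc rt) (?s i, h, out) (?s (Suc i), h, out)"
      by (rule impl_Seq[OF impl_incmod impl_eq[OF impl_inc]])
        (use assms i in \<open>auto simp: fun_eq_iff mod_Suc_eq\<close>)
  qed (use assms in \<open>auto simp: fun_eq_iff\<close>)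
  show "impl w L (clear rt) (?s (\<rho> y), h, out) (\<rho>(z := (\<rho> z + \<rho> y) mod \<rho> rk), h, out)"
    by (rule impl_eq[OF impl_clear]) (use assms in \<open>auto simp: fun_eq_iff\<close>)
qed

lemma impl_submod:
  assumes "\<rho> z < \<rho> rk" "\<rho> y \<le> \<rho> rk" "\<rho> rk < 2 ^ L" "\<rho> rt = 0" "z \<notin> {rk, rt}" "y \<notin> {z, rt}"
  shows "impl w L (submod z y) (\<rho>, h, out) (\<rho>(z := (\<rho> z + (\<rho> rk - \<rho> y)) mod \<rho> rk), h, out)"
  unfolding submod_def
proof (rule impl_Seq[OF impl_copy], rule impl_Seq)
  let ?s = "\<lambda>i. \<rho>(rt := \<rho> y + i, z := (\<rho> z + i) mod \<rho> rk)"
  show "impl w L (while_neq rt rk (incmod z ;; inc rt)) (\<rho>(rt := \<rho> y), h, out) (?s (\<rho> rk - \<rho> y), h, out)"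
  proof (rule impl_while[where m = "\<rho> rk - \<rho> y" and \<rho> = ?s and h = "\<lambda>_. h"])
    fix i assume i: "i < \<rho> rk - \<rho> y"
    show "impl w L (incmod z ;; inc rt) (?s i, h, out) (?s (Suc i), h, out)"
      by (rule impl_Seq[OF impl_incmod impl_eq[OF impl_inc]])
        (use assms i in \<open>auto simp: fun_eq_iff mod_Suc_eq\<close>)
  qed (use assms in \<open>auto simp: fun_eq_iff\<close>)
  show "impl w L (clear rt) (?s (\<rho> rk - \<rho> y), h, out)
      (\<rho>(z := (\<rho> z + (\<rho> rk - \<rho> y)) mod \<rho> rk), h, out)"
    by (rule impl_eq[OF impl_clear]) (use assms in \<open>auto simp: fun_eq_iff\<close>)
qed

definition residue :: "nat \<Rightarrow> int \<Rightarrow> nat" where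
  "residue k z = nat (z mod int k)"

lemma int_residue: "0 < k \<Longrightarrow> int (residue k z) = z mod int k"
  by (simp add: residue_def)

lemma residue_less: "0 < k \<Longrightarrow> residue k z < k"
  unfolding residue_def by (metis nat_less_iff of_nat_0_less_iff pos_mod_bound pos_mod_sign)

lemma residue_cong: "z mod int k = z' mod int k \<Longrightarrow> residue k z = residue k z'"
  by (simp add: residue_def)

lemma residue_of_nat: "residue k (int n) = n mod k"
  by (simp add: residue_def nat_mod_distrib flip: of_nat_mod)

text \<open>The factor \<open>a\<close> is a constant of the program, so multiplication is unrolled
  into repeated addition or subtraction.\<close>

definition addmul :: "nat \<Rightarrow> nat \<Rightarrow> int \<Rightarrow> ('a, 'o) com" where
  "addmul z y a = seqs (replicate (nat \<bar>a\<bar>) (if a \<ge> 0 then addmod z y else submod z y))"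

lemma impl_addmul:
  assumes "\<rho> rt = 0" "\<rho> z < \<rho> rk" "\<rho> y \<le> \<rho> rk" "\<rho> rk < 2 ^ L" "z \<notin> {rk, rt}" "y \<notin> {z, rt}"
  shows "impl w L (addmul z y a) (\<rho>, h, out)
    (\<rho>(z := residue (\<rho> rk) (int (\<rho> z) + a * int (\<rho> y))), h, out)"
proof -
  let ?k = "\<rho> rk"
  \<comment> \<open>The state after \<open>b\<close> additions, or after \<open>-b\<close>
    subtractions for negative \<open>b\<close>.\<close>
  define s where "s b = \<rho>(z := residue ?k (int (\<rho> z) + b * int (\<rho> y)))" for b
  have k: "0 < ?k" using assms(2) by simp
  have less: "s b z < s b rk" "s b rt = 0" "s b y = \<rho> y" "s b rk = ?k" for b
    using assms k by (auto simp: s_def residue_less)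
  have add: "impl w L (addmod z y) (s b, h, out) (s (b + 1), h, out)" for b
  proof (rule impl_eq[OF impl_addmod])
    have "int ((s b z + \<rho> y) mod ?k) = int (residue ?k (int (\<rho> z) + (b + 1) * int (\<rho> y)))"
      using k by (simp add: s_def int_residue of_nat_mod mod_simps algebra_simps)
    then have "(s b z + \<rho> y) mod ?k = residue ?k (int (\<rho> z) + (b + 1) * int (\<rho> y))"
      by (simp only: of_nat_eq_iff)
    then show "((s b)(z := (s b z + s b y) mod s b rk), h, out) = (s (b + 1), h, out)"
      unfolding less by (simp add: s_def)
  qed (use assms less in auto)
  have sub: "impl w L (submod z y) (s b, h, out) (s (b - 1), h, out)" for b
  proof (rule impl_eq[OF impl_submod])
    have "int ((s b z + (?k - \<rho> y)) mod ?k) = (s b z + (int ?k - int (\<rho> y))) mod int ?k"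
      using assms(3) by (simp add: of_nat_mod of_nat_diff add_diff_eq)
    also have "\<dots> = (s b z - int (\<rho> y) + int ?k) mod int ?k" by (simp add: algebra_simps)
    also have "\<dots> = (s b z - int (\<rho> y)) mod int ?k" by (rule mod_add_self2)
    also have "\<dots> = int (residue ?k (int (\<rho> z) + (b - 1) * int (\<rho> y)))"
      using k by (simp add: s_def int_residue mod_simps algebra_simps)
    finally have "(s b z + (?k - \<rho> y)) mod ?k = residue ?k (int (\<rho> z) + (b - 1) * int (\<rho> y))"
      by (simp only: of_nat_eq_iff)
    then show "((s b)(z := (s b z + (s b rk - s b y)) mod s b rk), h, out) = (s (b - 1), h, out)"
      unfolding less by (simp add: s_def)
  qed (use assms less in auto)
  have s0: "s 0 = \<rho>"
    using assms(2) by (auto simp: s_def fun_eq_iff residue_of_nat)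
  have "impl w L (addmul z y a) (\<rho>, h, out) (s a, h, out)"
  proof (cases "a \<ge> 0")
    case True
    have "impl w L (addmod z y) (s (int i), h, out) (s (int (Suc i)), h, out)" for i
      using add[of "int i"] by (simp add: add.commute)
    then show ?thesis unfolding addmul_def
      by (intro impl_repeat[where x = "\<lambda>i. (s (int i), h, out)"]) (use True s0 in auto)
  next
    case False
    have "impl w L (submod z y) (s (- int i), h, out) (s (- int (Suc i)), h, out)" for i
    proof -
      have "- int (Suc i) = - int i - 1" by simp
      then show ?thesis using sub by metis
    qed
    then show ?thesis unfolding addmul_def
      by (intro impl_repeat[where x = "\<lambda>i. (s (- int i), h, out)"]) (use False s0 in auto)
  qed
  then show ?thesis by (simp add: s_def)
qed

definition row :: "nat \<Rightarrow> nat \<Rightarrow> (nat \<Rightarrow> int) \<Rightarrow> ('a, 'o) com" where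
  "row N z P = seqs (map (\<lambda>l. addmul z (rx l) (P l)) [0..<N])"

lemma impl_row:
  assumes "\<rho> rt = 0" "\<rho> z < \<rho> rk" "\<rho> rk < 2 ^ L" "z \<notin> {rk, rt}" "z \<notin> range rx"
    and "\<And>l. l < N \<Longrightarrow> \<rho> (rx l) \<le> \<rho> rk"
  shows "impl w L (row N z P) (\<rho>, h, out)
    (\<rho>(z := residue (\<rho> rk) (int (\<rho> z) + (\<Sum>l<N. P l * int (\<rho> (rx l))))), h, out)"
  unfolding row_def
proof (rule impl_seqs_upt)
  let ?k = "\<rho> rk"
  let ?s = "\<lambda>n. \<rho>(z := residue ?k (int (\<rho> z) + (\<Sum>l<n. P l * int (\<rho> (rx l)))))"
  have k: "0 < ?k" using assms(2) by simp
  fix n assume n: "n < N"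
  have ne: "rx n \<noteq> z" using assms(5) by blast
  show "impl w L (addmul z (rx n) (P n)) (?s n, h, out) (?s (Suc n), h, out)"
  proof (rule impl_eq[OF impl_addmul])
    have "residue ?k (int (?s n z) + P n * int (\<rho> (rx n))) = ?s (Suc n) z"
      using k by (auto intro!: residue_cong simp: int_residue mod_simps algebra_simps)
    then show "((?s n)(z := residue (?s n rk) (int (?s n z) + P n * int (?s n (rx n)))), h, out) =
        (?s (Suc n), h, out)" using assms(4) ne by (auto simp: fun_eq_iff)
  qed (use assms n ne k in \<open>auto simp: residue_less\<close>)
next
  show "(\<rho>, h, out) = (\<rho>(z := residue (\<rho> rk) (int (\<rho> z) + (\<Sum>l<0. P l * int (\<rho> (rx l))))), h, out)"
    using assms(2) by (auto simp: fun_eq_iff residue_of_nat)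
qed simp

section \<open>Evaluating a linear representation along the input\<close>

type_synonym 'a mats = "'a \<Rightarrow> nat \<Rightarrow> nat \<Rightarrow> int"
type_synonym functional = "(nat \<Rightarrow> int) \<times> (nat \<Rightarrow> nat)"

definition mat_act :: "nat \<Rightarrow> (nat \<Rightarrow> nat \<Rightarrow> int) \<Rightarrow> (nat \<Rightarrow> int) \<Rightarrow> nat \<Rightarrow> int" where
  "mat_act N A v l = (\<Sum>j<N. A l j * v j)"

definition word_act :: "nat \<Rightarrow> 'a mats \<Rightarrow> 'a list \<Rightarrow> (nat \<Rightarrow> int) \<Rightarrow> nat \<Rightarrow> int" where
  "word_act N A u v = foldr (\<lambda>s. mat_act N (A s)) u v"

text \<open>A pair \<open>(P, e)\<close> stands for the map sending a word with matrix \<open>M\<close> to \<open>P M e\<close>.\<close>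

definition series :: "nat \<Rightarrow> 'a mats \<Rightarrow> functional \<Rightarrow> 'a list \<Rightarrow> int" where
  "series N A t u = (\<Sum>l<N. fst t l * word_act N A u (\<lambda>l. int (snd t l)) l)"

lemma word_act_Nil [simp]: "word_act N A [] v = v"
  and word_act_Cons [simp]: "word_act N A (s # u) v = mat_act N (A s) (word_act N A u v)"
  and word_act_append: "word_act N A (u @ u') v = word_act N A u (word_act N A u' v)"
  by (simp_all add: word_act_def)

definition regs :: "(nat \<Rightarrow> nat) \<Rightarrow> (nat \<Rightarrow> nat) \<Rightarrow> (nat \<Rightarrow> nat) \<Rightarrow> nat \<Rightarrow> nat" where
  "regs xs ys \<rho> r = (if r < 12 then \<rho> r else if even r then xs ((r - 12) div 2) else ys ((r - 13) div 2))"

lemma regs_rx [simp]: "regs xs ys \<rho> (rx l) = xs l"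
  and regs_ry [simp]: "regs xs ys \<rho> (ry l) = ys l"
  and regs_less [simp]: "r < 12 \<Longrightarrow> regs xs ys \<rho> r = \<rho> r"
  by (auto simp: regs_def rx_def ry_def)

lemma register_cases:
  obtains "r < 12" | l where "r = rx l" | l where "r = ry l"
proof (cases "r < 12")
  case False
  then have "r = rx ((r - 12) div 2) \<or> r = ry ((r - 13) div 2)"
    unfolding rx_def ry_def by presburger
  then show ?thesis using that by blast
qed

lemma registers_eqI:
  assumes "\<And>r. r < 12 \<Longrightarrow> f r = g r" "\<And>l. f (rx l) = g (rx l)" "\<And>l. f (ry l) = g (ry l)"
  shows "f = (g :: nat \<Rightarrow> nat)"
proof
  fix r show "f r = g r" by (cases rule: register_cases[of r]) (use assms in auto)
qed

definition clean :: "(nat \<Rightarrow> nat) \<Rightarrow> bool" where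
  "clean \<rho> \<longleftrightarrow> (\<forall>l. \<rho> (rx l) = 0 \<and> \<rho> (ry l) = 0)"

lemma clean_regs: "clean \<rho> \<Longrightarrow> regs (\<lambda>_. 0) (\<lambda>_. 0) \<rho> = \<rho>"
  by (rule registers_eqI) (auto simp: clean_def)

lemma clean_upd [simp]: "r < 12 \<Longrightarrow> clean (\<rho>(r := x)) \<longleftrightarrow> clean \<rho>"
  by (auto simp: clean_def)

definition residues :: "nat \<Rightarrow> nat \<Rightarrow> (nat \<Rightarrow> int) \<Rightarrow> nat \<Rightarrow> nat" where
  "residues N k v l = (if l < N then residue k (v l) else 0)"

definition ready :: "nat \<Rightarrow> (nat \<Rightarrow> nat) \<Rightarrow> bool" where
  "ready L \<rho> \<longleftrightarrow> 0 < \<rho> rk \<and> \<rho> rk < 2 ^ L \<and> \<rho> rt = 0"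

lemma residue_sum:
  assumes "0 < k"
  shows "residue k (\<Sum>l<N. P l * int (residues N k v l)) = residue k (\<Sum>l<N. P l * v l)"
proof (rule residue_cong)
  have "(\<Sum>l<N. P l * int (residues N k v l)) mod int k = (\<Sum>l<N. (P l * int (residues N k v l)) mod int k) mod int k"
    by (rule mod_sum_eq[symmetric])
  also have "\<dots> = (\<Sum>l<N. (P l * v l) mod int k) mod int k"
    by (rule arg_cong[of _ _ "\<lambda>x. x mod int k"], rule sum.cong[OF HOL.refl])
      (use assms in \<open>simp add: residues_def int_residue mod_mult_right_eq\<close>)
  also have "\<dots> = (\<Sum>l<N. P l * v l) mod int k" by (rule mod_sum_eq)
  finally show "(\<Sum>l<N. P l * int (residues N k v l)) mod int k = (\<Sum>l<N. P l * v l) mod int k" .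
qed

text \<open>Every new entry depends on all old ones. The product is therefore collected in the
  registers \<open>ry\<close> and copied back only when complete.\<close>

definition matstep :: "nat \<Rightarrow> (nat \<Rightarrow> nat \<Rightarrow> int) \<Rightarrow> ('a, 'o) com" where
  "matstep N A = seqs (map (\<lambda>l. row N (ry l) (A l)) [0..<N]) ;;
     seqs (map (\<lambda>l. copy (rx l) (ry l) ;; clear (ry l)) [0..<N])"

abbreviation "vec N \<rho> v \<equiv> regs (residues N (\<rho> rk) v) (\<lambda>_. 0) \<rho>"

lemma impl_matstep:
  assumes "ready L \<rho>"
  shows "impl w L (matstep N A) (vec N \<rho> v, h, out) (vec N \<rho> (mat_act N A v), h, out)"
  unfolding matstep_def
proof (rule impl_Seq)
  let ?k = "\<rho> rk"
  let ?v = "residues N ?k v" and ?v' = "residues N ?k (mat_act N A v)"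
  let ?s = "\<lambda>p. regs ?v (\<lambda>l. if l < p then ?v' l else 0) \<rho>"
  have k: "0 < ?k" using assms by (simp add: ready_def)
  show "impl w L (seqs (map (\<lambda>l. row N (ry l) (A l)) [0..<N])) (vec N \<rho> v, h, out) (?s N, h, out)"
  proof (rule impl_seqs_upt[where x = "\<lambda>p. (?s p, h, out)"])
    fix p assume p: "p < N"
    show "impl w L (row N (ry p) (A p)) (?s p, h, out) (?s (Suc p), h, out)"
    proof (rule impl_eq[OF impl_row])
      have "residue ?k (\<Sum>l<N. A p l * int (?v l)) = ?v' p"
        unfolding residue_sum[OF k] using p by (simp add: residues_def mat_act_def)
      then show "((?s p)(ry p := residue (?s p rk) (int (?s p (ry p)) + (\<Sum>l<N. A p l * int (?s p (rx l))))), h, out) =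
          (?s (Suc p), h, out)"
        by (auto intro!: registers_eqI)
    qed (use assms k in \<open>auto simp: ready_def residues_def residue_less less_imp_le\<close>)
  qed (auto intro!: registers_eqI)
  let ?t = "\<lambda>p. regs (\<lambda>l. if l < p then ?v' l else ?v l) (\<lambda>l. if p \<le> l then ?v' l else 0) \<rho>"
  show "impl w L (seqs (map (\<lambda>l. copy (rx l) (ry l) ;; clear (ry l)) [0..<N])) (?s N, h, out)
      (vec N \<rho> (mat_act N A v), h, out)"
  proof (rule impl_seqs_upt[where x = "\<lambda>p. (?t p, h, out)"])
    fix p assume p: "p < N"
    show "impl w L (copy (rx p) (ry p) ;; clear (ry p)) (?t p, h, out) (?t (Suc p), h, out)"
      by (rule impl_Seq[OF impl_copy impl_eq[OF impl_clear]]) (auto intro!: registers_eqI)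
  qed (auto intro!: registers_eqI simp: residues_def)
qed

definition apply_letter :: "nat \<Rightarrow> 'a mats \<Rightarrow> 'a list \<Rightarrow> ('a, 'o) com" where
  "apply_letter N A ss = foldr (\<lambda>s c. Cond (\<lambda>x _. x = Letter s) (matstep N (A s)) c) ss Skip"

lemma impl_apply_letter:
  assumes "ready L \<rho>" "input_cell w h = Letter b" "b \<in> set ss"
  shows "impl w L (apply_letter N A ss) (vec N \<rho> v, h, out) (vec N \<rho> (mat_act N (A b) v), h, out)"
  using assms(3)
proof (induction ss)
  case (Cons s ss)
  have "impl w L (Cond (\<lambda>x _. x = Letter s) (matstep N (A s)) (apply_letter N A ss))
      (vec N \<rho> v, h, out) (vec N \<rho> (mat_act N (A b) v), h, out)"
    by (rule impl_Cond_input)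
      (use Cons assms(2) impl_matstep[OF assms(1)] in auto)
  then show ?case by (simp add: apply_letter_def)
qed simp

definition init_vec :: "nat \<Rightarrow> (nat \<Rightarrow> nat) \<Rightarrow> ('a, 'o) com" where
  "init_vec N e = seqs (map (\<lambda>l. seqs (replicate (e l) (incmod (rx l)))) [0..<N])"

definition clear_vec :: "nat \<Rightarrow> ('a, 'o) com" where
  "clear_vec N = seqs (map (\<lambda>l. clear (rx l)) [0..<N])"

lemma impl_init_vec:
  assumes "ready L \<rho>"
  shows "impl w L (init_vec N e) (regs (\<lambda>_. 0) (\<lambda>_. 0) \<rho>, h, out) (vec N \<rho> (\<lambda>l. int (e l)), h, out)"
  unfolding init_vec_def
proof (rule impl_seqs_upt)
  let ?k = "\<rho> rk"
  have k: "0 < ?k" using assms by (simp add: ready_def)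
  let ?s = "\<lambda>p. regs (\<lambda>l. if l < p then e l mod ?k else 0) (\<lambda>_. 0) \<rho>"
  fix p assume p: "p < N"
  let ?t = "\<lambda>i. (?s p)(rx p := i mod ?k)"
  show "impl w L (seqs (replicate (e p) (incmod (rx p)))) (?s p, h, out) (?s (Suc p), h, out)"
  proof (rule impl_repeat[where x = "\<lambda>i. (?t i, h, out)"])
    fix i
    show "impl w L (incmod (rx p)) (?t i, h, out) (?t (Suc i), h, out)"
      by (rule impl_eq[OF impl_incmod])
        (use assms k in \<open>auto simp: ready_def mod_Suc_eq\<close>)
  qed (auto intro!: registers_eqI)
qed (auto intro!: registers_eqI simp: residues_def residue_of_nat)

lemma impl_clear_vec:
  "impl w L (clear_vec N) (vec N \<rho> v, h, out) (regs (\<lambda>_. 0) (\<lambda>_. 0) \<rho>, h, out)"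
  unfolding clear_vec_def
proof (rule impl_seqs_upt)
  let ?s = "\<lambda>p. regs (\<lambda>l. if l < p then 0 else residues N (\<rho> rk) v l) (\<lambda>_. 0) \<rho>"
  fix p
  show "impl w L (clear (rx p)) (?s p, h, out) (?s (Suc p), h, out)"
    by (rule impl_eq[OF impl_clear]) (auto intro!: registers_eqI)
qed (auto intro!: registers_eqI simp: residues_def)

definition goto_start :: "('a, 'o) com" where
  "goto_start = Loop (\<lambda>x _. x \<noteq> LeftEnd) (move_input MoveLeft)"

lemma input_cell_LeftEnd: "input_cell w h = LeftEnd \<longleftrightarrow> h = 0"
  by (simp add: input_cell_def)

lemma input_cell_Letter: "0 < h \<Longrightarrow> h \<le> length w \<Longrightarrow> input_cell w h = Letter (w ! (h - 1))"
  by (simp add: input_cell_def)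

lemma impl_goto_start:
  assumes "h \<le> length w + 1"
  shows "impl w L goto_start (\<rho>, h, out) (\<rho>, 0, out)"
proof -
  have "impl w L goto_start (\<rho>, h - 0, out) (\<rho>, h - h, out)"
    unfolding goto_start_def
  proof (rule impl_Loop_input[where m = h and h = "\<lambda>i. h - i" and \<rho> = "\<lambda>_. \<rho>" and out = "\<lambda>_. out"])
    fix i assume "i < h"
    then show "impl w L (move_input MoveLeft) (\<rho>, h - i, out) (\<rho>, h - Suc i, out)"
      using assms by (intro impl_eq[OF impl_move_input]) auto
  qed (auto simp: input_cell_LeftEnd)
  then show ?thesis by simp
qed

definition conj_word :: "'a list \<Rightarrow> nat \<Rightarrow> 'a list" where
  "conj_word w i = take i w @ rev (take (i - 1) w)"

text \<open>Words act with their last letter first. The word \<open>conj_word w i\<close> is a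
  palindrome, so its letters can be applied in the order of a walk from the left end to position
  \<open>i\<close>, followed by the walk back from position \<open>i - 1\<close>.\<close>

definition conj_act :: "nat \<Rightarrow> 'a mats \<Rightarrow> 'a list \<Rightarrow> (nat \<Rightarrow> nat) \<Rightarrow> nat \<Rightarrow> ('a, 'o) com" where
  "conj_act N A ss e r = init_vec N e ;; goto_start ;;
     while_neq rp r (move_input MoveRight ;; inc rp ;; apply_letter N A ss) ;; clear rp ;;
     move_input MoveLeft ;;
     Loop (\<lambda>x _. x \<noteq> LeftEnd) (apply_letter N A ss ;; move_input MoveLeft)"

lemma impl_conj_act:
  assumes \<rho>: "ready L \<rho>" "\<rho> rp = 0" and r: "r < 12" "r \<noteq> rp" and i: "\<rho> r = i" "0 < i" "i \<le> length w"
    and w: "set w \<subseteq> set ss" "length w < 2 ^ L" and h: "h \<le> length w + 1"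
  shows "impl w L (conj_act N A ss e r) (regs (\<lambda>_. 0) (\<lambda>_. 0) \<rho>, h, out)
    (vec N \<rho> (word_act N A (conj_word w i) (\<lambda>l. int (e l))), 0, out)"
  unfolding conj_act_def
proof (intro impl_Seq[OF impl_init_vec[OF \<rho>(1)]] impl_Seq[OF impl_goto_start[OF h]])
  let ?e = "\<lambda>l. int (e l)"
  \<comment> \<open>The vector after \<open>q\<close> letters on the way to the right; since later
    letters act on the outside, the prefix appears reversed.\<close>
  let ?f = "\<lambda>q. word_act N A (rev (take q w)) ?e"
  let ?s = "\<lambda>q. vec N (\<rho>(rp := q)) (?f q)"
  have 1: "impl w L (while_neq rp r (move_input MoveRight ;; inc rp ;; apply_letter N A ss))
      (vec N \<rho> ?e, 0, out) (?s i, i, out)"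
  proof (rule impl_while[where m = i and \<rho> = ?s and h = "\<lambda>q. q"])
    fix q assume q: "q < i"
    have mv: "impl w L (move_input MoveRight) (?s q, q, out) (?s q, Suc q, out)"
      using q i by (intro impl_eq[OF impl_move_input]) auto
    have ic: "impl w L (inc rp) (?s q, Suc q, out) (vec N (\<rho>(rp := Suc q)) (?f q), Suc q, out)"
      by (rule impl_eq[OF impl_inc]) (use q i w in \<open>auto intro!: registers_eqI\<close>)
    have "mat_act N (A (w ! q)) (?f q) = ?f (Suc q)"
      using q i by (simp add: take_Suc_conv_app_nth)
    moreover have "impl w L (apply_letter N A ss) (vec N (\<rho>(rp := Suc q)) (?f q), Suc q, out)
        (vec N (\<rho>(rp := Suc q)) (mat_act N (A (w ! q)) (?f q)), Suc q, out)"
      by (rule impl_apply_letter) (use \<rho> q i w in \<open>auto simp: ready_def input_cell_Letter\<close>)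
    ultimately have ap: "impl w L (apply_letter N A ss) (vec N (\<rho>(rp := Suc q)) (?f q), Suc q, out)
        (?s (Suc q), Suc q, out)" by simp
    show "impl w L (move_input MoveRight ;; inc rp ;; apply_letter N A ss) (?s q, q, out) (?s (Suc q), Suc q, out)"
      by (rule impl_Seq[OF mv impl_Seq[OF ic ap]])
  qed (use \<rho> r i in \<open>auto intro!: registers_eqI\<close>)
  have 2: "impl w L (clear rp) (?s i, i, out) (vec N \<rho> (?f i), i, out)"
    by (rule impl_eq[OF impl_clear]) (use \<rho> in \<open>auto intro!: registers_eqI\<close>)
  have 3: "impl w L (move_input MoveLeft) (vec N \<rho> (?f i), i, out) (vec N \<rho> (?f i), i - 1, out)"
    using i by (intro impl_eq[OF impl_move_input]) auto
  let ?u = "take (i - 1) w"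
  \<comment> \<open>The vector after \<open>q\<close> letters on the way back, when the head is in
    cell \<open>i - 1 - q\<close>.\<close>
  let ?g = "\<lambda>q. word_act N A (drop (i - 1 - q) ?u) (?f i)"
  have "impl w L (Loop (\<lambda>x _. x \<noteq> LeftEnd) (apply_letter N A ss ;; move_input MoveLeft))
      (vec N \<rho> (?g 0), i - 1 - 0, out) (vec N \<rho> (?g (i - 1)), i - 1 - (i - 1), out)"
  proof (rule impl_Loop_input[where m = "i - 1" and h = "\<lambda>q. i - 1 - q" and \<rho> = "\<lambda>q. vec N \<rho> (?g q)" and out = "\<lambda>_. out"])
    fix q assume q: "q < i - 1"
    let ?p = "i - 1 - q"
    have p: "0 < ?p" "?p \<le> length w" "?p - 1 < length ?u" "i - 1 - Suc q = ?p - 1" using q i by auto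
    have sp: "Suc (?p - 1) = ?p" using p by simp
    have "drop (?p - 1) ?u = ?u ! (?p - 1) # drop ?p ?u"
      using Cons_nth_drop_Suc[OF p(3)] unfolding sp by simp
    moreover have "?u ! (?p - 1) = w ! (?p - 1)" using p(3) by simp
    ultimately have "drop (i - 1 - Suc q) ?u = w ! (?p - 1) # drop ?p ?u"
      unfolding p(4) by simp
    then have "?g (Suc q) = mat_act N (A (w ! (?p - 1))) (?g q)" by simp
    moreover have "impl w L (apply_letter N A ss) (vec N \<rho> (?g q), ?p, out)
        (vec N \<rho> (mat_act N (A (w ! (?p - 1))) (?g q)), ?p, out)"
      by (rule impl_apply_letter) (use \<rho> p w input_cell_Letter[of ?p w] in auto)
    ultimately have ap: "impl w L (apply_letter N A ss) (vec N \<rho> (?g q), ?p, out) (vec N \<rho> (?g (Suc q)), ?p, out)"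
      by simp
    have mv: "impl w L (move_input MoveLeft) (vec N \<rho> (?g (Suc q)), ?p, out) (vec N \<rho> (?g (Suc q)), i - 1 - Suc q, out)"
      using p by (intro impl_eq[OF impl_move_input]) auto
    show "impl w L (apply_letter N A ss ;; move_input MoveLeft) (vec N \<rho> (?g q), ?p, out)
        (vec N \<rho> (?g (Suc q)), i - 1 - Suc q, out)"
      by (rule impl_Seq[OF ap mv])
  qed (auto simp: input_cell_LeftEnd)
  moreover have "?g 0 = ?f i" by simp
  moreover have "?g (i - 1) = word_act N A (conj_word w i) ?e"
  proof -
    obtain j where j: "i = Suc j" using i(2) by (cases i) auto
    then show ?thesis
      using i(3) by (simp add: conj_word_def take_Suc_conv_app_nth word_act_append)
  qed
  ultimately have 4: "impl w L (Loop (\<lambda>x _. x \<noteq> LeftEnd) (apply_letter N A ss ;; move_input MoveLeft))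
      (vec N \<rho> (?f i), i - 1, out) (vec N \<rho> (word_act N A (conj_word w i) ?e), 0, out)"
    by simp
  show "impl w L (while_neq rp r (move_input MoveRight ;; inc rp ;; apply_letter N A ss) ;; clear rp ;;
      move_input MoveLeft ;; Loop (\<lambda>x _. x \<noteq> LeftEnd) (apply_letter N A ss ;; move_input MoveLeft))
      (vec N \<rho> ?e, 0, out) (vec N \<rho> (word_act N A (conj_word w i) ?e), 0, out)"
    by (intro impl_Seq[OF 1] impl_Seq[OF 2] impl_Seq[OF 3] 4)
qed

definition eval_series ::
    "nat \<Rightarrow> 'a mats \<Rightarrow> 'a list \<Rightarrow> nat \<Rightarrow> nat \<Rightarrow> functional \<Rightarrow> ('a, 'o) com" where
  "eval_series N A ss z r t = conj_act N A ss (snd t) r ;; row N z (fst t) ;; clear_vec N"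

lemma impl_eval_series:
  assumes \<rho>: "clean \<rho>" "ready L \<rho>" "\<rho> rp = 0" "\<rho> z = 0"
    and z: "z < 12" "z \<notin> {rk, rt, rp}" and r: "r < 12" "r \<noteq> rp" and i: "\<rho> r = i" "0 < i" "i \<le> length w"
    and w: "set w \<subseteq> set ss" "length w < 2 ^ L" and h: "h \<le> length w + 1"
  shows "impl w L (eval_series N A ss z r t) (\<rho>, h, out)
    (\<rho>(z := residue (\<rho> rk) (series N A t (conj_word w i))), 0, out)"
proof -
  let ?k = "\<rho> rk" and ?v = "word_act N A (conj_word w i) (\<lambda>l. int (snd t l))"
  have k: "0 < ?k" using \<rho> by (simp add: ready_def)
  have 1: "impl w L (conj_act N A ss (snd t) r) (\<rho>, h, out) (vec N \<rho> ?v, 0, out)"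
    using impl_conj_act[OF \<rho>(2,3) r i w h, of N A "snd t" out] by (simp add: clean_regs \<rho>(1))
  let ?\<rho> = "\<rho>(z := residue ?k (series N A t (conj_word w i)))"
  have rk: "?\<rho> rk = ?k" using z by simp
  have 2: "impl w L (row N z (fst t)) (vec N \<rho> ?v, 0, out) (vec N ?\<rho> ?v, 0, out)"
  proof (rule impl_eq[OF impl_row])
    have "residue ?k (\<Sum>l<N. fst t l * int (residues N ?k ?v l)) = ?\<rho> z"
      using k by (simp add: residue_sum series_def)
    then show "((vec N \<rho> ?v)(z := residue (vec N \<rho> ?v rk)
        (int (vec N \<rho> ?v z) + (\<Sum>l<N. fst t l * int (vec N \<rho> ?v (rx l))))), 0, out) = (vec N ?\<rho> ?v, 0, out)"
      unfolding rk using \<rho>(4) z by (auto intro!: registers_eqI)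
  qed (use \<rho> z k in \<open>auto simp: ready_def residues_def residue_less less_imp_le\<close>)
  have 3: "impl w L (clear_vec N) (vec N ?\<rho> ?v, 0, out) (?\<rho>, 0, out)"
    using impl_clear_vec[of w L N ?\<rho> ?v 0 out] \<rho>(1) z(1) by (simp add: clean_regs)
  show ?thesis
    unfolding eval_series_def by (intro impl_Seq[OF 1] impl_Seq[OF 2] 3)
qed

section \<open>Comparing reflections and counting inversions\<close>

definition differ ::
    "nat \<Rightarrow> 'a mats \<Rightarrow> 'a list \<Rightarrow> nat \<Rightarrow> nat \<Rightarrow> nat \<Rightarrow> functional \<Rightarrow> bool" where
  "differ N A w i j k t \<longleftrightarrow>
     residue k (series N A t (conj_word w i)) \<noteq> residue k (series N A t (conj_word w j))"

text \<open>The flag \<open>rne\<close> is only raised here and never lowered, so a sequence of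
  comparisons leaves the disjunction of their outcomes.\<close>

definition compare_series ::
    "nat \<Rightarrow> 'a mats \<Rightarrow> 'a list \<Rightarrow> functional \<Rightarrow> ('a, 'o) com" where
  "compare_series N A ss t =
     eval_series N A ss rf ri t ;; eval_series N A ss rg rj t ;;
     if_neq rf rg (clear rne ;; inc rne) Skip ;; clear rf ;; clear rg"

text \<open>The last condition gives room for the value 1 in the flag and parity registers.\<close>

definition idle :: "nat \<Rightarrow> (nat \<Rightarrow> nat) \<Rightarrow> bool" where
  "idle L \<rho> \<longleftrightarrow> clean \<rho> \<and> \<rho> rt = 0 \<and> \<rho> rp = 0 \<and> \<rho> rf = 0 \<and> \<rho> rg = 0 \<and> (1::nat) < 2 ^ L"

lemma impl_compare_series:
  assumes \<rho>: "idle L \<rho>" "0 < \<rho> rk" "\<rho> rk < 2 ^ L"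
    and ij: "\<rho> ri = i" "0 < i" "i \<le> length w" "\<rho> rj = j" "0 < j" "j \<le> length w"
    and w: "set w \<subseteq> set ss" "length w < 2 ^ L" and h: "h \<le> length w + 1"
  shows "impl w L (compare_series N A ss t) (\<rho>, h, out)
    (\<rho>(rne := if differ N A w i j (\<rho> rk) t then 1 else \<rho> rne), 0, out)"
proof -
  let ?f = "residue (\<rho> rk) (series N A t (conj_word w i))"
    and ?g = "residue (\<rho> rk) (series N A t (conj_word w j))"
  let ?e = "if differ N A w i j (\<rho> rk) t then 1 else \<rho> rne"
  have \<rho>': "clean \<rho>" "ready L \<rho>" "\<rho> rp = 0" "\<rho> rf = 0" "\<rho> rg = 0" "\<rho> rt = 0"
    using \<rho> by (auto simp: idle_def ready_def)
  have 1: "impl w L (eval_series N A ss rf ri t) (\<rho>, h, out) (\<rho>(rf := ?f), 0, out)"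
    by (rule impl_eval_series) (use \<rho>' ij w h in auto)
  have 2: "impl w L (eval_series N A ss rg rj t) (\<rho>(rf := ?f), 0, out) (\<rho>(rf := ?f, rg := ?g), 0, out)"
    by (rule impl_eq[OF impl_eval_series[where i = j]]) (use \<rho>' ij w in \<open>auto simp: ready_def\<close>)
  let ?\<rho> = "\<rho>(rf := ?f, rg := ?g)"
  have 3: "impl w L (if_neq rf rg (clear rne ;; inc rne) Skip) (?\<rho>, 0, out) (?\<rho>(rne := ?e), 0, out)"
  proof (rule impl_if_neq)
    assume "?\<rho> rf \<noteq> ?\<rho> rg"
    then have "differ N A w i j (\<rho> rk) t" by (simp add: differ_def)
    then show "impl w L (clear rne ;; inc rne) (?\<rho>, 0, out) (?\<rho>(rne := ?e), 0, out)"
      using \<rho>(1) by (intro impl_Seq[OF impl_clear impl_eq[OF impl_inc]]) (auto simp: idle_def)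
  next
    assume "?\<rho> rf = ?\<rho> rg"
    then have "\<not> differ N A w i j (\<rho> rk) t" by (simp add: differ_def)
    then show "impl w L Skip (?\<rho>, 0, out) (?\<rho>(rne := ?e), 0, out)"
      by (intro impl_eq[OF impl_Skip]) (auto simp: fun_eq_iff)
  qed
  have 4: "impl w L (clear rf ;; clear rg) (?\<rho>(rne := ?e), 0, out) (\<rho>(rne := ?e), 0, out)"
    by (rule impl_Seq[OF impl_clear impl_eq[OF impl_clear]]) (use \<rho>' in \<open>auto simp: fun_eq_iff\<close>)
  show ?thesis
    unfolding compare_series_def by (intro impl_Seq[OF 1] impl_Seq[OF 2] impl_Seq[OF 3] 4)
qed

text \<open>The modulus is incremented before it is used, so it runs from 1 to \<open>K\<close> and
  is never 0 during a computation.\<close>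

definition compare_all ::
    "nat \<Rightarrow> 'a mats \<Rightarrow> 'a list \<Rightarrow> functional list \<Rightarrow> ('a, 'o) com" where
  "compare_all N A ss ts =
     goto_start ;; while_neq rk rK (inc rk ;; seqs (map (compare_series N A ss) ts)) ;; clear rk"

definition distinguished ::
    "nat \<Rightarrow> 'a mats \<Rightarrow> functional list \<Rightarrow> nat \<Rightarrow> 'a list \<Rightarrow> nat \<Rightarrow> nat \<Rightarrow> bool" where
  "distinguished N A ts K w i j \<longleftrightarrow> (\<exists>k\<in>{1..K}. \<exists>t\<in>set ts. differ N A w i j k t)"

lemma distinguished_Suc:
  "distinguished N A ts (Suc K) w i j \<longleftrightarrow>
    distinguished N A ts K w i j \<or> (\<exists>t\<in>set ts. differ N A w i j (Suc K) t)"
proof -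
  have "{1..Suc K} = insert (Suc K) {1..K}" by auto
  then show ?thesis by (simp add: distinguished_def disj_commute)
qed

lemma impl_compare_all:
  assumes \<rho>: "idle L \<rho>" "\<rho> rk = 0" "\<rho> rne = 0" "\<rho> rK = K" "K < 2 ^ L"
    and ij: "\<rho> ri = i" "0 < i" "i \<le> length w" "\<rho> rj = j" "0 < j" "j \<le> length w"
    and w: "set w \<subseteq> set ss" "length w < 2 ^ L" and h: "h \<le> length w + 1"
  shows "impl w L (compare_all N A ss ts) (\<rho>, h, out)
    (\<rho>(rne := of_bool (distinguished N A ts K w i j)), 0, out)"
  unfolding compare_all_def
proof (intro impl_Seq[OF impl_goto_start[OF h]] impl_Seq)
  let ?s = "\<lambda>q. \<rho>(rk := q, rne := of_bool (distinguished N A ts q w i j))"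
  show "impl w L (while_neq rk rK (inc rk ;; seqs (map (compare_series N A ss) ts))) (\<rho>, 0, out) (?s K, 0, out)"
  proof (rule impl_while[where m = K and \<rho> = ?s and h = "\<lambda>_. 0"])
    fix q assume q: "q < K"
    let ?t = "\<lambda>p. \<rho>(rk := Suc q, rne := of_bool (distinguished N A ts q w i j \<or>
      (\<exists>t\<in>set (take p ts). differ N A w i j (Suc q) t)))"
    have 1: "impl w L (inc rk) (?s q, 0, out) (?t 0, 0, out)"
      by (rule impl_eq[OF impl_inc]) (use q \<rho> in \<open>auto simp: fun_eq_iff\<close>)
    have 2: "impl w L (seqs (map (compare_series N A ss) ts)) (?t 0, 0, out) (?s (Suc q), 0, out)"
    proof (rule impl_seqs_map[where x = "\<lambda>p. (?t p, 0, out)"])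
      fix p assume p: "p < length ts"
      have "(\<exists>t\<in>set (take (Suc p) ts). differ N A w i j (Suc q) t) \<longleftrightarrow>
          (\<exists>t\<in>set (take p ts). differ N A w i j (Suc q) t) \<or> differ N A w i j (Suc q) (ts ! p)"
        using p by (auto simp: take_Suc_conv_app_nth)
      then show "impl w L (compare_series N A ss (ts ! p)) (?t p, 0, out) (?t (Suc p), 0, out)"
        by (intro impl_eq[OF impl_compare_series[where i = i and j = j]])
          (use \<rho> ij w q in \<open>auto simp: idle_def fun_eq_iff\<close>)
    qed (auto simp: distinguished_Suc)
    show "impl w L (inc rk ;; seqs (map (compare_series N A ss) ts)) (?s q, 0, out) (?s (Suc q), 0, out)"
      by (rule impl_Seq[OF 1 2])
  qed (use \<rho> in \<open>auto simp: distinguished_def fun_eq_iff\<close>)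
  show "impl w L (clear rk) (?s K, 0, out) (\<rho>(rne := of_bool (distinguished N A ts K w i j)), 0, out)"
    by (rule impl_eq[OF impl_clear]) (use \<rho> in \<open>auto simp: fun_eq_iff\<close>)
qed

definition update_count ::
    "nat \<Rightarrow> 'a mats \<Rightarrow> 'a list \<Rightarrow> functional list \<Rightarrow> ('a, 'o) com" where
  "update_count N A ss ts =
     goto_start ;;
     while_neq rj ri (inc rj ;; compare_all N A ss ts ;;
       if_pos rne (clear rne) (if_pos rpar (clear rpar) (inc rpar))) ;;
     clear rj ;; if_pos rpar (inc rcnt) (dec rcnt) ;; clear rpar"

lemma impl_update_count:
  fixes N A ts w i K
  defines "matches q \<equiv> card {j \<in> {1..q}. \<not> distinguished N A ts K w i j}"
  assumes \<rho>: "idle L \<rho>" "\<rho> rk = 0" "\<rho> rne = 0" "\<rho> rj = 0" "\<rho> rpar = 0" "\<rho> rK = K" "K < 2 ^ L"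
    and i: "\<rho> ri = i" "0 < i" "i \<le> length w"
    and w: "set w \<subseteq> set ss" "length w < 2 ^ L" and h: "h \<le> length w + 1"
    and cnt: "\<rho> rcnt + 1 < 2 ^ L" "even (matches i) \<Longrightarrow> 0 < \<rho> rcnt"
  shows "impl w L (update_count N A ss ts) (\<rho>, h, out)
    (\<rho>(rcnt := if odd (matches i) then \<rho> rcnt + 1 else \<rho> rcnt - 1), 0, out)"
  unfolding update_count_def
proof (intro impl_Seq[OF impl_goto_start[OF h]] impl_Seq)
  let ?s = "\<lambda>q. \<rho>(rj := q, rpar := matches q mod 2)"
  have matches_Suc: "matches (Suc q) = (if distinguished N A ts K w i (Suc q) then matches q else Suc (matches q))" for q
  proof -
    have "{j \<in> {1..Suc q}. \<not> distinguished N A ts K w i j} = {j \<in> {1..q}. \<not> distinguished N A ts K w i j} \<union>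
        (if distinguished N A ts K w i (Suc q) then {} else {Suc q})"
      by (auto simp: le_Suc_eq)
    then show ?thesis by (simp add: matches_def)
  qed
  show "impl w L (while_neq rj ri (inc rj ;; compare_all N A ss ts ;;
      if_pos rne (clear rne) (if_pos rpar (clear rpar) (inc rpar)))) (\<rho>, 0, out) (?s i, 0, out)"
  proof (rule impl_while[where m = i and \<rho> = ?s and h = "\<lambda>_. 0"])
    fix q assume q: "q < i"
    let ?d = "distinguished N A ts K w i (Suc q)"
    let ?t = "\<rho>(rj := Suc q, rpar := matches q mod 2)"
    have 1: "impl w L (inc rj) (?s q, 0, out) (?t, 0, out)"
      by (rule impl_eq[OF impl_inc]) (use q i w in \<open>auto simp: fun_eq_iff\<close>)
    have 2: "impl w L (compare_all N A ss ts) (?t, 0, out) (?t(rne := of_bool ?d), 0, out)"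
      by (rule impl_eq[OF impl_compare_all[where i = i and j = "Suc q" and K = K]])
        (use \<rho> i w q in \<open>auto simp: idle_def\<close>)
    have 3: "impl w L (if_pos rne (clear rne) (if_pos rpar (clear rpar) (inc rpar)))
        (?t(rne := of_bool ?d), 0, out) (?s (Suc q), 0, out)"
    proof (rule impl_if_pos)
      assume "0 < (?t(rne := of_bool ?d)) rne"
      then have ?d by (simp split: if_splits)
      then show "impl w L (clear rne) (?t(rne := of_bool ?d), 0, out) (?s (Suc q), 0, out)"
        by (intro impl_eq[OF impl_clear]) (use \<rho> in \<open>auto simp: fun_eq_iff matches_Suc\<close>)
    next
      assume "(?t(rne := of_bool ?d)) rne = 0"
      then have d: "\<not> ?d" by simp
      show "impl w L (if_pos rpar (clear rpar) (inc rpar)) (?t(rne := of_bool ?d), 0, out) (?s (Suc q), 0, out)"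
      proof (rule impl_if_pos)
        assume "0 < (?t(rne := of_bool ?d)) rpar"
        then have "odd (matches q)" by (simp add: odd_iff_mod_2_eq_one)
        then show "impl w L (clear rpar) (?t(rne := of_bool ?d), 0, out) (?s (Suc q), 0, out)"
          by (intro impl_eq[OF impl_clear])
            (use \<rho> d in \<open>auto simp: fun_eq_iff matches_Suc odd_iff_mod_2_eq_one mod_Suc\<close>)
      next
        assume "(?t(rne := of_bool ?d)) rpar = 0"
        then have "even (matches q)" by (simp add: even_iff_mod_2_eq_zero)
        then show "impl w L (inc rpar) (?t(rne := of_bool ?d), 0, out) (?s (Suc q), 0, out)"
          by (intro impl_eq[OF impl_inc])
            (use \<rho> d in \<open>auto simp: fun_eq_iff matches_Suc even_iff_mod_2_eq_zero mod_Suc idle_def\<close>)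
      qed
    qed
    show "impl w L (inc rj ;; compare_all N A ss ts ;;
        if_pos rne (clear rne) (if_pos rpar (clear rpar) (inc rpar))) (?s q, 0, out) (?s (Suc q), 0, out)"
      by (rule impl_Seq[OF 1 impl_Seq[OF 2 3]])
  qed (use \<rho> i in \<open>auto simp: fun_eq_iff matches_def\<close>)
  show "impl w L (clear rj) (?s i, 0, out) (\<rho>(rpar := matches i mod 2), 0, out)"
    by (rule impl_eq[OF impl_clear]) (use \<rho> in \<open>auto simp: fun_eq_iff\<close>)
  let ?c = "if odd (matches i) then \<rho> rcnt + 1 else \<rho> rcnt - 1"
  show "impl w L (if_pos rpar (inc rcnt) (dec rcnt)) (\<rho>(rpar := matches i mod 2), 0, out)
      (\<rho>(rpar := matches i mod 2, rcnt := ?c), 0, out)"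
  proof (rule impl_if_pos)
    assume "0 < (\<rho>(rpar := matches i mod 2)) rpar"
    then have "odd (matches i)" by (simp add: odd_iff_mod_2_eq_one)
    then show "impl w L (inc rcnt) (\<rho>(rpar := matches i mod 2), 0, out)
        (\<rho>(rpar := matches i mod 2, rcnt := ?c), 0, out)"
      by (intro impl_eq[OF impl_inc]) (use cnt in auto)
  next
    assume "(\<rho>(rpar := matches i mod 2)) rpar = 0"
    then have "even (matches i)" by (simp add: even_iff_mod_2_eq_zero)
    then show "impl w L (dec rcnt) (\<rho>(rpar := matches i mod 2), 0, out)
        (\<rho>(rpar := matches i mod 2, rcnt := ?c), 0, out)"
      by (intro impl_eq[OF impl_dec]) (use cnt in auto)
  qed
  show "impl w L (clear rpar) (\<rho>(rpar := matches i mod 2, rcnt := ?c), 0, out) (\<rho>(rcnt := ?c), 0, out)"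
    by (rule impl_eq[OF impl_clear]) (use \<rho> in \<open>auto simp: fun_eq_iff\<close>)
qed

text \<open>The comparisons end with the head at the left end, so the current position is kept in
  \<open>ri\<close> and found again by walking.\<close>

definition goto_index :: "('a, 'o) com" where
  "goto_index = goto_start ;; while_neq rp ri (move_input MoveRight ;; inc rp) ;; clear rp"

lemma impl_goto_index:
  assumes "\<rho> rp = 0" "\<rho> ri = i" "i \<le> length w" "length w < 2 ^ L" "h \<le> length w + 1"
  shows "impl w L goto_index (\<rho>, h, out) (\<rho>, i, out)"
  unfolding goto_index_def
proof (intro impl_Seq[OF impl_goto_start[OF assms(5)]] impl_Seq)
  show "impl w L (while_neq rp ri (move_input MoveRight ;; inc rp)) (\<rho>, 0, out) (\<rho>(rp := i), i, out)"
  proof (rule impl_while[where m = i and \<rho> = "\<lambda>q. \<rho>(rp := q)" and h = "\<lambda>q. q"])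
    fix q assume q: "q < i"
    show "impl w L (move_input MoveRight ;; inc rp) (\<rho>(rp := q), q, out) (\<rho>(rp := Suc q), Suc q, out)"
      by (rule impl_Seq[OF impl_eq[OF impl_move_input, where y' = "(\<rho>(rp := q), Suc q, out)"]
            impl_eq[OF impl_inc]])
        (use q assms in auto)
  qed (use assms in auto)
  show "impl w L (clear rp) (\<rho>(rp := i), i, out) (\<rho>, i, out)"
    by (rule impl_eq[OF impl_clear]) (use assms in auto)
qed

text \<open>The output is written once, generator by generator. Each generator gets its own pass
  over the input, so a single counter suffices and is cleared at the end.\<close>

definition output_count ::
    "nat \<Rightarrow> 'a mats \<Rightarrow> 'a list \<Rightarrow> functional list \<Rightarrow> 'a \<Rightarrow> ('a, output_symbol) com"
  where
  "output_count N A ss ts a =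
     goto_start ;;
     while_neq ri rn (inc ri ;; goto_index ;;
       Cond (\<lambda>x _. x = Letter a) (update_count N A ss ts) goto_start) ;;
     clear ri ;; emit_register rcnt ;; emit Separator ;; clear rcnt"

text \<open>
  \<open>f\<close> is the value of the counter after each letter; \<open>matches\<close> includes the trivial match of a
  position with itself, so an odd number means an even number of earlier occurrences.
\<close>

lemma impl_output_count:
  fixes N A ts w K
  defines "matches i \<equiv> card {j \<in> {1..i}. \<not> distinguished N A ts K w i j}"
  assumes \<rho>: "idle L \<rho>" "\<forall>r\<in>{rk, rne, rj, rpar, ri, rcnt}. \<rho> r = 0" "\<rho> rK = K" "K < 2 ^ L" "\<rho> rn = length w"
    and w: "set w \<subseteq> set ss" "length w + 1 < 2 ^ L" and h: "h \<le> length w + 1"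
    and f: "f 0 = 0" "\<And>i. i < length w \<Longrightarrow> f i \<le> length w"
      "\<And>i. i < length w \<Longrightarrow> w ! i \<noteq> a \<Longrightarrow> f (Suc i) = f i"
      "\<And>i. i < length w \<Longrightarrow> w ! i = a \<Longrightarrow> odd (matches (Suc i)) \<Longrightarrow> f (Suc i) = f i + 1"
      "\<And>i. i < length w \<Longrightarrow> w ! i = a \<Longrightarrow> even (matches (Suc i)) \<Longrightarrow> f i = f (Suc i) + 1"
  shows "impl w L (output_count N A ss ts a) (\<rho>, h, out)
    (\<rho>, 0, out @ map Bit (binary (f (length w))) @ [Separator])"
  unfolding output_count_def
proof (intro impl_Seq[OF impl_goto_start[OF h]] impl_Seq)
  let ?s = "\<lambda>i. \<rho>(ri := i, rcnt := f i)"
  let ?n = "length w"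
  show "impl w L (while_neq ri rn (inc ri ;; goto_index ;;
      Cond (\<lambda>x _. x = Letter a) (update_count N A ss ts) goto_start)) (\<rho>, 0, out) (?s ?n, 0, out)"
  proof (rule impl_while[where m = ?n and \<rho> = ?s and h = "\<lambda>_. 0"])
    fix i assume i: "i < ?n"
    let ?t = "\<rho>(ri := Suc i, rcnt := f i)"
    have 1: "impl w L (inc ri) (?s i, 0, out) (?t, 0, out)"
      by (rule impl_eq[OF impl_inc]) (use i w in \<open>auto simp: fun_eq_iff\<close>)
    have 2: "impl w L goto_index (?t, 0, out) (?t, Suc i, out)"
      by (rule impl_goto_index) (use \<rho> i w in \<open>auto simp: idle_def\<close>)
    have 3: "impl w L (Cond (\<lambda>x _. x = Letter a) (update_count N A ss ts) goto_start)
        (?t, Suc i, out) (?s (Suc i), 0, out)"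
    proof (rule impl_Cond_input)
      assume "input_cell w (Suc i) = Letter a"
      then have a: "w ! i = a" using i by (simp add: input_cell_Letter)
      have m: "card {j \<in> {1..Suc i}. \<not> distinguished N A ts K w (Suc i) j} = matches (Suc i)"
        by (simp add: matches_def)
      have upd: "(if odd (matches (Suc i)) then ?t rcnt + 1 else ?t rcnt - 1) = f (Suc i)"
        using f(4,5)[OF i a] by auto
      have "impl w L (update_count N A ss ts) (?t, Suc i, out)
          (?t(rcnt := if odd (matches (Suc i)) then ?t rcnt + 1 else ?t rcnt - 1), 0, out)"
        unfolding m[symmetric]
        by (rule impl_update_count)
          (use \<rho> i w f(2)[OF i] f(5)[OF i a] m in \<open>auto simp: idle_def\<close>)
      then show "impl w L (update_count N A ss ts) (?t, Suc i, out) (?s (Suc i), 0, out)"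
        unfolding upd by simp
    next
      assume "input_cell w (Suc i) \<noteq> Letter a"
      then have "w ! i \<noteq> a" using i by (simp add: input_cell_Letter)
      then show "impl w L goto_start (?t, Suc i, out) (?s (Suc i), 0, out)"
        using i f(3) by (intro impl_eq[OF impl_goto_start]) auto
    qed
    show "impl w L (inc ri ;; goto_index ;; Cond (\<lambda>x _. x = Letter a) (update_count N A ss ts) goto_start)
        (?s i, 0, out) (?s (Suc i), 0, out)"
      by (rule impl_Seq[OF 1 impl_Seq[OF 2 3]])
  qed (use \<rho> f in \<open>auto simp: fun_eq_iff\<close>)
  let ?o = "out @ map Bit (binary (f ?n))"
  show "impl w L (clear ri) (?s ?n, 0, out) (\<rho>(rcnt := f ?n), 0, out)"
    by (rule impl_eq[OF impl_clear]) (use \<rho> in \<open>auto simp: fun_eq_iff\<close>)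
  show "impl w L (emit_register rcnt) (\<rho>(rcnt := f ?n), 0, out) (\<rho>(rcnt := f ?n), 0, ?o)"
    by (rule impl_eq[OF impl_emit_register]) simp
  show "impl w L (emit Separator) (\<rho>(rcnt := f ?n), 0, ?o) (\<rho>(rcnt := f ?n), 0, ?o @ [Separator])"
    by (rule impl_emit) simp
  show "impl w L (clear rcnt) (\<rho>(rcnt := f ?n), 0, ?o @ [Separator])
      (\<rho>, 0, out @ map Bit (binary (f ?n)) @ [Separator])"
    by (rule impl_eq[OF impl_clear]) (use \<rho> in \<open>auto simp: fun_eq_iff\<close>)
qed

text \<open>The first pass computes the length \<open>n\<close> and, by \<open>C\<close> increments
  at the start and for every letter, the bound \<open>C * (n + 1)\<close> for the moduli.\<close>

definition parikh_program ::
    "nat \<Rightarrow> nat \<Rightarrow> 'a mats \<Rightarrow> 'a list \<Rightarrow> functional list \<Rightarrow> ('a, output_symbol) com"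
  where
  "parikh_program C N A ss ts =
     seqs (replicate C (inc rK)) ;; move_input MoveRight ;;
     Loop (\<lambda>x _. x \<noteq> RightEnd) (inc rn ;; seqs (replicate C (inc rK)) ;; move_input MoveRight) ;;
     goto_start ;; seqs (map (output_count N A ss ts) ss)"

lemma input_cell_RightEnd: "input_cell w h = RightEnd \<longleftrightarrow> length w < h"
  by (simp add: input_cell_def)

lemma impl_parikh_program:
  fixes C N A ts w
  defines "matches i \<equiv> card {j \<in> {1..i}. \<not> distinguished N A ts (C * (length w + 1)) w i j}"
  assumes L: "C * (length w + 1) + length w + 1 < 2 ^ L" and w: "set w \<subseteq> set ss"
    and f: "\<And>a. f a 0 = 0" "\<And>a i. i < length w \<Longrightarrow> f a i \<le> length w"
      "\<And>a i. i < length w \<Longrightarrow> w ! i \<noteq> a \<Longrightarrow> f a (Suc i) = f a i"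
      "\<And>a i. i < length w \<Longrightarrow> w ! i = a \<Longrightarrow> odd (matches (Suc i)) \<Longrightarrow> f a (Suc i) = f a i + 1"
      "\<And>a i. i < length w \<Longrightarrow> w ! i = a \<Longrightarrow> even (matches (Suc i)) \<Longrightarrow> f a i = f a (Suc i) + 1"
  shows "\<exists>\<rho>. impl w L (parikh_program C N A ss ts) (\<lambda>_. 0, 0, [])
    (\<rho>, 0, concat (map (\<lambda>a. map Bit (binary (f a (length w))) @ [Separator]) ss))"
proof
  let ?n = "length w" and ?nil = "[] :: output_symbol list"
  let ?s = "\<lambda>i. (\<lambda>_. 0)(rn := i, rK := C * (i + 1))"
  have add: "impl w L (seqs (replicate C (inc rK))) (\<rho>, h, out) (\<rho>(rK := \<rho> rK + C), h, out)"
    if "\<rho> rK + C < 2 ^ L" for \<rho> h and out :: "output_symbol list"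
    by (rule impl_repeat[where x = "\<lambda>i. (\<rho>(rK := \<rho> rK + i), h, out)"])
      (use that in \<open>auto intro!: impl_eq[OF impl_inc]\<close>)
  have less: "C * (i + 1) + C + i + 1 < 2 ^ L" if "i < ?n" for i
  proof -
    have "C * (i + 1) + C = C * (i + 2)" by simp
    also have "\<dots> \<le> C * (?n + 1)" using that by (intro mult_left_mono) auto
    finally show ?thesis using L that by linarith
  qed
  have C: "C < 2 ^ L"
    using L by (simp add: algebra_simps)
  have 1: "impl w L (seqs (replicate C (inc rK))) (\<lambda>_. 0, 0, ?nil) (?s 0, 0, ?nil)"
    by (rule impl_eq[OF add]) (use C in \<open>auto simp: fun_eq_iff\<close>)
  have 2: "impl w L (move_input MoveRight) (?s 0, 0, ?nil) (?s 0, Suc 0, ?nil)"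
    by (rule impl_eq[OF impl_move_input]) auto
  have 3: "impl w L (Loop (\<lambda>x _. x \<noteq> RightEnd) (inc rn ;; seqs (replicate C (inc rK)) ;; move_input MoveRight))
      (?s 0, Suc 0, ?nil) (?s ?n, Suc ?n, ?nil)"
  proof (rule impl_Loop_input[where m = ?n and \<rho> = ?s and h = Suc and out = "\<lambda>_. ?nil"])
    fix i assume i: "i < ?n"
    let ?t = "(?s i)(rn := Suc i)"
    have 1: "impl w L (inc rn) (?s i, Suc i, ?nil) (?t, Suc i, ?nil)"
      by (rule impl_eq[OF impl_inc]) (use less[OF i] in auto)
    have 2: "impl w L (seqs (replicate C (inc rK))) (?t, Suc i, ?nil) (?s (Suc i), Suc i, ?nil)"
      by (rule impl_eq[OF add]) (use less[OF i] in \<open>auto simp: fun_eq_iff\<close>)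
    have 3: "impl w L (move_input MoveRight) (?s (Suc i), Suc i, ?nil) (?s (Suc i), Suc (Suc i), ?nil)"
      by (rule impl_eq[OF impl_move_input]) (use i in auto)
    show "impl w L (inc rn ;; seqs (replicate C (inc rK)) ;; move_input MoveRight)
        (?s i, Suc i, ?nil) (?s (Suc i), Suc (Suc i), ?nil)"
      by (rule impl_Seq[OF 1 impl_Seq[OF 2 3]])
  qed (auto simp: input_cell_RightEnd)
  have 4: "impl w L goto_start (?s ?n, Suc ?n, ?nil) (?s ?n, 0, ?nil)"
    by (rule impl_goto_start) simp
  let ?o = "\<lambda>as. concat (map (\<lambda>a. map Bit (binary (f a ?n)) @ [Separator]) as)"
  have 5: "impl w L (seqs (map (output_count N A ss ts) ss)) (?s ?n, 0, ?nil) (?s ?n, 0, ?o ss)"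
  proof (rule impl_seqs_map[where x = "\<lambda>p. (?s ?n, 0, ?o (take p ss))"])
    fix p assume p: "p < length ss"
    let ?a = "ss ! p"
    have "impl w L (output_count N A ss ts ?a) (?s ?n, 0, ?o (take p ss))
        (?s ?n, 0, ?o (take p ss) @ map Bit (binary (f ?a ?n)) @ [Separator])"
      by (rule impl_output_count[where K = "C * (?n + 1)"])
        (use L w f[where a = ?a] in \<open>auto simp: idle_def clean_def matches_def\<close>)
    then show "impl w L (output_count N A ss ts ?a) (?s ?n, 0, ?o (take p ss)) (?s ?n, 0, ?o (take (Suc p) ss))"
      using p by (simp add: take_Suc_conv_app_nth)
  qed auto
  show "impl w L (parikh_program C N A ss ts) (\<lambda>_. 0, 0, []) (?s ?n, 0, ?o ss)"
    unfolding parikh_program_def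
    by (intro impl_Seq[OF 1] impl_Seq[OF 2] impl_Seq[OF 3] impl_Seq[OF 4] 5)
qed

text \<open>Two marks, twelve scalar registers and two vectors of length \<open>N\<close> need
  \<open>14 + 2 * N\<close> tracks, so \<open>16 + 2 * N\<close> leaves enough room.\<close>

lemma rx_ry_le: "l < N \<Longrightarrow> rx l + 2 < 16 + 2 * N" "l < N \<Longrightarrow> ry l + 2 < 16 + 2 * N"
  by (simp_all add: rx_def ry_def)

lemma symbols_below_addmul:
  assumes "z + 2 < R" "11 < R"
  shows "symbols_below (2 ^ R) (addmul z y a)"
  using assms by (auto simp: addmul_def addmod_def submod_def incmod_def)

lemma symbols_below_row:
  assumes "z + 2 < R" "11 < R"
  shows "symbols_below (2 ^ R) (row N z P)"
  using symbols_below_addmul[OF assms] by (auto simp: row_def)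

lemma symbols_below_apply_letter: "symbols_below (2 ^ (16 + 2 * N)) (apply_letter N A ss)"
proof (induction ss)
  case (Cons s ss)
  have "symbols_below (2 ^ (16 + 2 * N)) (matstep N B)" for B
    unfolding matstep_def
    by (auto intro!: symbols_below_row symbols_below_write rx_ry_le simp del: power_add)
  with Cons show ?case by (simp add: apply_letter_def)
qed (simp add: apply_letter_def)

lemma symbols_below_vec:
  "symbols_below (2 ^ (16 + 2 * N)) (init_vec N e)" "symbols_below (2 ^ (16 + 2 * N)) (clear_vec N)"
  unfolding init_vec_def clear_vec_def incmod_def
  by (auto intro!: symbols_below_write rx_ry_le simp del: power_add)

lemma symbols_below_goto [simp]:
  "symbols_below K goto_start" "5 + 2 < R \<Longrightarrow> symbols_below (2 ^ R) goto_index"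
  by (simp_all add: goto_start_def goto_index_def)

lemma symbols_below_eval_series:
  "z < 12 \<Longrightarrow> symbols_below (2 ^ (16 + 2 * N)) (eval_series N A ss z r t)"
  unfolding eval_series_def conj_act_def
  by (simp add: symbols_below_apply_letter symbols_below_vec symbols_below_row del: power_add)

lemma symbols_below_compare_series: "symbols_below (2 ^ (16 + 2 * N)) (compare_series N A ss t)"
  unfolding compare_series_def by (simp add: symbols_below_eval_series del: power_add)

lemma symbols_below_compare_all: "symbols_below (2 ^ (16 + 2 * N)) (compare_all N A ss ts)"
  unfolding compare_all_def by (simp add: symbols_below_compare_series del: power_add)

lemma symbols_below_update_count: "symbols_below (2 ^ (16 + 2 * N)) (update_count N A ss ts)"
  unfolding update_count_def by (simp add: symbols_below_compare_all del: power_add)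

lemma symbols_below_output_count: "symbols_below (2 ^ (16 + 2 * N)) (output_count N A ss ts a)"
  unfolding output_count_def by (simp add: symbols_below_update_count del: power_add)

lemma symbols_below_parikh_program: "symbols_below (2 ^ (16 + 2 * N)) (parikh_program C N A ss ts)"
  unfolding parikh_program_def by (simp add: symbols_below_output_count del: power_add)

theorem logspace_parikh:
  fixes S :: "'a::linorder set" and C N A ts and f :: "'a list \<Rightarrow> 'a \<Rightarrow> nat \<Rightarrow> nat"
  defines "matches w i \<equiv> card {j \<in> {1..i}. \<not> distinguished N A ts (C * (length w + 1)) w i j}"
  assumes S: "finite S"
    and f: "\<And>w a. w \<in> lists S \<Longrightarrow> f w a 0 = 0"
      "\<And>w a i. w \<in> lists S \<Longrightarrow> i < length w \<Longrightarrow> f w a i \<le> length w"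
      "\<And>w a i. w \<in> lists S \<Longrightarrow> i < length w \<Longrightarrow> w ! i \<noteq> a \<Longrightarrow> f w a (Suc i) = f w a i"
      "\<And>w a i. w \<in> lists S \<Longrightarrow> i < length w \<Longrightarrow> w ! i = a \<Longrightarrow> odd (matches w (Suc i)) \<Longrightarrow>
        f w a (Suc i) = f w a i + 1"
      "\<And>w a i. w \<in> lists S \<Longrightarrow> i < length w \<Longrightarrow> w ! i = a \<Longrightarrow> even (matches w (Suc i)) \<Longrightarrow>
        f w a i = f w a (Suc i) + 1"
  shows "\<exists>T :: ('a, output_symbol) transducer. logspace_transducer S T \<and>
    (\<forall>w\<in>lists S. computes T w (encode_vector S (\<lambda>a. f w a (length w))))"
proof -
  \<comment> \<open>The moduli and residues are at most \<open>C * (n + 1)\<close>, and positions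
    and counts are linear in \<open>n\<close> as well; all of them fit into \<open>L n\<close>
    bits.\<close>
  define M where "M n = C * (n + 1) + n + 1" for n
  define L where "L n = nat \<lfloor>log 2 (real (M n))\<rfloor> + 1" for n
  have M1: "M n \<ge> 1" for n by (simp add: M_def)
  have log_nonneg: "0 \<le> log 2 (real (M n))" for n using M1[of n] by simp
  have M: "M n < 2 ^ L n" for n
  proof -
    have "log 2 (real (M n)) < real (L n)"
      using log_nonneg[of n] unfolding L_def by linarith
    then have "real (M n) < 2 powr real (L n)" using M1[of n] by (simp add: log_less_iff)
    then have "real (M n) < real (2 ^ L n)" by (simp add: powr_realpow)
    then show ?thesis by (simp only: of_nat_less_iff)
  qed
  let ?c = "init_tape ;; parikh_program C N A (sorted_list_of_set S) ts"
  show ?thesis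
  proof (rule logspace_transducer_of_com[where c = ?c and K = "2 ^ (16 + 2 * N)" and s = "\<lambda>n. Suc (L n)"])
    show "symbols_below (2 ^ (16 + 2 * N)) ?c"
      by (simp add: symbols_below_parikh_program symbols_below_init_tape del: power_add)
    have "(\<lambda>n. real (Suc (L n))) \<in> O(\<lambda>n. log 2 ((real C + 1) * (real n + 1)) + 2)"
    proof (intro landau_o.big_mono always_eventually allI)
      fix n
      have "real (M n) = (real C + 1) * (real n + 1)" by (simp add: M_def algebra_simps)
      moreover have "real (Suc (L n)) \<le> log 2 (real (M n)) + 2"
        using log_nonneg[of n] unfolding L_def by linarith
      ultimately show "norm (real (Suc (L n))) \<le> norm (log 2 ((real C + 1) * (real n + 1)) + 2)"
        by simp
    qed
    also have "(\<lambda>n. log 2 ((D + 1) * (real n + 1)) + 2) \<in> O(\<lambda>n. ln (real n))" if "D \<ge> 0" for D :: real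
    proof -
      have "D + 1 > 0" using that by simp
      then show ?thesis by real_asymp
    qed
    from this[of "real C"] have "(\<lambda>n. log 2 ((real C + 1) * (real n + 1)) + 2) \<in> O(\<lambda>n. ln (real n))" by simp
    finally show "(\<lambda>n. real (Suc (L n))) \<in> O(\<lambda>n. ln (real n))" .
  next
    fix w assume w: "w \<in> lists S"
    have "\<exists>\<rho>. impl w (L (length w)) (parikh_program C N A (sorted_list_of_set S) ts) (\<lambda>_. 0, 0, [])
        (\<rho>, 0, concat (map (\<lambda>a. map Bit (binary (f w a (length w))) @ [Separator]) (sorted_list_of_set S)))"
    proof (rule impl_parikh_program[where f = "f w"])
      show "C * (length w + 1) + length w + 1 < 2 ^ L (length w)"
        using M[of "length w"] by (simp add: M_def)
      show "set w \<subseteq> set (sorted_list_of_set S)" using w S by auto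
    qed (use f[OF w, unfolded matches_def] in blast)+
    then obtain \<rho> where "impl w (L (length w)) (parikh_program C N A (sorted_list_of_set S) ts) (\<lambda>_. 0, 0, [])
        (\<rho>, 0, encode_vector S (\<lambda>a. f w a (length w)))"
      unfolding encode_vector_def by blast
    moreover have "0 < L (length w)" by (simp add: L_def)
    ultimately show "\<exists>h \<tau> p. exec w (Suc (L (length w))) ?c (0, \<lambda>_. 0, 0, [])
        (h, \<tau>, p, encode_vector S (\<lambda>a. f w a (length w)))"
      by (rule exec_of_impl)
  qed auto
qed

section \<open>Integer matrices and congruences\<close>

text \<open>The entry \<open>1 / ((n + 1) (n choose k))\<close> of the Leibniz harmonic triangle.
  Each entry is the sum of the two below it, which is \<open>leibniz_Suc\<close>.\<close>

definition leibniz :: "nat \<Rightarrow> nat \<Rightarrow> real" where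
  "leibniz n k = fact k * fact (n - k) / fact (Suc n)"

lemma leibniz_Suc:
  assumes "k \<le> n"
  shows "leibniz (Suc n) (Suc k) = leibniz n k - leibniz (Suc n) k"
proof -
  obtain r where n: "n = k + r" using assms le_Suc_ex by blast
  have "leibniz n k = fact k * fact r / fact (Suc n)"
    "leibniz (Suc n) k = fact k * (real (Suc r) * fact r) / (real (n + 2) * fact (Suc n))"
    "leibniz (Suc n) (Suc k) = (real (Suc k) * fact k) * fact r / (real (n + 2) * fact (Suc n))"
    by (simp_all add: leibniz_def n)
  moreover have "real (n + 2) \<noteq> 0" "(fact (Suc n) :: real) \<noteq> 0" by simp_all
  moreover have "real (n + 2) = real (Suc k) + real (Suc r)" by (simp add: n)
  ultimately show ?thesis by (simp only:) (simp add: divide_simps, simp add: algebra_simps)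
qed

text \<open>The first entry of row \<open>n\<close> is \<open>1 / (n + 1)\<close>, and the triangle
  rule expresses every other entry as an integer combination of such first entries in rows up to
  \<open>n\<close>.\<close>

lemma leibniz_multiple_Ints:
  fixes z :: int
  shows "(\<And>j. j \<in> {1..Suc n} \<Longrightarrow> int j dvd z) \<Longrightarrow> k \<le> n \<Longrightarrow> of_int z * leibniz n k \<in> \<int>"
proof (induction k arbitrary: n)
  case 0
  from 0(1)[of "Suc n"] obtain q where "z = int (Suc n) * q" by auto
  then have "real_of_int z = real (Suc n) * of_int q" by simp
  moreover have "leibniz n 0 = 1 / real (Suc n)"
    by (simp add: leibniz_def del: of_nat_Suc)
  ultimately have "of_int z * leibniz n 0 = of_int q" by simp
  then show ?case by simp
next
  case (Suc k)
  then obtain n' where n: "n = Suc n'" by (cases n) auto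
  have "of_int z * leibniz n' k \<in> \<int>" by (rule Suc.IH) (use Suc.prems n in auto)
  moreover have "of_int z * leibniz n k \<in> \<int>" by (rule Suc.IH) (use Suc.prems in auto)
  ultimately show ?case
    using leibniz_Suc[of k n'] Suc.prems(2) n by (simp add: right_diff_distrib)
qed

text \<open>
  All \<open>(n + 1) (n choose k)\<close> divide the least common multiple of \<open>1, \<dots>, n + 1\<close>, and these
  numbers add up to \<open>(n + 1) 2\<^sup>n\<close>.
\<close>

lemma zero_if_many_divisors:
  fixes z :: int
  assumes "\<And>j. j \<in> {1..Suc n} \<Longrightarrow> int j dvd z" "\<bar>z\<bar> < 2 ^ n"
  shows "z = 0"
proof (rule ccontr)
  assume "z \<noteq> 0"
  have le: "real (Suc n) * real (n choose k) \<le> of_int \<bar>z\<bar>" if "k \<le> n" for k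
  proof -
    have pos: "leibniz n k > 0" by (simp add: leibniz_def)
    have "of_int z * leibniz n k \<in> \<int>" using leibniz_multiple_Ints assms(1) that by blast
    then obtain q where q: "of_int z * leibniz n k = of_int q" by (auto elim: Ints_cases)
    then have "q \<noteq> 0" using \<open>z \<noteq> 0\<close> pos by auto
    then have "1 \<le> \<bar>real_of_int q\<bar>" by linarith
    also have "\<bar>real_of_int q\<bar> = of_int \<bar>z\<bar> * leibniz n k"
      unfolding q[symmetric] using pos by (simp add: abs_mult)
    finally have "1 / leibniz n k \<le> of_int \<bar>z\<bar>" using pos by (simp add: divide_le_eq)
    moreover have "1 / leibniz n k = real (Suc n) * real (n choose k)"
      using that by (simp add: leibniz_def binomial_fact)
    ultimately show ?thesis by simp
  qed
  have "real (Suc n) * 2 ^ n = (\<Sum>k\<le>n. real (Suc n) * real (n choose k))"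
    using choose_row_sum[of n] by (simp add: sum_distrib_left[symmetric] flip: of_nat_sum)
  also have "\<dots> \<le> (\<Sum>k\<le>n. of_int \<bar>z\<bar>)" by (intro sum_mono le) simp
  also have "\<dots> = real (Suc n) * of_int \<bar>z\<bar>" by simp
  finally have "2 ^ n \<le> real_of_int \<bar>z\<bar>" by simp
  also have "real_of_int \<bar>z\<bar> < real_of_int (2 ^ n)" using assms(2) by (simp only: of_int_less_iff)
  finally show False by simp
qed

text \<open>The integer vectors that evaluate to 0 are cut out one coordinate at a time. If
  \<open>\<rho> N\<close> depends rationally on the earlier values, multiplying by a common
  denominator eliminates the last coordinate; if not, that coordinate must vanish. The case
  distinction is not effective, but only existence is claimed.\<close>

lemma integer_relations:
  fixes \<rho> :: "nat \<Rightarrow> real"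
  shows "\<exists>Ps :: (nat \<Rightarrow> int) list. \<forall>z :: nat \<Rightarrow> int.
    (\<Sum>l<N. of_int (z l) * \<rho> l) = 0 \<longleftrightarrow> (\<forall>P\<in>set Ps. (\<Sum>l<N. P l * z l) = 0)"
proof (induction N)
  case 0
  show ?case by (rule exI[of _ "[]"]) simp
next
  case (Suc N)
  then obtain Ps :: "(nat \<Rightarrow> int) list" where
    Ps: "\<And>z. (\<Sum>l<N. of_int (z l) * \<rho> l) = 0 \<longleftrightarrow> (\<forall>P\<in>set Ps. (\<Sum>l<N. P l * z l) = 0)" by blast
  show ?case
  proof (cases "\<exists>D e. D \<noteq> (0::int) \<and> of_int D * \<rho> N = (\<Sum>l<N. of_int (e l) * \<rho> l)")
    case True
    then obtain D e where D: "D \<noteq> (0::int)" "of_int D * \<rho> N = (\<Sum>l<N. of_int (e l) * \<rho> l)" by blast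
    \<comment> \<open>The form \<open>P\<close> applied to the vector
      \<open>D z\<^sub>l + e\<^sub>l z\<^sub>N\<close> of length \<open>N\<close>, rewritten as a
      form in all \<open>N + 1\<close> coordinates of \<open>z\<close>.\<close>
    define Q where "Q P = (\<lambda>l. if l < N then D * P l else (\<Sum>k<N. P k * e k))" for P :: "nat \<Rightarrow> int"
    have "(\<Sum>l<Suc N. of_int (z l) * \<rho> l) = 0 \<longleftrightarrow> (\<forall>P\<in>set (map Q Ps). (\<Sum>l<Suc N. P l * z l) = 0)" for z
    proof -
      have QP: "(\<Sum>l<N. P l * (D * z l + e l * z N)) = (\<Sum>l<Suc N. Q P l * z l)" for P
        by (simp add: Q_def sum_distrib_left sum_distrib_right sum.distrib algebra_simps)
      have "(\<Sum>l<Suc N. of_int (z l) * \<rho> l) = 0 \<longleftrightarrow> of_int D * (\<Sum>l<Suc N. of_int (z l) * \<rho> l) = 0"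
        using D(1) by simp
      also have "of_int D * (\<Sum>l<Suc N. of_int (z l) * \<rho> l) =
          (\<Sum>l<N. of_int (D * z l) * \<rho> l) + of_int (z N) * (of_int D * \<rho> N)"
        by (simp add: sum_distrib_left algebra_simps)
      also have "\<dots> = (\<Sum>l<N. of_int (D * z l + e l * z N) * \<rho> l)"
        unfolding D(2) by (simp add: sum_distrib_left sum.distrib algebra_simps)
      also have "\<dots> = 0 \<longleftrightarrow> (\<forall>P\<in>set Ps. (\<Sum>l<N. P l * (D * z l + e l * z N)) = 0)"
        by (rule Ps)
      also have "\<dots> \<longleftrightarrow> (\<forall>P\<in>set (map Q Ps). (\<Sum>l<Suc N. P l * z l) = 0)"
        unfolding QP by simp
      finally show ?thesis .
    qed
    then show ?thesis by blast
  next
    case False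
    define Q where "Q P = (\<lambda>l. if l < N then P l else 0)" for P :: "nat \<Rightarrow> int"
    \<comment> \<open>The form that reads off the last coordinate.\<close>
    define E where "E = (\<lambda>l. if l = N then 1 else 0 :: int)"
    have "(\<Sum>l<Suc N. of_int (z l) * \<rho> l) = 0 \<longleftrightarrow> (\<forall>P\<in>set (E # map Q Ps). (\<Sum>l<Suc N. P l * z l) = 0)" for z
    proof -
      have E: "(\<Sum>l<Suc N. E l * z l) = z N" by (simp add: E_def)
      have Q: "(\<Sum>l<Suc N. Q P l * z l) = (\<Sum>l<N. P l * z l)" for P by (simp add: Q_def)
      have "z N = 0" if "(\<Sum>l<Suc N. of_int (z l) * \<rho> l) = 0"
      proof (rule ccontr)
        assume "z N \<noteq> 0"
        moreover have "of_int (z N) * \<rho> N = (\<Sum>l<N. of_int (- z l) * \<rho> l)"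
          using that by (simp add: sum_negf)
        ultimately have "\<exists>D e. D \<noteq> (0::int) \<and> of_int D * \<rho> N = (\<Sum>l<N. of_int (e l) * \<rho> l)"
          by (intro exI[of _ "z N"] exI[of _ "\<lambda>l. - z l"] conjI)
        with False show False by contradiction
      qed
      then have "(\<Sum>l<Suc N. of_int (z l) * \<rho> l) = 0 \<longleftrightarrow> z N = 0 \<and> (\<Sum>l<N. of_int (z l) * \<rho> l) = 0" by auto
      then show ?thesis using E Q Ps by simp
    qed
    then show ?thesis by blast
  qed
qed

section \<open>Growth of the integers computed along a word\<close>

lemma of_int_word_act_bound:
  fixes A :: "'a mats"
  assumes A: "\<And>s l. s \<in> set u \<Longrightarrow> l < N \<Longrightarrow> (\<Sum>j<N. \<bar>A s l j\<bar>) \<le> B"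
    and v: "\<And>l. l < N \<Longrightarrow> \<bar>v l\<bar> \<le> B" and l: "l < N" and B: "0 \<le> B"
  shows "\<bar>word_act N A u v l\<bar> \<le> B ^ Suc (length u)"
  using A l
proof (induction u arbitrary: l)
  case Nil
  then show ?case using v by simp
next
  case (Cons s u)
  have "\<bar>word_act N A (s # u) v l\<bar> \<le> (\<Sum>j<N. \<bar>A s l j * word_act N A u v j\<bar>)"
    unfolding word_act_Cons mat_act_def by (rule sum_abs)
  also have "\<dots> \<le> (\<Sum>j<N. \<bar>A s l j\<bar> * B ^ Suc (length u))"
    unfolding abs_mult using Cons by (intro sum_mono mult_left_mono) auto
  also have "\<dots> = (\<Sum>j<N. \<bar>A s l j\<bar>) * B ^ Suc (length u)" by (simp add: sum_distrib_right)
  also have "\<dots> \<le> B * B ^ Suc (length u)"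
    using Cons.prems B by (intro mult_right_mono) auto
  finally show ?case by simp
qed

text \<open>Each letter contributes one factor, and the start vector and the linear form one more
  each. The base is a power of two for comparison with the bound in
  \<open>zero_if_many_divisors\<close>.\<close>

lemma series_bound:
  fixes A :: "'a mats"
  assumes "finite S"
  shows "\<exists>B. \<forall>u\<in>lists S. \<forall>t\<in>set ts. \<bar>series N A t u\<bar> \<le> (2 ^ B) ^ (length u + 2)"
proof -
  \<comment> \<open>The sum of the absolute values of all coefficients, as a crude common bound for
    row sums, forms and start vectors.\<close>
  define X where "X = (\<Sum>s\<in>S. \<Sum>l<N. \<Sum>j<N. \<bar>A s l j\<bar>) + (\<Sum>t\<in>set ts. \<Sum>l<N. \<bar>fst t l\<bar>) +
    (\<Sum>t\<in>set ts. \<Sum>l<N. int (snd t l))"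
  have X1: "0 \<le> (\<Sum>s\<in>S. \<Sum>l<N. \<Sum>j<N. \<bar>A s l j\<bar>)" "0 \<le> (\<Sum>t\<in>set ts. \<Sum>l<N. \<bar>fst t l\<bar>)"
    "0 \<le> (\<Sum>t\<in>set ts. \<Sum>l<N. int (snd t l))" by (intro sum_nonneg; simp)+
  define B where "B = nat X"
  have XB: "X \<le> 2 ^ B"
  proof -
    have "X = int B" using X1 by (simp add: B_def X_def)
    also have "\<dots> \<le> int (2 ^ B)" using less_exp[of B] by (simp only: of_nat_le_iff)
    finally show ?thesis by simp
  qed
  have A: "(\<Sum>j<N. \<bar>A s l j\<bar>) \<le> 2 ^ B" if "s \<in> S" "l < N" for s l
  proof -
    have "(\<Sum>j<N. \<bar>A s l j\<bar>) \<le> (\<Sum>l<N. \<Sum>j<N. \<bar>A s l j\<bar>)"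
      using that by (intro member_le_sum) (auto intro: sum_nonneg)
    also have "\<dots> \<le> (\<Sum>s\<in>S. \<Sum>l<N. \<Sum>j<N. \<bar>A s l j\<bar>)"
      by (rule member_le_sum[of s S "\<lambda>s. \<Sum>l<N. \<Sum>j<N. \<bar>A s l j\<bar>"]) (use that assms in \<open>auto intro!: sum_nonneg\<close>)
    finally show ?thesis using XB X1 unfolding X_def by linarith
  qed
  have P: "(\<Sum>l<N. \<bar>fst t l\<bar>) \<le> 2 ^ B" if "t \<in> set ts" for t
  proof -
    have "(\<Sum>l<N. \<bar>fst t l\<bar>) \<le> (\<Sum>t\<in>set ts. \<Sum>l<N. \<bar>fst t l\<bar>)"
      by (rule member_le_sum[of t "set ts" "\<lambda>t. \<Sum>l<N. \<bar>fst t l\<bar>"]) (use that in \<open>auto intro!: sum_nonneg\<close>)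
    then show ?thesis using XB X1 unfolding X_def by linarith
  qed
  have e: "int (snd t l) \<le> 2 ^ B" if "t \<in> set ts" "l < N" for t l
  proof -
    have "int (snd t l) \<le> (\<Sum>l<N. int (snd t l))"
      by (rule member_le_sum[of l "{..<N}" "\<lambda>l. int (snd t l)"]) (use that in auto)
    also have "\<dots> \<le> (\<Sum>t\<in>set ts. \<Sum>l<N. int (snd t l))"
      by (rule member_le_sum[of t "set ts" "\<lambda>t. \<Sum>l<N. int (snd t l)"]) (use that in \<open>auto intro!: sum_nonneg\<close>)
    finally show ?thesis using XB X1 unfolding X_def by linarith
  qed
  have "\<bar>series N A t u\<bar> \<le> (2 ^ B) ^ (length u + 2)" if u: "u \<in> lists S" and t: "t \<in> set ts" for u t
  proof -
    let ?w = "word_act N A u (\<lambda>l. int (snd t l))"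
    have "\<bar>series N A t u\<bar> \<le> (\<Sum>l<N. \<bar>fst t l * ?w l\<bar>)"
      unfolding series_def by (rule sum_abs)
    also have "\<dots> \<le> (\<Sum>l<N. \<bar>fst t l\<bar> * (2 ^ B) ^ Suc (length u))"
      unfolding abs_mult
      by (intro sum_mono mult_left_mono of_int_word_act_bound) (use A e u t in auto)
    also have "\<dots> = (\<Sum>l<N. \<bar>fst t l\<bar>) * (2 ^ B) ^ Suc (length u)" by (simp add: sum_distrib_right)
    also have "\<dots> \<le> 2 ^ B * (2 ^ B) ^ Suc (length u)"
      using P[OF t] by (intro mult_right_mono) auto
    finally show ?thesis by simp
  qed
  then show ?thesis by blast
qed

section \<open>The integer lift of the geometric representation\<close>

context coxeter
begin

text \<open>A common multiple \<open>Q\<close> of all finite entries, so that each angle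
  \<open>\<pi> / m a b\<close> is an integer multiple of \<open>\<pi> / Q\<close>.\<close>

definition common_order :: nat where
  "common_order = (\<Prod>a\<in>S. \<Prod>b\<in>S. if m a b = 0 then 1 else m a b)"

lemma common_order_pos: "common_order > 0"
  unfolding common_order_def by (auto intro!: prod_pos)

lemma dvd_common_order:
  assumes "a \<in> S" "b \<in> S" "m a b \<noteq> 0"
  shows "m a b dvd common_order"
proof -
  have "m a b dvd (\<Prod>b\<in>S. if m a b = 0 then 1 else m a b)"
    using dvd_prodI[OF finS assms(2), of "\<lambda>b. if m a b = 0 then 1 else m a b"] assms(3) by simp
  also have "\<dots> dvd common_order"
    unfolding common_order_def using finS assms(1)
    by (rule dvd_prodI[of S a "\<lambda>a. \<Prod>b\<in>S. if m a b = 0 then 1 else m a b"])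
  finally show ?thesis .
qed

definition root_cos :: "nat \<Rightarrow> real" where
  "root_cos i = cos (real i * pi / real common_order)"

lemma root_cos_mod: "root_cos (i mod (2 * common_order)) = root_cos i"
proof -
  let ?Q = "common_order"
  have "real i = real (i mod (2 * ?Q) + 2 * ?Q * (i div (2 * ?Q)))" by simp
  also have "\<dots> = real (i mod (2 * ?Q)) + 2 * real ?Q * real (i div (2 * ?Q))"
    by (simp only: of_nat_add of_nat_mult of_nat_numeral)
  finally have "real i * pi / real ?Q = real (i mod (2 * ?Q)) * pi / real ?Q + of_int (int (i div (2 * ?Q))) * (2 * pi)"
    using common_order_pos by (simp add: field_simps)
  then have "root_cos i = cos (real (i mod (2 * ?Q)) * pi / real ?Q + of_int (int (i div (2 * ?Q))) * (2 * pi))"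
    by (simp only: root_cos_def)
  also have "\<dots> = root_cos (i mod (2 * ?Q))"
    unfolding root_cos_def cos_add using cos_int_2pin[of "int (i div (2 * ?Q))"] sin_int_2pin[of "int (i div (2 * ?Q))"]
    by (simp add: mult.commute)
  finally show ?thesis ..
qed

lemma root_cos_sum: "(\<Sum>j<2 * common_order. of_int (if j = i mod (2 * common_order) then x else 0) * root_cos j) =
  of_int x * root_cos i"
proof -
  have "(\<Sum>j<2 * common_order. of_int (if j = i mod (2 * common_order) then x else 0) * root_cos j) =
      (\<Sum>j<2 * common_order. if j = i mod (2 * common_order) then of_int x * root_cos j else 0)"
    by (intro sum.cong) auto
  also have "\<dots> = of_int x * root_cos i"
    using common_order_pos by (simp add: root_cos_mod)
  finally show ?thesis .
qed

text \<open>
  The integer span of the numbers \<open>cos (i \<pi> / Q)\<close> is closed under multiplication by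
  \<open>2 cos (h \<pi> / Q)\<close>, by the product formula for cosines.
\<close>

lemma cartan_root_cos:
  assumes "a \<in> S" "b \<in> S"
  shows "\<exists>\<gamma> :: nat \<Rightarrow> int. cartan a b * root_cos i = (\<Sum>j<2 * common_order. of_int (\<gamma> j) * root_cos j)"
proof (cases "m a b = 0")
  case True
  then have "cartan a b * root_cos i = of_int 2 * root_cos i" by (simp add: cartan_def)
  then show ?thesis
    unfolding root_cos_sum[of i 2, symmetric]
    by (intro exI[of _ "\<lambda>j. if j = i mod (2 * common_order) then 2 else 0"])
next
  case False
  let ?Q = common_order
  from dvd_common_order[OF assms False] obtain h where h: "?Q = m a b * h" by auto
  have "pi / real (m a b) = real h * pi / real ?Q"
    using h common_order_pos by (simp add: field_simps)
  then have "cartan a b * root_cos i = 2 * cos (real h * pi / real ?Q) * cos (real i * pi / real ?Q)"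
    using False by (simp add: cartan_def root_cos_def)
  also have "\<dots> = cos (real i * pi / real ?Q + real h * pi / real ?Q) + cos (real i * pi / real ?Q - real h * pi / real ?Q)"
    by (simp add: cos_add cos_diff)
  also have "real i * pi / real ?Q + real h * pi / real ?Q = real (i + h) * pi / real ?Q"
    by (simp add: field_simps add_divide_distrib)
  \<comment> \<open>Adding the period \<open>2 * ?Q\<close> keeps the index a natural
    number.\<close>
  also have "cos (real i * pi / real ?Q - real h * pi / real ?Q) = root_cos (i + 2 * ?Q - h)"
  proof -
    have "h \<le> i + 2 * ?Q" using h False by (simp add: trans_le_add2)
    then have "real (i + 2 * ?Q - h) * pi / real ?Q = (real i * pi / real ?Q - real h * pi / real ?Q) + 2 * pi"
      using common_order_pos by (simp add: of_nat_diff field_simps)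
    then show ?thesis by (simp add: root_cos_def)
  qed
  finally have "cartan a b * root_cos i = root_cos (i + h) + root_cos (i + 2 * ?Q - h)"
    by (simp add: root_cos_def)
  also have "\<dots> = (\<Sum>j<2 * ?Q. of_int ((if j = (i + h) mod (2 * ?Q) then 1 else 0) +
      (if j = (i + 2 * ?Q - h) mod (2 * ?Q) then 1 else 0)) * root_cos j)"
    unfolding of_int_add distrib_right sum.distrib root_cos_sum by simp
  finally show ?thesis
    by (intro exI[of _ "\<lambda>j. (if j = (i + h) mod (2 * ?Q) then 1 else 0) +
      (if j = (i + 2 * ?Q - h) mod (2 * ?Q) then 1 else 0)"])
qed

definition entry :: "'a \<Rightarrow> 'a \<Rightarrow> 'a \<Rightarrow> real" where
  "entry s x y = (if x = s then if y = s then - 1 else cartan s y else of_bool (x = y))"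

lemma reflect_entry:
  assumes "s \<in> S" "x \<in> S"
  shows "reflect s f x = (\<Sum>y\<in>S. entry s x y * f y)"
proof (cases "x = s")
  case True
  have "(\<Sum>y\<in>S. entry s s y * f y) = entry s s s * f s + (\<Sum>y\<in>S - {s}. entry s s y * f y)"
    using finS assms(1) by (rule sum.remove)
  also have "(\<Sum>y\<in>S - {s}. entry s s y * f y) = (\<Sum>y\<in>S - {s}. cartan s y * f y)"
    by (intro sum.cong) (auto simp: entry_def)
  finally show ?thesis using True by (simp add: reflect_def entry_def)
next
  case False
  then have "(\<Sum>y\<in>S. entry s x y * f y) = (\<Sum>y\<in>S. if y = x then f y else 0)"
    by (intro sum.cong) (auto simp: entry_def)
  then show ?thesis using False assms finS by (simp add: reflect_def)
qed

lemma entry_root_cos: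
  assumes "s \<in> S" "y \<in> S"
  shows "\<exists>\<gamma> :: nat \<Rightarrow> int. entry s x y * root_cos i = (\<Sum>j<2 * common_order. of_int (\<gamma> j) * root_cos j)"
proof (cases "x = s \<and> y \<noteq> s")
  case True
  then show ?thesis using cartan_root_cos[OF assms, of i] by (simp add: entry_def)
next
  case False
  then have "entry s x y \<in> {-1, 0, 1}" by (auto simp: entry_def)
  then obtain n :: int where "entry s x y = of_int n" using that[of "-1"] that[of 0] that[of 1] by auto
  then show ?thesis
    using root_cos_sum[of i n]
    by (intro exI[of _ "\<lambda>j. if j = i mod (2 * common_order) then n else 0"]) simp
qed

text \<open>Every real coordinate is replaced by integer coefficients with respect to the cosines,
  giving dimension \<open>N = |S| 2 Q\<close>. The coefficients in the matrices are arbitrary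
  choices, so integer vectors may depend on the word; their evaluation is the action on roots, which
  depends on the element alone. The forms in \<open>ts\<close> compare exactly these
  evaluations.\<close>

theorem integer_representation:
  "\<exists>N A ts. \<forall>u\<in>lists S. \<forall>v\<in>lists S.
    element_of S m u = element_of S m v \<longleftrightarrow> (\<forall>t\<in>set ts. series N A t u = series N A t v)"
proof -
  let ?d = "2 * common_order"
  define \<Gamma> where "\<Gamma> s x y i = (SOME \<gamma> :: nat \<Rightarrow> int.
    entry s x y * root_cos i = (\<Sum>j<?d. of_int (\<gamma> j) * root_cos j))" for s x y i
  have \<Gamma>: "entry s x y * root_cos i = (\<Sum>j<?d. of_int (\<Gamma> s x y i j) * root_cos j)"
    if "s \<in> S" "y \<in> S" for s x y i
    unfolding \<Gamma>_def by (rule someI_ex[OF entry_root_cos[OF that]])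
  define N where "N = card (S \<times> {..<?d})"
  obtain \<beta> where \<beta>: "bij_betw \<beta> {..<N} (S \<times> {..<?d})"
    unfolding N_def using ex_bij_betw_nat_finite[of "S \<times> {..<?d}"] finS by (auto simp: atLeast0LessThan)
  have \<beta>_in: "fst (\<beta> l) \<in> S" "snd (\<beta> l) < ?d" if "l < N" for l
    using bij_betwE[OF \<beta>] that by (auto simp: mem_Times_iff)
  define A where "A s l l' = \<Gamma> s (fst (\<beta> l)) (fst (\<beta> l')) (snd (\<beta> l')) (snd (\<beta> l))" for s l l'
  define \<rho> where "\<rho> x l = (if fst (\<beta> l) = x then root_cos (snd (\<beta> l)) else 0)" for x l
  define eval where "eval v x = (\<Sum>l<N. of_int (v l) * \<rho> x l)" for v :: "nat \<Rightarrow> int" and x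
  \<comment> \<open>As \<open>root_cos 0 = 1\<close>, this unit vector lifts
    \<open>simple_root s\<close>.\<close>
  define e where "e s l = (if \<beta> l = (s, 0) then 1 else 0 :: nat)" for s l
  have slice: "(\<Sum>l<N. if fst (\<beta> l) = x then g (snd (\<beta> l)) else 0) = (\<Sum>j<?d. g j)" if "x \<in> S"
    for x and g :: "nat \<Rightarrow> real"
  proof -
    have "(\<Sum>l<N. if fst (\<beta> l) = x then g (snd (\<beta> l)) else 0) =
        (\<Sum>p\<in>S \<times> {..<?d}. if fst p = x then g (snd p) else 0)"
      using sum.reindex_bij_betw[OF \<beta>, of "\<lambda>p. if fst p = x then g (snd p) else 0"] by simp
    also have "\<dots> = (\<Sum>y\<in>S. \<Sum>j<?d. if y = x then g j else 0)"
      by (simp add: sum.cartesian_product split_beta)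
    also have "\<dots> = (\<Sum>y\<in>S. if y = x then \<Sum>j<?d. g j else 0)"
      by (intro sum.cong) auto
    also have "\<dots> = (\<Sum>j<?d. g j)" using that finS by simp
    finally show ?thesis .
  qed
  have eval_mat_act: "eval (mat_act N (A s) v) x = reflect s (eval v) x" if "s \<in> S" "x \<in> S" for s v x
  proof -
    have column: "(\<Sum>l<N. of_int (A s l l') * \<rho> x l) = (\<Sum>y\<in>S. entry s x y * \<rho> y l')" if l': "l' < N" for l'
    proof -
      let ?y = "fst (\<beta> l')" and ?i = "snd (\<beta> l')"
      have "(\<Sum>l<N. of_int (A s l l') * \<rho> x l) =
          (\<Sum>l<N. if fst (\<beta> l) = x then of_int (\<Gamma> s x ?y ?i (snd (\<beta> l))) * root_cos (snd (\<beta> l)) else 0)"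
        by (intro sum.cong) (auto simp: A_def \<rho>_def)
      also have "\<dots> = (\<Sum>j<?d. of_int (\<Gamma> s x ?y ?i j) * root_cos j)"
        by (rule slice) (use \<open>x \<in> S\<close> in simp)
      also have "\<dots> = entry s x ?y * root_cos ?i"
        using \<Gamma>[OF \<open>s \<in> S\<close>, of ?y x ?i] \<beta>_in[OF l'] by simp
      also have "\<dots> = (\<Sum>y\<in>S. if y = ?y then entry s x y * root_cos ?i else 0)"
        using finS \<beta>_in[OF l'] by simp
      also have "\<dots> = (\<Sum>y\<in>S. entry s x y * \<rho> y l')"
        by (intro sum.cong) (auto simp: \<rho>_def)
      finally show ?thesis .
    qed
    have "eval (mat_act N (A s) v) x = (\<Sum>l<N. \<Sum>l'<N. of_int (v l') * (of_int (A s l l') * \<rho> x l))"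
      unfolding eval_def mat_act_def of_int_sum of_int_mult sum_distrib_right
      by (intro sum.cong HOL.refl) (simp add: mult_ac)
    also have "\<dots> = (\<Sum>l'<N. \<Sum>l<N. of_int (v l') * (of_int (A s l l') * \<rho> x l))"
      by (rule sum.swap)
    also have "\<dots> = (\<Sum>l'<N. of_int (v l') * (\<Sum>y\<in>S. entry s x y * \<rho> y l'))"
      by (intro sum.cong HOL.refl) (simp add: column flip: sum_distrib_left)
    also have "\<dots> = (\<Sum>l'<N. \<Sum>y\<in>S. entry s x y * (of_int (v l') * \<rho> y l'))"
      unfolding sum_distrib_left by (intro sum.cong HOL.refl) (simp add: mult_ac)
    also have "\<dots> = (\<Sum>y\<in>S. \<Sum>l'<N. entry s x y * (of_int (v l') * \<rho> y l'))"
      by (rule sum.swap)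
    also have "\<dots> = (\<Sum>y\<in>S. entry s x y * eval v y)"
      by (simp add: eval_def sum_distrib_left)
    finally show ?thesis using reflect_entry[OF that] by simp
  qed
  have reflect_S: "reflect s f x = reflect s g x" if "\<And>y. y \<in> S \<Longrightarrow> f y = g y" "s \<in> S" "x \<in> S" for s f g x
    unfolding reflect_entry[OF that(2,3)] using that(1) by (intro sum.cong) auto
  have eval_e: "eval (\<lambda>l. int (e s l)) x = simple_root s x" if "s \<in> S" "x \<in> S" for s x
  proof -
    have "eval (\<lambda>l. int (e s l)) x =
        (\<Sum>l<N. if fst (\<beta> l) = s then (if snd (\<beta> l) = 0 then of_bool (x = s) else 0) else 0)"
      unfolding eval_def by (intro sum.cong) (auto simp: e_def \<rho>_def root_cos_def prod_eq_iff)
    also have "\<dots> = (\<Sum>j<?d. if j = 0 then of_bool (x = s) else 0)"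
      using slice[OF that(1), of "\<lambda>j. if j = 0 then of_bool (x = s) else 0"] .
    also have "\<dots> = simple_root s x" using common_order_pos by (simp add: simple_root_def)
    finally show ?thesis .
  qed
  have eval_word: "eval (word_act N A u (\<lambda>l. int (e s l))) x = act u (simple_root s) x"
    if "u \<in> lists S" "s \<in> S" "x \<in> S" for u s x
    using that(1,3)
  proof (induction u arbitrary: x rule: list.induct)
    case Nil
    then show ?case using eval_e that(2) by simp
  next
    case (Cons a u)
    then have a: "a \<in> S" and u: "u \<in> lists S" by auto
    have "eval (word_act N A (a # u) (\<lambda>l. int (e s l))) x = reflect a (eval (word_act N A u (\<lambda>l. int (e s l)))) x"
      unfolding word_act_Cons by (rule eval_mat_act[OF a Cons.prems(2)])
    also have "\<dots> = reflect a (act u (simple_root s)) x"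
      by (rule reflect_S[OF Cons.IH[OF u] a Cons.prems(2)])
    finally show ?case unfolding act_Cons .
  qed
  \<comment> \<open>Roots are functions on the whole type, so the coordinates outside
    \<open>S\<close>, which the lift does not contain, are shown to agree separately.\<close>
  have outside: "act u (simple_root s) x = 0" if "u \<in> lists S" "s \<in> S" "x \<notin> S" for u s x
    using that(1)
  proof (induction u)
    case Nil
    then show ?case using that by (auto simp: simple_root_def)
  next
    case (Cons a u)
    then have "a \<noteq> x" using that(3) by auto
    then show ?case using Cons by (simp add: reflect_def)
  qed
  have "\<exists>Ps. \<forall>z :: nat \<Rightarrow> int. eval z x = 0 \<longleftrightarrow> (\<forall>P\<in>set Ps. (\<Sum>l<N. P l * z l) = 0)" for x
    unfolding eval_def by (rule integer_relations)
  then obtain Ps where Ps: "\<And>x z. eval z x = 0 \<longleftrightarrow> (\<forall>P\<in>set (Ps x). (\<Sum>l<N. P l * z l) = 0)"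
    by metis
  obtain ss where ss: "set ss = S" using finS finite_list by blast
  define ts where "ts = concat (map (\<lambda>s. concat (map (\<lambda>x. map (\<lambda>P. (P, e s)) (Ps x)) ss)) ss)"
  have ts: "set ts = {(P, e s) | s x P. s \<in> S \<and> x \<in> S \<and> P \<in> set (Ps x)}"
    unfolding ts_def by (auto simp: ss)
  have "element_of S m u = element_of S m v \<longleftrightarrow> (\<forall>t\<in>set ts. series N A t u = series N A t v)"
    if u: "u \<in> lists S" and v: "v \<in> lists S" for u v
  proof -
    have "element_of S m u = element_of S m v \<longleftrightarrow>
        (\<forall>s\<in>S. act u (simple_root s) = act v (simple_root s))" by (rule act_faithful[OF u v])
    also have "\<dots> \<longleftrightarrow> (\<forall>s\<in>S. \<forall>x\<in>S. act u (simple_root s) x = act v (simple_root s) x)"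
    proof (intro ball_cong HOL.refl)
      fix s assume s: "s \<in> S"
      show "act u (simple_root s) = act v (simple_root s) \<longleftrightarrow>
          (\<forall>x\<in>S. act u (simple_root s) x = act v (simple_root s) x)"
      proof
        assume "\<forall>x\<in>S. act u (simple_root s) x = act v (simple_root s) x"
        then show "act u (simple_root s) = act v (simple_root s)"
          using outside[OF u s] outside[OF v s] by (intro ext) metis
      qed simp
    qed
    also have "\<dots> \<longleftrightarrow> (\<forall>s\<in>S. \<forall>x\<in>S. \<forall>P\<in>set (Ps x). series N A (P, e s) u = series N A (P, e s) v)"
    proof (intro ball_cong HOL.refl)
      fix s x assume s: "s \<in> S" and x: "x \<in> S"
      let ?u = "word_act N A u (\<lambda>l. int (e s l))" and ?v = "word_act N A v (\<lambda>l. int (e s l))"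
      \<comment> \<open>The relations express vanishing, so they are applied to the difference of
        the two lifted vectors.\<close>
      have "eval (\<lambda>l. ?u l - ?v l) x = eval ?u x - eval ?v x"
        by (simp add: eval_def left_diff_distrib sum_subtractf)
      then have "act u (simple_root s) x = act v (simple_root s) x \<longleftrightarrow> eval (\<lambda>l. ?u l - ?v l) x = 0"
        using eval_word u v s x by simp
      also have "\<dots> \<longleftrightarrow> (\<forall>P\<in>set (Ps x). (\<Sum>l<N. P l * (?u l - ?v l)) = 0)" by (rule Ps)
      also have "\<dots> \<longleftrightarrow> (\<forall>P\<in>set (Ps x). series N A (P, e s) u = series N A (P, e s) v)"
        by (simp add: series_def right_diff_distrib sum_subtractf)
      finally show "act u (simple_root s) x = act v (simple_root s) x \<longleftrightarrow>
          (\<forall>P\<in>set (Ps x). series N A (P, e s) u = series N A (P, e s) v)" .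
    qed
    also have "\<dots> \<longleftrightarrow> (\<forall>t\<in>set ts. series N A t u = series N A t v)"
      unfolding ts by blast
    finally show ?thesis .
  qed
  then show ?thesis by blast
qed

end

section \<open>Correctness of the comparison and the final assembly\<close>

lemma residue_eq_iff: "0 < k \<Longrightarrow> residue k a = residue k b \<longleftrightarrow> int k dvd a - b"
  using eq_nat_nat_iff[of "a mod int k" "b mod int k"] by (simp add: residue_def mod_eq_dvd_iff)

text \<open>The length bound has the form in which the exponent of \<open>series_bound\<close> needs
  it, proportional to the factor \<open>length w + 1\<close> of the bound for the moduli.\<close>

lemma (in coxeter) conj_word:
  assumes "w \<in> lists S" "0 < i" "i \<le> length w"
  shows "conj_word w i \<in> lists S" "length (conj_word w i) + 2 \<le> 2 * (length w + 1)"
    "element_of S m (conj_word w i) = reflection (take (i - 1) w) (w ! (i - 1))"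
proof -
  obtain j where j: "i = Suc j" using assms(2) by (cases i) auto
  then have eq: "conj_word w i = take j w @ [w ! j] @ rev (take j w)"
    using assms(3) by (simp add: conj_word_def take_Suc_conv_app_nth)
  show "conj_word w i \<in> lists S"
    unfolding eq using assms(1,3) j by (auto dest: in_set_takeD)
  show "length (conj_word w i) + 2 \<le> 2 * (length w + 1)"
    unfolding eq using assms(3) j by simp
  show "element_of S m (conj_word w i) = reflection (take (i - 1) w) (w ! (i - 1))"
    unfolding eq reflection_def using j by simp
qed

theorem theorem6:
  fixes S :: "'a::linorder set" and m :: "'a \<Rightarrow> 'a \<Rightarrow> nat"
  assumes "even_coxeter_matrix S m"
  shows "\<exists>T :: ('a, output_symbol) transducer. logspace_transducer S T \<and>
           (\<forall>w\<in>lists S.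
              computes T w (encode_vector S (parikh_image S (shortlex_nf S m (element_of S m w)))))"
proof -
  interpret even_coxeter S m
    using assms by unfold_locales (auto simp: even_coxeter_matrix_def)
  obtain N A ts where rep: "\<And>u v. u \<in> lists S \<Longrightarrow> v \<in> lists S \<Longrightarrow>
      element_of S m u = element_of S m v \<longleftrightarrow> (\<forall>t\<in>set ts. series N A t u = series N A t v)"
    using integer_representation by blast
  obtain B where B: "\<And>u t. u \<in> lists S \<Longrightarrow> t \<in> set ts \<Longrightarrow> \<bar>series N A t u\<bar> \<le> (2 ^ B) ^ (length u + 2)"
    using series_bound[OF finS] by blast
  \<comment> \<open>Two values bounded by \<open>2 ^ (2 * B * (n + 1))\<close> differ by at most
    \<open>2 ^ (2 * B * (n + 1) + 1)\<close>. This has to be below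
    \<open>2 ^ (C * (n + 1) - 1)\<close>, which \<open>C = 2 * B + 3\<close> ensures even for
    \<open>n = 0\<close>.\<close>
  define C where "C = 2 * B + 3"
  let ?r = "\<lambda>w i. reflection (take (i - 1) w) (w ! (i - 1))"
  have dist: "distinguished N A ts (C * (length w + 1)) w i j \<longleftrightarrow> ?r w j \<noteq> ?r w i"
    if w: "w \<in> lists S" and i: "0 < i" "i \<le> length w" and j: "0 < j" "j \<le> length w" for w i j
  proof -
    note ci = conj_word[OF w i] and cj = conj_word[OF w j]
    let ?n = "length w"
    have diff: "series N A t (conj_word w i) = series N A t (conj_word w j)"
      if nd: "\<not> distinguished N A ts (C * (?n + 1)) w i j" and t: "t \<in> set ts" for t
    proof -
      let ?z = "series N A t (conj_word w i) - series N A t (conj_word w j)"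
      \<comment> \<open>One less than the number of moduli, since
        \<open>zero_if_many_divisors\<close> trades \<open>Suc M\<close> divisors for the bound
        \<open>2 ^ M\<close>.\<close>
      define M where "M = C * (?n + 1) - 1"
      have M: "Suc M = C * (?n + 1)" by (simp add: M_def C_def)
      have "int k dvd ?z" if "k \<in> {1..Suc M}" for k
        using nd t that residue_eq_iff[of k] unfolding M distinguished_def differ_def by fastforce
      moreover have "\<bar>?z\<bar> < 2 ^ M"
      proof -
        have pow: "(2 ^ B) ^ (length u + 2) \<le> (2 :: int) ^ (B * (2 * (?n + 1)))"
          if "length u + 2 \<le> 2 * (?n + 1)" for u :: "'a list"
          unfolding power_mult[symmetric] using that by (intro power_increasing mult_left_mono) auto
        have "\<bar>?z\<bar> \<le> \<bar>series N A t (conj_word w i)\<bar> + \<bar>series N A t (conj_word w j)\<bar>"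
          by (rule abs_triangle_ineq4)
        also have "\<dots> \<le> 2 ^ (B * (2 * (?n + 1))) + 2 ^ (B * (2 * (?n + 1)))"
          using B[OF ci(1) t] B[OF cj(1) t] pow[OF ci(2)] pow[OF cj(2)] by linarith
        also have "\<dots> = 2 ^ Suc (B * (2 * (?n + 1)))" by simp
        also have "\<dots> < 2 ^ M"
          by (rule power_strict_increasing) (auto simp: M_def C_def algebra_simps)
        finally show ?thesis .
      qed
      ultimately have "?z = 0" by (rule zero_if_many_divisors)
      then show ?thesis by simp
    qed
    have "?r w j = ?r w i \<longleftrightarrow> (\<forall>t\<in>set ts. series N A t (conj_word w i) = series N A t (conj_word w j))"
      using rep[OF ci(1) cj(1)] unfolding ci(3) cj(3) by auto
    then show ?thesis
      using diff unfolding distinguished_def differ_def by metis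
  qed
  define f where "f w a i = card (inversions (take i w) a)" for w a i
  have parity: "odd (card {j \<in> {1..Suc i}. \<not> distinguished N A ts (C * (length w + 1)) w (Suc i) j}) \<longleftrightarrow>
      \<not> par (take i w) (reflection (take i w) (w ! i))"
    if w: "w \<in> lists S" and i: "i < length w" for w i
  proof -
    \<comment> \<open>Position \<open>Suc i\<close> always matches itself. Removing it leaves the
      count of \<open>par_take\<close> and turns odd into even, hence the negation.\<close>
    have "{j \<in> {1..Suc i}. \<not> distinguished N A ts (C * (length w + 1)) w (Suc i) j} =
        insert (Suc i) {j \<in> {1..i}. ?r w j = ?r w (Suc i)}"
      using dist[OF w] i by (auto simp: le_Suc_eq)
    moreover have "reflection (take i w) (w ! i) \<in> carrier (coxeter_group S m)"
      by (rule reflection_closed) (use w i in \<open>auto dest: in_set_takeD\<close>)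
    ultimately show ?thesis
      using par_take[OF w, of i "?r w (Suc i)"] i by simp
  qed
  have "\<exists>T :: ('a, output_symbol) transducer. logspace_transducer S T \<and>
      (\<forall>w\<in>lists S. computes T w (encode_vector S (\<lambda>a. f w a (length w))))"
  proof (rule logspace_parikh[OF finS, where C = C and N = N and A = A and ts = ts and f = f])
    fix w a i assume w: "w \<in> lists S"
    show "f w a 0 = 0" by (simp add: f_def inversions_def)
    assume i: "i < length w"
    have take: "take i w \<in> lists S" "w ! i \<in> S" "take (Suc i) w = take i w @ [w ! i]"
      using w i by (auto dest: in_set_takeD simp: take_Suc_conv_app_nth)
    note step = card_inversions_snoc[OF take(1,2), folded take(3)]
    show "f w a i \<le> length w"
      using card_inversions_le[OF take(1), of a] i by (simp add: f_def)
    show "f w a (Suc i) = f w a i" if "w ! i \<noteq> a"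
      using step(1)[of a] that by (simp add: f_def)
    show "f w a (Suc i) = f w a i + 1" if "w ! i = a"
      "odd (card {j \<in> {1..Suc i}. \<not> distinguished N A ts (C * (length w + 1)) w (Suc i) j})"
      using step(2) that parity[OF w i] unfolding f_def by blast
    show "f w a i = f w a (Suc i) + 1" if "w ! i = a"
      "even (card {j \<in> {1..Suc i}. \<not> distinguished N A ts (C * (length w + 1)) w (Suc i) j})"
      using step(3) that parity[OF w i] unfolding f_def by blast
  qed
  moreover have "encode_vector S (\<lambda>a. f w a (length w)) =
      encode_vector S (parikh_image S (shortlex_nf S m (element_of S m w)))" if "w \<in> lists S" for w
    unfolding encode_vector_def parikh_image_def
    using finS shortlex_nf_count[OF assms that]
    by (intro arg_cong[of _ _ concat] map_cong HOL.refl) (simp add: f_def)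
  ultimately show ?thesis by auto
qed

end
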